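(* For every $\lambda$ with $0<\lambda<2$ there exists a constant $A_\lambda>0$, depending only on $\lambda$, such that for any solution $u$ of the Navier-Stokes equations $$\partial_t u-\Delta u+\operatorname{div}(u\otimes u)+\nabla p=0,\qquad \operatorname{div}(u)=0$$ on $(0,\infty)\times\mathbb{R}^3$, and for any $T>\lambda$, $$\|u(T,\cdot)\|_{L^\infty(\mathbb{R}^3)}\le A_\lambda\Big\{1+\int_0^T\int_{\mathbb{R}^3}|u|^6\,dx\,ds\Big\}.$$
   Context: Here $u$ takes values in $\mathbb{R}^3$ and $p$ is scalar. A solution on $(0,\infty)\times\mathbb{R}^3$ means a weak solution in the energy class: $u\in L^\infty(0,\infty;L^2(\mathbb{R}^3))\cap L^2(0,\infty;\dot H^1(\mathbb{R}^3))$ satisfying the equations in the sense of distributions (for some pressure distribution $p$), taken in its representative that is weakly continuous in time with values in $L^2(\mathbb{R}^3)$. The right-hand side is allowed to be $+\infty$, in which case the inequality is vacuous. *)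

theory Defs
  imports "HOL-Analysis.Analysis" "HOL-Probability.Essential_Supremum"
begin

definition pderiv_dir :: "'a::euclidean_space \<Rightarrow> ('a \<Rightarrow> real) \<Rightarrow> 'a \<Rightarrow> real" where
  "pderiv_dir v f x = frechet_derivative f (at x) v"

text \<open>\<^term>\<open>pderivs [v, w] f\<close> differentiates first along \<^term>\<open>w\<close>, then along \<^term>\<open>v\<close>.\<close>

primrec pderivs :: "'a::euclidean_space list \<Rightarrow> ('a \<Rightarrow> real) \<Rightarrow> 'a \<Rightarrow> real" where
  "pderivs [] f = f"
| "pderivs (v # vs) f = pderiv_dir v (pderivs vs f)"

text \<open>Frechet differentiability of every iterated partial derivative makes all of them exist
  and be continuous, so this is $C^\infty$.\<close>

definition smooth :: "('a::euclidean_space \<Rightarrow> real) \<Rightarrow> bool" where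
  "smooth f \<longleftrightarrow> (\<forall>vs. set vs \<subseteq> Basis \<longrightarrow> pderivs vs f differentiable_on UNIV)"

text \<open>The space $C_c^\infty(\Omega)$; its elements are extended by zero to the whole space.\<close>

definition test_functions :: "'a::euclidean_space set \<Rightarrow> ('a \<Rightarrow> real) set" where
  "test_functions \<Omega> = {\<phi>. smooth \<phi> \<and> compact (closure (support_on UNIV \<phi>))
                            \<and> closure (support_on UNIV \<phi>) \<subseteq> \<Omega>}"

text \<open>Distributions on an open set \<open>\<Omega>\<close> are represented by functionals of which only
  the values on test functions matter. Continuity is the usual seminorm estimate on every
  compact subset.\<close>

definition distribution_on :: "'a::euclidean_space set \<Rightarrow> (('a \<Rightarrow> real) \<Rightarrow> real) \<Rightarrow> bool" where
  "distribution_on \<Omega> D \<longleftrightarrow>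
     (\<forall>\<phi>\<in>test_functions \<Omega>. \<forall>\<psi>\<in>test_functions \<Omega>. D (\<lambda>x. \<phi> x + \<psi> x) = D \<phi> + D \<psi>) \<and>
     (\<forall>c. \<forall>\<phi>\<in>test_functions \<Omega>. D (\<lambda>x. c * \<phi> x) = c * D \<phi>) \<and>
     (\<forall>K. compact K \<and> K \<subseteq> \<Omega> \<longrightarrow>
        (\<exists>C N. \<forall>\<phi>\<in>test_functions \<Omega>. closure (support_on UNIV \<phi>) \<subseteq> K \<longrightarrow>
           \<bar>D \<phi>\<bar> \<le> C * (\<Sum>vs | set vs \<subseteq> Basis \<and> length vs \<le> N. SUP x. \<bar>pderivs vs \<phi> x\<bar>)))"

definition dist_of :: "'a::euclidean_space set \<Rightarrow> ('a \<Rightarrow> real) \<Rightarrow> ('a \<Rightarrow> real) \<Rightarrow> real" where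
  "dist_of \<Omega> f \<phi> = (\<integral>x. f x * \<phi> x \<partial>lebesgue_on \<Omega>)"

definition dist_deriv ::
    "'a::euclidean_space \<Rightarrow> (('a \<Rightarrow> real) \<Rightarrow> real) \<Rightarrow> ('a \<Rightarrow> real) \<Rightarrow> real" where
  "dist_deriv v D \<phi> = - D (pderiv_dir v \<phi>)"

definition sq_L2_norm :: "('a::euclidean_space \<Rightarrow> 'b::real_normed_vector) \<Rightarrow> ennreal" where
  "sq_L2_norm f = (\<integral>\<^sup>+x. ennreal ((norm (f x))\<^sup>2) \<partial>lebesgue)"

definition L2 :: "('a::euclidean_space \<Rightarrow> 'b::euclidean_space) set" where
  "L2 = {f. f \<in> borel_measurable lebesgue \<and> sq_L2_norm f < \<infinity>}"

definition weak_gradient :: "(real^3 \<Rightarrow> real^3) \<Rightarrow> (real^3 \<Rightarrow> real^3^3) \<Rightarrow> bool" where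
  "weak_gradient f G \<longleftrightarrow>
     (\<forall>i j. \<forall>\<phi>\<in>test_functions UNIV.
        dist_deriv (axis j 1) (dist_of UNIV (\<lambda>x. f x $ i)) \<phi> = dist_of UNIV (\<lambda>x. G x $ i $ j) \<phi>)"

abbreviation spacetime :: "(real \<times> (real^3)) set" where
  "spacetime \<equiv> {0<..} \<times> UNIV"

abbreviation e_time :: "real \<times> (real^3)" where
  "e_time \<equiv> (1, 0)"

abbreviation e_space :: "3 \<Rightarrow> real \<times> (real^3)" where
  "e_space j \<equiv> (0, axis j 1)"

text \<open>Membership in $L^\infty(0,\infty;L^2) \cap L^2(0,\infty;\dot H^1)$. Measurability in time
  with values in these separable spaces is joint Lebesgue measurability in time and space.
  The norm of \<^term>\<open>G t x\<close> is the Euclidean norm of the nine entries of the gradient.\<close>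

definition energy_class :: "(real \<Rightarrow> real^3 \<Rightarrow> real^3) \<Rightarrow> bool" where
  "energy_class u \<longleftrightarrow>
     (\<lambda>(t, x). u t x) \<in> borel_measurable (lebesgue_on spacetime) \<and>
     (\<exists>C::real. AE t in lebesgue_on {0<..}. u t \<in> L2 \<and> sq_L2_norm (u t) \<le> ennreal C) \<and>
     (\<exists>G. (\<lambda>(t, x). G t x) \<in> borel_measurable (lebesgue_on spacetime) \<and>
          (AE t in lebesgue_on {0<..}. G t \<in> L2 \<and> weak_gradient (u t) (G t)) \<and>
          (\<integral>\<^sup>+t\<in>{0<..}. sq_L2_norm (G t) \<partial>lebesgue) < \<infinity>)"

definition weakly_continuous_L2 :: "(real \<Rightarrow> real^3 \<Rightarrow> real^3) \<Rightarrow> bool" where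
  "weakly_continuous_L2 u \<longleftrightarrow>
     (\<forall>t>0. u t \<in> L2) \<and>
     (\<forall>w\<in>L2. continuous_on {0<..} (\<lambda>t. \<integral>x. u t x \<bullet> w x \<partial>lebesgue))"

definition NS_equations ::
    "(real \<Rightarrow> real^3 \<Rightarrow> real^3) \<Rightarrow> ((real \<times> (real^3) \<Rightarrow> real) \<Rightarrow> real) \<Rightarrow> bool" where
  "NS_equations u p \<longleftrightarrow>
     (\<forall>\<phi>\<in>test_functions spacetime.
        (\<forall>i. dist_deriv e_time (dist_of spacetime (\<lambda>(t, x). u t x $ i)) \<phi>
           - (\<Sum>j\<in>UNIV. dist_deriv (e_space j)
                (dist_deriv (e_space j) (dist_of spacetime (\<lambda>(t, x). u t x $ i))) \<phi>)
           + (\<Sum>j\<in>UNIV. dist_deriv (e_space j)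
                (dist_of spacetime (\<lambda>(t, x). u t x $ i * u t x $ j)) \<phi>)
           + dist_deriv (e_space i) p \<phi> = 0) \<and>
        (\<Sum>j\<in>UNIV. dist_deriv (e_space j) (dist_of spacetime (\<lambda>(t, x). u t x $ j)) \<phi>) = 0)"

definition NS_solution :: "(real \<Rightarrow> real^3 \<Rightarrow> real^3) \<Rightarrow> bool" where
  "NS_solution u \<longleftrightarrow>
     energy_class u \<and> weakly_continuous_L2 u \<and>
     (\<exists>p. distribution_on spacetime p \<and> NS_equations u p)"

end

theory Submission
  imports Defs
begin

text \<open>
  Let $\Gamma$ be the heat kernel. Choosing the divergence-free test field
  $\nabla\partial_k\Psi - e_k\Delta\Psi$ removes the pressure. With
  $\Psi = a(t) \Gamma_{t_0-t+s}(x-y)$ the linear part of the equation becomes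
  $a'\Delta\Gamma = a'\partial_s\Gamma$, while the third derivatives of $\Psi$ are at most
  $C(t_0-t+s+|x-y|^2)^{-3}$. Integrating over $s\in(\varepsilon,\infty)$ therefore produces an
  Oseen-type estimate, without constructing the Oseen kernel: for a time cutoff $\eta$
  vanishing near $T-R$, almost everywhere on $(T-R,T)\times\mathbb{R}^3$,
  $$\eta|u| \le M + C K * (|u|\cdot\eta|u|),\qquad K(\tau,x)=(\tau+|x|^2)^{-2},$$
  where $M$ is a multiple of $R^{-1} (\tau+|x|^2)^{-3/2} * |u|$.
  Since $K\in L^{6/5}$ on bounded time intervals, Hoelder's inequality shows that for
  $R = c (1+\int\int|u|^6)^{-2}$ the linear operator $w\mapsto C K*(|u|w)$ has norm at most
  $1/2$ on $L^\infty$ and on $L^{6/5}$. Hence $(\eta|u|-2M)_+$, which lies in $L^{6/5}$ by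
  Chebyshev, vanishes, and $M$ is of order $1+\int\int|u|^6$. Weak continuity carries the
  bound to time $T$.
\<close>

section \<open>Calculus of smooth functions\<close>

text \<open>The exponent -2 and the linear growth come from one scaling count. Let I be the integral
  of |u|^6. Over times below R the 6/5-th power of the quadratic kernel has integral of order
  R^(1/10), so Hoelder against the L^6 norm gives an operator norm of order (1 + I)^(1/6) R^(1/12),
  a small number exactly when R is a small multiple of (1 + I)^(-2). The linear term is then of
  order R^(-1) R^(7/12) (1 + I)^(1/6), that is 1 + I. The number lambda enters as an upper bound for
  R, which keeps the window inside positive times, so that no initial datum is involved. The
  obstacle is absorption: the inequality bounds |u| by an integral of |u| itself, and a norm that
  may be infinite cannot be moved to the other side. Cutting at height 2M brings the excess into
  L^(6/5), because it lives where |u| is bounded below and |u|^2 is integrable. The Hoelder constant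
  there is the same as on bounded functions, so a single choice of R serves both uses.\<close>

lemma pderiv_dir_eq:
  "(f has_derivative f') (at x) \<Longrightarrow> pderiv_dir v f x = f' v"
  unfolding pderiv_dir_def by (drule frechet_derivative_at) (rule fun_cong, erule sym)

lemma has_derivative_pderiv_dir:
  assumes "f differentiable (at x)"
  shows "(f has_derivative (\<lambda>v. pderiv_dir v f x)) (at x)"
  unfolding pderiv_dir_def using assms unfolding frechet_derivative_works .

lemma pderiv_dir_cong_open:
  assumes "open S" "x \<in> S" "\<And>y. y \<in> S \<Longrightarrow> f y = g y"
  shows "pderiv_dir v f x = pderiv_dir v g x"
proof -
  have "(f has_derivative D) (at x) \<longleftrightarrow> (g has_derivative D) (at x)" for D
    using has_derivative_transform_within_open[of f D x UNIV S g]
      has_derivative_transform_within_open[of g D x UNIV S f] assms by auto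
  then show ?thesis unfolding pderiv_dir_def frechet_derivative_def by simp
qed

lemma pderivs_cong_open:
  assumes "open S" "\<And>y. y \<in> S \<Longrightarrow> f y = g y" "x \<in> S"
  shows "pderivs vs f x = pderivs vs g x"
  using assms(3)
proof (induction vs arbitrary: x)
  case (Cons v vs)
  have "pderiv_dir v (pderivs vs f) x = pderiv_dir v (pderivs vs g) x"
    by (rule pderiv_dir_cong_open[OF assms(1) Cons.prems Cons.IH])
  then show ?case by simp
next
  case Nil
  then show ?case by (simp add: assms(2))
qed

lemma pderivs_snoc: "pderivs (vs @ [v]) f = pderivs vs (pderiv_dir v f)"
  by (induction vs) auto

text \<open>Counts orders by peeling off the innermost derivative, whereas \<open>pderivs\<close>
  peels off the outermost. In this form a calculus rule rewrites the function once, and induction on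
  the order, with the function generalised, does the rest.\<close>

primrec diff_times :: "nat \<Rightarrow> ('a::euclidean_space \<Rightarrow> real) \<Rightarrow> bool" where
  "diff_times 0 f \<longleftrightarrow> f differentiable_on UNIV"
| "diff_times (Suc n) f \<longleftrightarrow> f differentiable_on UNIV \<and> (\<forall>b\<in>Basis. diff_times n (pderiv_dir b f))"

lemma diff_times_iff:
  "diff_times n f \<longleftrightarrow> (\<forall>vs. set vs \<subseteq> Basis \<and> length vs \<le> n \<longrightarrow> pderivs vs f differentiable_on UNIV)"
proof (induction n arbitrary: f)
  case (Suc n)
  show ?case
  proof
    assume L: "diff_times (Suc n) f"
    show "\<forall>vs. set vs \<subseteq> Basis \<and> length vs \<le> Suc n \<longrightarrow> pderivs vs f differentiable_on UNIV"
    proof (intro allI impI)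
      fix vs :: "'a list" assume vs: "set vs \<subseteq> Basis \<and> length vs \<le> Suc n"
      show "pderivs vs f differentiable_on UNIV"
      proof (cases vs rule: rev_cases)
        case Nil then show ?thesis using L by simp
      next
        case (snoc us u)
        then show ?thesis using L vs Suc.IH by (auto simp: pderivs_snoc)
      qed
    qed
  next
    assume R: "\<forall>vs. set vs \<subseteq> Basis \<and> length vs \<le> Suc n \<longrightarrow> pderivs vs f differentiable_on UNIV"
    have "pderivs vs (pderiv_dir b f) differentiable_on UNIV"
      if "b \<in> Basis" "set vs \<subseteq> Basis \<and> length vs \<le> n" for b vs
      using R[rule_format, of "vs @ [b]"] that by (auto simp: pderivs_snoc)
    moreover have "f differentiable_on UNIV" using R[rule_format, of "[]"] by simp
    ultimately show "diff_times (Suc n) f" using Suc.IH by simp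
  qed
qed simp

lemma smooth_iff_diff_times: "smooth f \<longleftrightarrow> (\<forall>n. diff_times n f)"
  unfolding smooth_def diff_times_iff by auto

lemma diff_times_differentiable: "diff_times n f \<Longrightarrow> f differentiable (at x)"
  by (cases n) (auto simp: differentiable_on_def)

lemma diff_times_Suc_weaken: "diff_times (Suc n) f \<Longrightarrow> diff_times n f"
  unfolding diff_times_iff by auto

lemma smooth_differentiable: "smooth f \<Longrightarrow> f differentiable (at x)"
  by (rule diff_times_differentiable[of 0]) (simp only: smooth_iff_diff_times)

lemma smooth_has_derivative: "smooth f \<Longrightarrow> (f has_derivative (\<lambda>v. pderiv_dir v f x)) (at x)"
  by (intro has_derivative_pderiv_dir smooth_differentiable)

lemma smooth_continuous_on: "smooth f \<Longrightarrow> continuous_on S f"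
  by (intro continuous_at_imp_continuous_on ballI differentiable_imp_continuous_within smooth_differentiable)

lemma smooth_borel: "smooth f \<Longrightarrow> f \<in> borel_measurable borel"
  by (intro borel_measurable_continuous_onI smooth_continuous_on)

lemma smooth_pderiv_dir: "smooth f \<Longrightarrow> b \<in> Basis \<Longrightarrow> smooth (pderiv_dir b f)"
  unfolding smooth_iff_diff_times by (metis diff_times.simps(2))

lemma smooth_pderivs: "smooth f \<Longrightarrow> set vs \<subseteq> Basis \<Longrightarrow> smooth (pderivs vs f)"
  by (induction vs) (auto intro: smooth_pderiv_dir)

section \<open>Sum, product, chain and quotient rules; closure of smoothness\<close>

lemma pderiv_dir_add:
  assumes "f differentiable (at x)" "g differentiable (at x)"
  shows "pderiv_dir v (\<lambda>x. f x + g x) x = pderiv_dir v f x + pderiv_dir v g x"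
  by (rule pderiv_dir_eq)
     (rule has_derivative_add[OF has_derivative_pderiv_dir[OF assms(1)] has_derivative_pderiv_dir[OF assms(2)]])

lemma pderiv_dir_mult:
  fixes f g :: "'a::euclidean_space \<Rightarrow> real"
  assumes "f differentiable (at x)" "g differentiable (at x)"
  shows "pderiv_dir v (\<lambda>x. f x * g x) x = pderiv_dir v f x * g x + f x * pderiv_dir v g x"
  using pderiv_dir_eq[OF has_derivative_mult[OF has_derivative_pderiv_dir[OF assms(1)]
      has_derivative_pderiv_dir[OF assms(2)]], of v]
  by simp

lemma pderiv_dir_const: "pderiv_dir v (\<lambda>x. c) x = 0"
  by (rule pderiv_dir_eq) (rule has_derivative_const)

lemma pderiv_dir_compose:
  fixes h :: "real \<Rightarrow> real"
  assumes "f differentiable (at x)" "h differentiable (at (f x))"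
  shows "pderiv_dir v (\<lambda>x. h (f x)) x = pderiv_dir 1 h (f x) * pderiv_dir v f x"
proof -
  have h: "(h has_derivative (\<lambda>u. pderiv_dir u h (f x))) (at (f x))"
    using has_derivative_pderiv_dir assms by blast
  have "pderiv_dir (c *\<^sub>R 1) h (f x) = c *\<^sub>R pderiv_dir 1 h (f x)" for c
    using linear_scale[OF has_derivative_linear[OF h]] by blast
  then have *: "pderiv_dir c h (f x) = c * pderiv_dir 1 h (f x)" for c
    by (metis mult.right_neutral real_scaleR_def)
  from has_derivative_compose[OF has_derivative_pderiv_dir[OF assms(1)] h]
  have "pderiv_dir v (\<lambda>x. h (f x)) x = pderiv_dir (pderiv_dir v f x) h (f x)"
    by (rule pderiv_dir_eq)
  then show ?thesis by (simp only: *[of "pderiv_dir v f x"] mult.commute)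
qed

lemma pderiv_dir_inverse:
  fixes f :: "'a::euclidean_space \<Rightarrow> real"
  assumes "f differentiable (at x)" "f x \<noteq> 0"
  shows "pderiv_dir v (\<lambda>x. inverse (f x)) x = - (inverse (f x) * pderiv_dir v f x * inverse (f x))"
  by (rule pderiv_dir_eq[OF Deriv.has_derivative_inverse[OF assms(2) has_derivative_pderiv_dir[OF assms(1)]]])

lemma diff_times_const: "diff_times n (\<lambda>x. c)"
proof (induction n arbitrary: c)
  case (Suc n)
  have "pderiv_dir b (\<lambda>x::'a. c) = (\<lambda>x. 0)" for b
    by (rule ext) (rule pderiv_dir_const)
  then show ?case using Suc by simp
qed simp

lemma diff_times_add:
  "diff_times n f \<Longrightarrow> diff_times n g \<Longrightarrow> diff_times n (\<lambda>x. f x + g x)"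
proof (induction n arbitrary: f g)
  case (Suc n)
  have "pderiv_dir b (\<lambda>x. f x + g x) = (\<lambda>x. pderiv_dir b f x + pderiv_dir b g x)" for b
    by (rule ext) (intro pderiv_dir_add diff_times_differentiable[OF Suc.prems(1)]
        diff_times_differentiable[OF Suc.prems(2)])
  then show ?case using Suc by auto
qed auto

lemma diff_times_mult:
  "diff_times n f \<Longrightarrow> diff_times n g \<Longrightarrow> diff_times n (\<lambda>x. f x * g x)"
proof (induction n arbitrary: f g)
  case (Suc n)
  have "pderiv_dir b (\<lambda>x. f x * g x) = (\<lambda>x. pderiv_dir b f x * g x + f x * pderiv_dir b g x)" for b
    by (rule ext) (intro pderiv_dir_mult diff_times_differentiable[OF Suc.prems(1)]
        diff_times_differentiable[OF Suc.prems(2)])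
  moreover have "diff_times n f" "diff_times n g"
    using Suc.prems diff_times_Suc_weaken by auto
  ultimately show ?case using Suc by (auto intro!: diff_times_add)
qed auto

text \<open>The outer function is generalised in the induction, because after one differentiation
  the composition carries the derivative of \<open>h\<close> in place of \<open>h\<close>.\<close>

lemma diff_times_compose:
  fixes h :: "real \<Rightarrow> real"
  shows "smooth h \<Longrightarrow> diff_times n f \<Longrightarrow> diff_times n (\<lambda>x. h (f x))"
proof (induction n arbitrary: h)
  case 0
  then show ?case
    using differentiable_chain_at[of f _ h] smooth_differentiable[of h]
    by (auto simp: differentiable_on_def o_def)
next
  case (Suc n)
  have d: "f differentiable (at x)" for x using Suc.prems diff_times_differentiable by blast
  have "pderiv_dir b (\<lambda>x. h (f x)) = (\<lambda>x. pderiv_dir 1 h (f x) * pderiv_dir b f x)" for b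
    by (rule ext) (intro pderiv_dir_compose d smooth_differentiable Suc.prems)
  moreover have "diff_times n (\<lambda>x. pderiv_dir 1 h (f x))"
    using Suc.IH[of "pderiv_dir 1 h"] Suc.prems smooth_pderiv_dir[of h 1]
      diff_times_Suc_weaken by auto
  moreover have "(\<lambda>x. h (f x)) differentiable_on UNIV"
    using differentiable_chain_at[OF d, of h] smooth_differentiable[of h] Suc.prems
    by (auto simp: differentiable_on_def o_def)
  ultimately show ?case using Suc.prems by (auto intro!: diff_times_mult)
qed

text \<open>The derivative is a derivative of \<open>f\<close> times two copies of the same
  reciprocal, so a lower order of that reciprocal suffices and the induction keeps \<open>f\<close>
  fixed.\<close>

lemma diff_times_inverse:
  "diff_times n f \<Longrightarrow> (\<And>x. f x \<noteq> 0) \<Longrightarrow> diff_times n (\<lambda>x. inverse (f x))"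
proof (induction n)
  case (Suc n)
  have d: "f differentiable (at x)" for x using Suc.prems diff_times_differentiable by blast
  have "pderiv_dir b (\<lambda>x. inverse (f x))
      = (\<lambda>x. (-1) * (inverse (f x) * pderiv_dir b f x * inverse (f x)))" for b
    by (rule ext) (subst pderiv_dir_inverse, use d Suc.prems in auto)
  moreover have "diff_times n (\<lambda>x. inverse (f x))"
    using Suc diff_times_Suc_weaken by blast
  moreover have "(\<lambda>x. inverse (f x)) differentiable_on UNIV"
    using Suc.prems by (auto intro!: differentiable_inverse d simp: differentiable_on_def)
  moreover have "diff_times n (\<lambda>x. (-1) * (inverse (f x) * pderiv_dir b f x * inverse (f x)))"
    if "b \<in> Basis" for b
    using Suc.prems that calculation(2) by (intro diff_times_mult diff_times_const) auto
  ultimately show ?case by simp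
qed (auto intro!: differentiable_inverse simp: differentiable_on_def)

lemma smooth_const [simp]: "smooth (\<lambda>x. c)"
  by (simp add: smooth_iff_diff_times diff_times_const)

lemma smooth_add: "smooth f \<Longrightarrow> smooth g \<Longrightarrow> smooth (\<lambda>x. f x + g x)"
  unfolding smooth_iff_diff_times using diff_times_add by blast

lemma smooth_mult: "smooth f \<Longrightarrow> smooth g \<Longrightarrow> smooth (\<lambda>x. f x * g x)"
  unfolding smooth_iff_diff_times using diff_times_mult by blast

lemma smooth_compose:
  fixes h :: "real \<Rightarrow> real"
  shows "smooth h \<Longrightarrow> smooth f \<Longrightarrow> smooth (\<lambda>x. h (f x))"
  using diff_times_compose[of h] unfolding smooth_iff_diff_times[of f] smooth_iff_diff_times[of "\<lambda>x. h (f x)"]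
  by blast

lemma smooth_inverse: "smooth f \<Longrightarrow> (\<And>x. f x \<noteq> 0) \<Longrightarrow> smooth (\<lambda>x. inverse (f x))"
  unfolding smooth_iff_diff_times using diff_times_inverse by blast

lemma smooth_uminus: "smooth f \<Longrightarrow> smooth (\<lambda>x. - f x)"
  using smooth_mult[OF smooth_const[of "-1"], of f] by simp

lemma smooth_diff: "smooth f \<Longrightarrow> smooth g \<Longrightarrow> smooth (\<lambda>x. f x - g x)"
  using smooth_add[OF _ smooth_uminus, of f g] by simp

lemma smooth_sum: "(\<And>i. i \<in> A \<Longrightarrow> smooth (f i)) \<Longrightarrow> smooth (\<lambda>x. \<Sum>i\<in>A. f i x)"
  by (induction A rule: infinite_finite_induct) (auto intro!: smooth_add)

text \<open>Replaces an induction on the order when a class of differentiable functions is stable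
  under partial differentiation, as the class containing just \<open>exp\<close> is.\<close>

lemma smooth_coinduct:
  assumes "P f" "\<And>f. P f \<Longrightarrow> f differentiable_on UNIV"
    "\<And>f b. P f \<Longrightarrow> b \<in> Basis \<Longrightarrow> P (pderiv_dir b f)"
  shows "smooth f"
proof -
  have "P (pderivs vs f)" if "set vs \<subseteq> Basis" for vs
    using that by (induction vs) (use assms in auto)
  then show ?thesis using assms(2) by (auto simp: smooth_def)
qed

lemma smooth_linear: 
  assumes "bounded_linear f" shows "smooth f"
proof -
  have d: "(f has_derivative f) (at x)" for x
    using assms bounded_linear_imp_has_derivative by blast
  have "pderiv_dir b f = (\<lambda>x. f b)" for b
    by (rule ext) (rule pderiv_dir_eq[OF d])
  then have "diff_times n f" for n
    using d by (cases n) (auto simp: diff_times_const differentiable_on_def differentiable_def)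
  then show ?thesis by (simp add: smooth_iff_diff_times)
qed

lemma smooth_exp: "smooth (exp :: real \<Rightarrow> real)"
proof (rule smooth_coinduct[where P="\<lambda>f. f = exp"])
  fix f :: "real \<Rightarrow> real" and b :: real assume "f = exp" "b \<in> Basis"
  moreover have "pderiv_dir 1 exp x = exp x" for x :: real
    by (rule trans, rule pderiv_dir_eq[where f'="\<lambda>u. u * exp x"])
       (auto intro!: derivative_eq_intros)
  ultimately show "pderiv_dir b f = exp" by auto
next
  fix f :: "real \<Rightarrow> real" assume "f = exp"
  then show "f differentiable_on UNIV"
    by (auto simp: differentiable_on_def intro!: field_differentiable_imp_differentiable
        field_differentiable_within_exp)
qed simp

lemma smooth_ln:
  assumes "smooth f" "\<And>x. 0 < f x" shows "smooth (\<lambda>x. ln (f x))"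
proof -
  have d: "((\<lambda>x. ln (f x)) has_derivative (\<lambda>v. pderiv_dir v f x * inverse (f x))) (at x)" for x
    using assms by (auto intro!: derivative_eq_intros smooth_has_derivative)
  have "pderiv_dir b (\<lambda>x. ln (f x)) = (\<lambda>x. pderiv_dir b f x * inverse (f x))" for b
    by (rule ext) (rule pderiv_dir_eq[OF d])
  moreover have "smooth (\<lambda>x. inverse (f x))"
    using assms by (intro smooth_inverse) (auto simp: less_imp_neq[symmetric] dest: less_imp_neq)
  ultimately have "diff_times n (\<lambda>x. ln (f x))" for n
    using d smooth_pderiv_dir[OF assms(1)]
    by (cases n) (auto simp: differentiable_on_def differentiable_def smooth_iff_diff_times intro!: diff_times_mult)
  then show ?thesis by (simp add: smooth_iff_diff_times)
qed

section \<open>Symmetry of mixed partial derivatives\<close>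

lemma smooth_second_difference:
  fixes f :: "'a::euclidean_space \<Rightarrow> real"
  assumes f: "smooth f" and v: "v \<in> Basis" and w: "w \<in> Basis" and h: "0 < h"
  shows "\<exists>s t. 0 < s \<and> s < h \<and> 0 < t \<and> t < h \<and>
    f (x + h *\<^sub>R v + h *\<^sub>R w) - f (x + h *\<^sub>R v) - f (x + h *\<^sub>R w) + f x
     = h * h * pderiv_dir w (pderiv_dir v f) (x + s *\<^sub>R v + t *\<^sub>R w)"
proof -
  have line: "((\<lambda>s. g (c + s *\<^sub>R u)) has_real_derivative pderiv_dir u g (c + s *\<^sub>R u)) (at s)"
    if "smooth g" for g :: "'a \<Rightarrow> real" and c u s
  proof -
    have 1: "((\<lambda>s. c + s *\<^sub>R u) has_derivative (\<lambda>k. k *\<^sub>R u)) (at s)"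
      using has_derivative_add[OF has_derivative_const
          bounded_linear_imp_has_derivative[OF bounded_linear_scaleR_left[of u]], of c "at s"] by simp
    define D where "D = (\<lambda>v. pderiv_dir v g (c + s *\<^sub>R u))"
    have D: "(g has_derivative D) (at (c + s *\<^sub>R u))"
      unfolding D_def by (rule smooth_has_derivative[OF that])
    have "((\<lambda>s. g (c + s *\<^sub>R u)) has_derivative (\<lambda>k. D (k *\<^sub>R u))) (at s)"
      by (rule has_derivative_compose[OF 1 D])
    moreover have "D (k *\<^sub>R u) = pderiv_dir u g (c + s *\<^sub>R u) * k" for k
      using linear_scale[OF has_derivative_linear[OF D], of k u] by (simp add: mult.commute D_def)
    ultimately show ?thesis by (simp add: has_field_derivative_def)
  qed
  \<comment> \<open>The second difference is the increment of \<open>\<phi>\<close> from 0 to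
    \<open>h\<close>. The mean value theorem is applied along \<open>v\<close> to
    \<open>\<phi>\<close>, and then along \<open>w\<close> to the difference of derivatives that it
    produces.\<close>
  define \<phi> where "\<phi> s = f ((x + h *\<^sub>R w) + s *\<^sub>R v) - f (x + s *\<^sub>R v)" for s
  have d\<phi>: "(\<phi> has_real_derivative
      (pderiv_dir v f ((x + h *\<^sub>R w) + s *\<^sub>R v) - pderiv_dir v f (x + s *\<^sub>R v))) (at s)" for s
    unfolding \<phi>_def by (rule DERIV_diff[OF line[OF f] line[OF f]])
  obtain s where s: "0 < s" "s < h"
    "\<phi> h - \<phi> 0 = (h - 0) * (pderiv_dir v f ((x + h *\<^sub>R w) + s *\<^sub>R v) - pderiv_dir v f (x + s *\<^sub>R v))"
    using MVT2[OF h, of \<phi> "\<lambda>s. pderiv_dir v f ((x + h *\<^sub>R w) + s *\<^sub>R v) - pderiv_dir v f (x + s *\<^sub>R v)"] d\<phi>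
    by auto
  obtain t where t: "0 < t" "t < h"
    "pderiv_dir v f ((x + s *\<^sub>R v) + h *\<^sub>R w) - pderiv_dir v f ((x + s *\<^sub>R v) + 0 *\<^sub>R w)
      = (h - 0) * pderiv_dir w (pderiv_dir v f) ((x + s *\<^sub>R v) + t *\<^sub>R w)"
    using MVT2[OF h, of "\<lambda>t. pderiv_dir v f ((x + s *\<^sub>R v) + t *\<^sub>R w)"
        "\<lambda>t. pderiv_dir w (pderiv_dir v f) ((x + s *\<^sub>R v) + t *\<^sub>R w)"]
      line[OF smooth_pderiv_dir[OF f v], of "x + s *\<^sub>R v" w] by auto
  have c: "x + h *\<^sub>R v + h *\<^sub>R w = x + h *\<^sub>R w + h *\<^sub>R v" "x + s *\<^sub>R v + h *\<^sub>R w = x + h *\<^sub>R w + s *\<^sub>R v"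
    by (simp_all add: add.assoc add.commute)
  have "f (x + h *\<^sub>R v + h *\<^sub>R w) - f (x + h *\<^sub>R v) - f (x + h *\<^sub>R w) + f x = \<phi> h - \<phi> 0"
    unfolding \<phi>_def c by simp
  also have "\<dots> = h * h * pderiv_dir w (pderiv_dir v f) (x + s *\<^sub>R v + t *\<^sub>R w)"
    unfolding s(3) using t(3) unfolding c by (simp add: mult.assoc)
  finally show ?thesis using s(1,2) t(1,2) by blast
qed

text \<open>The second difference quotient is symmetric in the two directions, and as the step tends
  to 0 it converges to either mixed derivative, since both are continuous.\<close>

lemma pderiv_dir_commute:
  fixes f :: "'a::euclidean_space \<Rightarrow> real"
  assumes f: "smooth f" and v: "v \<in> Basis" and w: "w \<in> Basis"
  shows "pderiv_dir v (pderiv_dir w f) = pderiv_dir w (pderiv_dir v f)"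
proof
  fix x
  let ?h = "\<lambda>n. 1 / real (Suc n)"
  have h: "?h \<longlonglongrightarrow> 0" by (rule lim_1_over_n[THEN LIMSEQ_Suc])
  define \<Delta> where "\<Delta> n = f (x + ?h n *\<^sub>R v + ?h n *\<^sub>R w) - f (x + ?h n *\<^sub>R v) - f (x + ?h n *\<^sub>R w) + f x" for n
  have lim: "(\<lambda>n. \<Delta> n / (?h n * ?h n)) \<longlonglongrightarrow> pderiv_dir b (pderiv_dir a f) x"
    if ab: "(a = v \<and> b = w) \<or> (a = w \<and> b = v)" for a b
  proof -
    have B: "a \<in> Basis" "b \<in> Basis" using ab v w by auto
    have "\<forall>n. \<exists>s t. 0 < s \<and> s < ?h n \<and> 0 < t \<and> t < ?h n \<and>
       \<Delta> n = ?h n * ?h n * pderiv_dir b (pderiv_dir a f) (x + s *\<^sub>R a + t *\<^sub>R b)"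
    proof
      fix n
      have "\<Delta> n = f (x + ?h n *\<^sub>R a + ?h n *\<^sub>R b) - f (x + ?h n *\<^sub>R a) - f (x + ?h n *\<^sub>R b) + f x"
        using ab unfolding \<Delta>_def by (auto simp: algebra_simps)
      then show "\<exists>s t. 0 < s \<and> s < ?h n \<and> 0 < t \<and> t < ?h n \<and>
         \<Delta> n = ?h n * ?h n * pderiv_dir b (pderiv_dir a f) (x + s *\<^sub>R a + t *\<^sub>R b)"
        using smooth_second_difference[OF f B, of "?h n" x] by simp
    qed
    then obtain s t where st: "\<And>n. 0 < s n \<and> s n < ?h n \<and> 0 < t n \<and> t n < ?h n \<and>
       \<Delta> n = ?h n * ?h n * pderiv_dir b (pderiv_dir a f) (x + s n *\<^sub>R a + t n *\<^sub>R b)"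
      by metis
    have "s \<longlonglongrightarrow> 0" "t \<longlonglongrightarrow> 0"
      by (rule tendsto_sandwich[OF always_eventually always_eventually tendsto_const h]; use st less_imp_le in blast)+
    then have "(\<lambda>n. x + s n *\<^sub>R a + t n *\<^sub>R b) \<longlonglongrightarrow> x + 0 *\<^sub>R a + 0 *\<^sub>R b"
      by (intro tendsto_intros)
    moreover have "isCont (pderiv_dir b (pderiv_dir a f)) x"
      by (intro differentiable_imp_continuous_within smooth_differentiable smooth_pderiv_dir f B)
    ultimately have "(\<lambda>n. pderiv_dir b (pderiv_dir a f) (x + s n *\<^sub>R a + t n *\<^sub>R b)) \<longlonglongrightarrow> pderiv_dir b (pderiv_dir a f) x"
      using isCont_tendsto_compose[of x "pderiv_dir b (pderiv_dir a f)" "\<lambda>n. x + s n *\<^sub>R a + t n *\<^sub>R b" sequentially]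
      by simp
    moreover have "\<Delta> n / (?h n * ?h n) = pderiv_dir b (pderiv_dir a f) (x + s n *\<^sub>R a + t n *\<^sub>R b)" for n
    proof -
      have "\<Delta> n = ?h n * ?h n * pderiv_dir b (pderiv_dir a f) (x + s n *\<^sub>R a + t n *\<^sub>R b)"
        using st by blast
      then show ?thesis by (metis nonzero_mult_div_cancel_left divide_eq_0_iff mult_eq_0_iff of_nat_eq_0_iff old.nat.distinct(2) one_neq_zero)
    qed
    ultimately show ?thesis by simp
  qed
  show "pderiv_dir v (pderiv_dir w f) x = pderiv_dir w (pderiv_dir v f) x"
    using LIMSEQ_unique[OF lim lim, of w v v w] by simp
qed

section \<open>Supports and membership among test functions\<close>

lemma pderivs_eq_0_outside:
  assumes "closed S" "\<And>y. y \<notin> S \<Longrightarrow> f y = 0" "x \<notin> S"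
  shows "pderivs vs f x = 0"
proof -
  have "pderivs vs f x = pderivs vs (\<lambda>x. 0) x"
    by (rule pderivs_cong_open[of "- S"]) (use assms in auto)
  also have "pderivs vs (\<lambda>x::'a. 0) = (\<lambda>x. 0)"
    by (induction vs) (auto simp: pderiv_dir_const)
  finally show ?thesis by simp
qed

lemma test_functions_subset_compact:
  assumes "smooth f" "compact K" "K \<subseteq> \<Omega>" "\<And>y. y \<notin> K \<Longrightarrow> f y = 0"
  shows "f \<in> test_functions \<Omega>"
proof -
  have "support_on UNIV f \<subseteq> K" using assms by (auto simp: support_on_def)
  then have 1: "closure (support_on UNIV f) \<subseteq> K"
    by (simp add: assms(2) closure_minimal compact_imp_closed)
  then have "compact (closure (support_on UNIV f))"
    using assms(2) compact_Int_closed[of K "closure (support_on UNIV f)"] by (simp add: Int_absorb1)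
  then show ?thesis
    using assms(1,3) 1 unfolding test_functions_def by blast
qed

lemma pderivs_test_functions:
  assumes f: "f \<in> test_functions \<Omega>" and vs: "set vs \<subseteq> Basis"
  shows "pderivs vs f \<in> test_functions \<Omega>"
proof (rule test_functions_subset_compact)
  show "smooth (pderivs vs f)" "compact (closure (support_on UNIV f))" "closure (support_on UNIV f) \<subseteq> \<Omega>"
    using f vs by (auto simp: test_functions_def intro: smooth_pderivs)
  have "y \<notin> closure (support_on UNIV f) \<Longrightarrow> f y = 0" for y
    using closure_subset[of "support_on UNIV f"] by (auto simp: support_on_def)
  then show "pderivs vs f y = 0" if "y \<notin> closure (support_on UNIV f)" for y
    using pderivs_eq_0_outside[OF closed_closure _ that] by blast
qed

section \<open>Smooth cutoffs\<close>

lemma power_le_fact_exp: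
  fixes x :: real assumes "0 \<le> x" shows "x ^ n \<le> fact n * exp x"
proof -
  have s: "summable (\<lambda>n. x ^ n /\<^sub>R fact n)" by (rule summable_exp_generic)
  have "(\<Sum>k\<in>{n}. x ^ k /\<^sub>R fact k) \<le> (\<Sum>k. x ^ k /\<^sub>R fact k)"
    by (rule sum_le_suminf[OF s]) (use assms in auto)
  then have "x ^ n / fact n \<le> exp x" by (simp add: exp_def divide_inverse mult.commute)
  then show ?thesis by (simp add: divide_le_eq mult.commute)
qed

lemma has_real_derivative_pderiv_dir:
  fixes h :: "real \<Rightarrow> real"
  assumes "smooth h" shows "(h has_real_derivative pderiv_dir 1 h x) (at x)"
proof -
  have h: "(h has_derivative (\<lambda>u. pderiv_dir u h x)) (at x)"
    by (rule smooth_has_derivative[OF assms])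
  have "pderiv_dir u h x = pderiv_dir 1 h x * u" for u
    using linear_scale[OF has_derivative_linear[OF h], of u 1] by (simp add: mult.commute)
  then have "(\<lambda>u. pderiv_dir u h x) = (\<lambda>u. pderiv_dir 1 h x * u)" by (rule ext)
  then show ?thesis using h by (simp add: has_field_derivative_def)
qed

lemma pderiv_dir_1_eq: 
  fixes h :: "real \<Rightarrow> real"
  assumes "(h has_real_derivative d) (at x)" shows "pderiv_dir 1 h x = d"
  using pderiv_dir_eq[OF assms[unfolded has_field_derivative_def], of 1] by simp

text \<open>The function exp(-1/x) extended by zero, with powers of x in the denominator so that the
  family is closed under differentiation up to linear combinations. Smoothness of every member then
  follows by one induction.\<close>

definition flat :: "nat \<Rightarrow> real \<Rightarrow> real" where
  "flat m x = (if 0 < x then exp (- (1 / x)) / x ^ m else 0)"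

lemma flat_Suc: "flat m x = flat (Suc m) x * x"
  by (simp add: flat_def)

lemma flat_bound: "\<bar>flat m x\<bar> \<le> fact m"
proof (cases "0 < x")
  case True
  have "(1 / x) ^ m \<le> fact m * exp (1 / x)" using True by (intro power_le_fact_exp) auto
  then have "(1 / x) ^ m * exp (- (1 / x)) \<le> fact m * exp (1 / x) * exp (- (1 / x))"
    by (intro mult_right_mono) auto
  then show ?thesis using True by (simp add: flat_def exp_minus field_simps)
qed (simp add: flat_def)

text \<open>Away from 0 this is the quotient rule. At 0 the value \<open>flat m h\<close> is a
  bounded factor times the square of \<open>h\<close>, so the difference quotient is of order
  \<open>h\<close>.\<close>

lemma flat_has_derivative:
  "(flat m has_real_derivative flat (m + 2) x - real m * flat (m + 1) x) (at x)"
proof -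
  consider "0 < x" | "x < 0" | "x = 0" by linarith
  then show ?thesis
  proof cases
    case 1
    have "((\<lambda>x. exp (- (1 / x)) / x ^ m) has_real_derivative
        ((exp (- (1 / x)) * (1 / (x * x))) * x ^ m - exp (- (1 / x)) * (real m * x ^ (m - 1))) / (x ^ m * x ^ m)) (at x)"
      using 1 by (auto intro!: derivative_eq_intros simp: field_simps)
    also have "((exp (- (1 / x)) * (1 / (x * x))) * x ^ m - exp (- (1 / x)) * (real m * x ^ (m - 1))) / (x ^ m * x ^ m)
        = flat (m + 2) x - real m * flat (m + 1) x"
      using 1 by (cases m) (auto simp: flat_def field_simps)
    finally show ?thesis
      by (rule has_field_derivative_transform_within_open[where S="{0<..}"]) (use 1 in \<open>auto simp: flat_def\<close>)
  next
    case 2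
    have "((\<lambda>x. 0) has_real_derivative 0) (at x)" by simp
    then have "(flat m has_real_derivative 0) (at x)"
      by (rule has_field_derivative_transform_within_open[where S="{..<0}"]) (use 2 in \<open>auto simp: flat_def\<close>)
    then show ?thesis using 2 by (simp add: flat_def)
  next
    case 3
    have "((\<lambda>h. flat m h / h) \<longlongrightarrow> 0) (at 0)"
    proof (rule Lim_null_comparison)
      have "\<bar>flat m h / h\<bar> \<le> fact (m + 2) * \<bar>h\<bar>" for h
      proof -
        have "flat m h = flat (m + 2) h * (h * h)"
          using flat_Suc[of m h] flat_Suc[of "Suc m" h] by simp
        then have "\<bar>flat m h / h\<bar> = \<bar>flat (m + 2) h\<bar> * \<bar>h\<bar>"
          by (simp add: abs_mult)
        then show ?thesis by (metis abs_ge_zero flat_bound mult_right_mono)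
      qed
      then show "\<forall>\<^sub>F h in at 0. norm (flat m h / h) \<le> fact (m + 2) * \<bar>h\<bar>" by simp
      show "((\<lambda>h. fact (m + 2) * \<bar>h\<bar>) \<longlongrightarrow> 0) (at (0::real))"
        by (intro tendsto_eq_intros refl) auto
    qed
    then show ?thesis using 3 by (simp add: has_field_derivative_iff flat_def)
  qed
qed

lemma smooth_flat: "smooth (flat m)"
proof -
  have "diff_times n (flat m)" for n
  proof (induction n arbitrary: m)
    case 0
    then show ?case using flat_has_derivative
      by (auto simp: differentiable_on_def real_differentiable_def)
  next
    case (Suc n)
    have "flat m differentiable_on UNIV" using flat_has_derivative
      by (auto simp: differentiable_on_def real_differentiable_def)
    moreover have "pderiv_dir 1 (flat m) = (\<lambda>x. flat (m + 2) x + (- real m) * flat (m + 1) x)"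
      by (rule ext) (subst pderiv_dir_1_eq[OF flat_has_derivative], simp)
    moreover have "diff_times n (\<lambda>x. flat (m + 2) x + (- real m) * flat (m + 1) x)"
      by (intro diff_times_add diff_times_mult diff_times_const Suc)
    ultimately show ?case by (simp only: diff_times.simps Basis_real_def ball_simps)
  qed
  then show ?thesis by (simp add: smooth_iff_diff_times)
qed

text \<open>The usual quotient of flat functions, rising from 0 to 1 between 1/4 and 1/2. Vanishing
  up to 1/4, and not just up to 0, keeps the time cutoffs built from it at a positive distance from
  the start of the window and from the evaluation time.\<close>

definition smooth_step :: "real \<Rightarrow> real" where
  "smooth_step s = flat 0 (s - 1/4) * inverse (flat 0 (s - 1/4) + flat 0 (1/2 - s))"

lemma flat_nonneg: "0 \<le> flat m x"
  by (simp add: flat_def)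

lemma flat_pos: "0 < x \<Longrightarrow> 0 < flat m x"
  by (simp add: flat_def)

lemma smooth_step_denominator: "0 < flat 0 (s - 1/4) + flat 0 (1/2 - s)"
proof (cases "1/4 < s")
  case True then show ?thesis using flat_pos[of "s - 1/4" 0] flat_nonneg[of 0 "1/2 - s"] by linarith
next
  case False then show ?thesis using flat_pos[of "1/2 - s" 0] flat_nonneg[of 0 "s - 1/4"] by linarith
qed

lemma smooth_id: "smooth (\<lambda>x::real. x)"
  by (rule smooth_linear) (rule bounded_linear_ident)

lemma smooth_smooth_step: "smooth smooth_step"
proof -
  have 1: "smooth (\<lambda>s. flat 0 (s - 1/4))" "smooth (\<lambda>s. flat 0 (1/2 - s))"
    by (rule smooth_compose[OF smooth_flat], rule smooth_diff, (rule smooth_id smooth_const)+)+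
  have "smooth (\<lambda>s. flat 0 (s - 1/4) * inverse (flat 0 (s - 1/4) + flat 0 (1/2 - s)))"
    by (intro smooth_mult smooth_inverse smooth_add 1 smooth_step_denominator[THEN less_imp_neq, THEN not_sym])
  then show ?thesis unfolding smooth_step_def[abs_def] .
qed

lemma smooth_step_bounds: "0 \<le> smooth_step s" "smooth_step s \<le> 1"
  using smooth_step_denominator[of s] flat_nonneg[of 0 "s - 1/4"] flat_nonneg[of 0 "1/2 - s"]
  by (auto simp: smooth_step_def divide_inverse[symmetric] intro: divide_nonneg_pos)

lemma smooth_step_eq_0: "s \<le> 1/4 \<Longrightarrow> smooth_step s = 0"
  by (simp add: smooth_step_def flat_def)

lemma smooth_step_eq_1: "1/2 \<le> s \<Longrightarrow> smooth_step s = 1"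
  using flat_pos[of "s - 1/4" 0] by (simp add: smooth_step_def) (simp add: flat_def)

section \<open>Derivative bounds for products and for dilated cutoffs\<close>

lemma bounded_pderivs_compact_support:
  assumes f: "smooth f" and K: "compact K" "\<And>y. y \<notin> K \<Longrightarrow> f y = 0" and vs: "set vs \<subseteq> Basis"
  shows "\<exists>C. \<forall>x. \<bar>pderivs vs f x\<bar> \<le> C"
proof -
  have "compact (pderivs vs f ` K)"
    by (intro compact_continuous_image smooth_continuous_on smooth_pderivs f vs K)
  then have "bounded (pderivs vs f ` K)" by (rule compact_imp_bounded)
  then obtain C where C: "\<forall>x\<in>K. norm (pderivs vs f x) \<le> C"
    unfolding bounded_iff by (auto simp del: real_norm_def)
  have "\<bar>pderivs vs f x\<bar> \<le> max C 0" for x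
  proof (cases "x \<in> K")
    case False
    then have "pderivs vs f x = 0"
      by (intro pderivs_eq_0_outside[of K]) (use K compact_imp_closed in auto)
    then show ?thesis by simp
  next
    case True
    then show ?thesis using bspec[OF C True] by simp
  qed
  then show ?thesis by blast
qed

text \<open>Every differentiation splits a product into two, so 2^n products of derivatives appear
  after n steps, each bounded by \<open>A * B\<close>. Peeling off the innermost derivative replaces
  one factor by its derivative, for which the bounds up to one order less are still
  available.\<close>

lemma pderivs_mult_bound:
  fixes f g :: "'a::euclidean_space \<Rightarrow> real"
  assumes "smooth f" "smooth g" "set vs \<subseteq> Basis"
    "\<And>us. set us \<subseteq> Basis \<Longrightarrow> length us \<le> length vs \<Longrightarrow> \<bar>pderivs us f x\<bar> \<le> A"
    "\<And>us. set us \<subseteq> Basis \<Longrightarrow> length us \<le> length vs \<Longrightarrow> \<bar>pderivs us g x\<bar> \<le> B"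
  shows "\<bar>pderivs vs (\<lambda>x. f x * g x) x\<bar> \<le> 2 ^ length vs * (A * B)"
  using assms
proof (induction vs arbitrary: f g rule: rev_induct)
  case Nil
  have "\<bar>f x\<bar> \<le> A" "\<bar>g x\<bar> \<le> B" using Nil.prems(4)[of "[]"] Nil.prems(5)[of "[]"] by auto
  then show ?case by (auto simp: abs_mult intro!: mult_mono)
next
  case (snoc v vs)
  have v: "v \<in> Basis" "set vs \<subseteq> Basis" using snoc.prems by auto
  have eq: "pderiv_dir v (\<lambda>x. f x * g x) = (\<lambda>x. pderiv_dir v f x * g x + f x * pderiv_dir v g x)"
    by (rule ext) (intro pderiv_dir_mult smooth_differentiable snoc.prems)
  have 1: "\<bar>pderivs vs (\<lambda>x. pderiv_dir v f x * g x) x\<bar> \<le> 2 ^ length vs * (A * B)"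
  proof (rule snoc.IH)
    show "\<bar>pderivs us (pderiv_dir v f) x\<bar> \<le> A" if "set us \<subseteq> Basis" "length us \<le> length vs" for us
      using snoc.prems(4)[of "us @ [v]"] that v by (simp add: pderivs_snoc)
  qed (use snoc.prems v smooth_pderiv_dir in auto)
  have 2: "\<bar>pderivs vs (\<lambda>x. f x * pderiv_dir v g x) x\<bar> \<le> 2 ^ length vs * (A * B)"
  proof (rule snoc.IH)
    show "\<bar>pderivs us (pderiv_dir v g) x\<bar> \<le> B" if "set us \<subseteq> Basis" "length us \<le> length vs" for us
      using snoc.prems(5)[of "us @ [v]"] that v by (simp add: pderivs_snoc)
  qed (use snoc.prems v smooth_pderiv_dir in auto)
  have add: "pderivs vs (\<lambda>x. F x + H x) x = pderivs vs F x + pderivs vs H x"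
    if "smooth F" "smooth H" for F H :: "'a \<Rightarrow> real"
    using v(2) that
  proof (induction vs arbitrary: F H rule: rev_induct)
    case (snoc u us)
    have "pderiv_dir u (\<lambda>x. F x + H x) = (\<lambda>x. pderiv_dir u F x + pderiv_dir u H x)"
      by (rule ext) (intro pderiv_dir_add smooth_differentiable snoc.prems)
    moreover have "smooth (pderiv_dir u F)" "smooth (pderiv_dir u H)"
      using snoc.prems by (auto intro: smooth_pderiv_dir)
    ultimately show ?case using snoc.IH[of "pderiv_dir u F" "pderiv_dir u H"] snoc.prems(1)
      by (simp add: pderivs_snoc)
  qed simp
  have "pderivs (vs @ [v]) (\<lambda>x. f x * g x) x
      = pderivs vs (\<lambda>x. pderiv_dir v f x * g x) x + pderivs vs (\<lambda>x. f x * pderiv_dir v g x) x"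
    unfolding pderivs_snoc eq
    by (intro add smooth_mult smooth_pderiv_dir snoc.prems v)
  then show ?case using 1 2 by (simp add: mult.assoc)
qed

lemma pderivs_scale:
  fixes f :: "'a::euclidean_space \<Rightarrow> real"
  assumes "smooth f" "set vs \<subseteq> Basis"
  shows "pderivs vs (\<lambda>x. f (c *\<^sub>R x)) x = c ^ length vs * pderivs vs f (c *\<^sub>R x)"
  using assms(2)
proof (induction vs arbitrary: x)
  case (Cons v vs)
  let ?g = "pderivs vs f"
  have g: "smooth ?g" using Cons.prems assms by (intro smooth_pderivs) auto
  have IH: "pderivs vs (\<lambda>x. f (c *\<^sub>R x)) = (\<lambda>x. c ^ length vs * ?g (c *\<^sub>R x))"
    by (rule ext) (rule Cons.IH, use Cons.prems in auto)
  have c: "((\<lambda>x. c *\<^sub>R x) has_derivative (\<lambda>v. c *\<^sub>R v)) (at x)"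
    by (intro bounded_linear_imp_has_derivative bounded_linear_scaleR_right)
  define D where "D = (\<lambda>v. pderiv_dir v ?g (c *\<^sub>R x))"
  have D: "(?g has_derivative D) (at (c *\<^sub>R x))"
    unfolding D_def by (rule smooth_has_derivative[OF g])
  have "((\<lambda>x. c ^ length vs * ?g (c *\<^sub>R x)) has_derivative (\<lambda>v. c ^ length vs * D (c *\<^sub>R v))) (at x)"
    by (intro has_derivative_mult_right has_derivative_compose[OF c D])
  then have "pderiv_dir v (\<lambda>x. c ^ length vs * ?g (c *\<^sub>R x)) x = c ^ length vs * D (c *\<^sub>R v)"
    by (rule pderiv_dir_eq)
  also have "D (c *\<^sub>R v) = c * D v"
    using linear_scale[OF has_derivative_linear[OF D], of c v] by simp
  finally show ?case by (simp add: IH D_def)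
qed simp

text \<open>A radial cutoff at scale \<open>Suc n\<close>, equal to 1 on the ball of half that
  radius. The square of the norm is used because, unlike the norm, it is smooth at the
  origin.\<close>

definition cutoff :: "nat \<Rightarrow> 'a::euclidean_space \<Rightarrow> real" where
  "cutoff n z = smooth_step (1 - ((1 / real (Suc n)) *\<^sub>R z) \<bullet> ((1 / real (Suc n)) *\<^sub>R z))"

lemma smooth_inner_left: "smooth (\<lambda>z. z \<bullet> b)"
  by (rule smooth_linear) (rule bounded_linear_inner_left)

lemma smooth_inner_self: "smooth (\<lambda>z::'a::euclidean_space. z \<bullet> z)"
proof -
  have "(\<lambda>z::'a. z \<bullet> z) = (\<lambda>z. \<Sum>b\<in>Basis. (z \<bullet> b) * (z \<bullet> b))"
    by (rule ext) (rule euclidean_inner)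
  then show ?thesis by (simp only:) (intro smooth_sum smooth_mult smooth_inner_left)
qed

lemma smooth_cutoff: "smooth (cutoff n)"
proof -
  have "smooth (\<lambda>z::'a. smooth_step (1 - (1 / real (Suc n) * (1 / real (Suc n))) * (z \<bullet> z)))"
    by (intro smooth_compose[OF smooth_smooth_step] smooth_diff smooth_mult smooth_inner_self smooth_const)
  then show ?thesis unfolding cutoff_def[abs_def] inner_scaleR_left inner_scaleR_right mult.assoc .
qed

lemma cutoff_eq_0: "real (Suc n) \<le> norm z \<Longrightarrow> cutoff n z = 0"
proof -
  assume n: "real (Suc n) \<le> norm z"
  have "1 \<le> norm ((1 / real (Suc n)) *\<^sub>R z)" using n by (simp add: field_simps)
  then have "1 \<le> ((1 / real (Suc n)) *\<^sub>R z) \<bullet> ((1 / real (Suc n)) *\<^sub>R z)"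
    by (metis one_le_power power2_norm_eq_inner)
  then show ?thesis unfolding cutoff_def by (intro smooth_step_eq_0) linarith
qed

lemma cutoff_eq_1: "2 * norm z \<le> real (Suc n) \<Longrightarrow> cutoff n z = 1"
proof -
  assume n: "2 * norm z \<le> real (Suc n)"
  have "norm ((1 / real (Suc n)) *\<^sub>R z) \<le> 1/2" using n by (simp add: field_simps)
  then have "(norm ((1 / real (Suc n)) *\<^sub>R z))\<^sup>2 \<le> (1/2)\<^sup>2" by (rule power_mono) simp
  then have "((1 / real (Suc n)) *\<^sub>R z) \<bullet> ((1 / real (Suc n)) *\<^sub>R z) \<le> 1/2"
    unfolding power2_norm_eq_inner by (rule order_trans) (simp add: power2_eq_square)
  then show ?thesis unfolding cutoff_def by (intro smooth_step_eq_1) linarith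
qed

text \<open>All cutoffs are dilations of \<open>cutoff 0\<close> by factors at most 1, and each
  derivative brings out one such factor, so bounds for the first cutoff serve for every
  \<open>n\<close>.\<close>

lemma cutoff_pderivs_bound:
  "\<exists>A. \<forall>n us z. set us \<subseteq> Basis \<and> length us \<le> N \<longrightarrow> \<bar>pderivs us (cutoff n) (z::'a::euclidean_space)\<bar> \<le> A"
proof -
  let ?F = "{us. set us \<subseteq> (Basis::'a set) \<and> length us \<le> N}"
  have fin: "finite ?F" by (rule finite_lists_length_le) simp
  have "\<exists>C. \<forall>x. \<bar>pderivs us (cutoff 0 :: 'a \<Rightarrow> real) x\<bar> \<le> C" if "us \<in> ?F" for us
  proof (rule bounded_pderivs_compact_support[OF smooth_cutoff compact_cball[of 0 1]])
    show "cutoff 0 y = 0" if "y \<notin> cball 0 1" for y :: 'a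
      using that by (intro cutoff_eq_0) simp
  qed (use that in simp)
  then obtain C where C: "\<And>us x. us \<in> ?F \<Longrightarrow> \<bar>pderivs us (cutoff 0 :: 'a \<Rightarrow> real) x\<bar> \<le> C us"
    by metis
  have "\<bar>pderivs us (cutoff n) z\<bar> \<le> (\<Sum>us\<in>?F. C us)" if us: "set us \<subseteq> Basis \<and> length us \<le> N" for us n and z :: 'a
  proof -
    let ?c = "1 / real (Suc n)"
    have "cutoff n = (\<lambda>z::'a. cutoff 0 (?c *\<^sub>R z))" by (rule ext) (simp add: cutoff_def)
    then have "pderivs us (cutoff n) z = ?c ^ length us * pderivs us (cutoff 0) (?c *\<^sub>R z)"
      using pderivs_scale[OF smooth_cutoff[of 0], of us ?c z] us by simp
    then have "\<bar>pderivs us (cutoff n) z\<bar> = ?c ^ length us * \<bar>pderivs us (cutoff 0) (?c *\<^sub>R z)\<bar>"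
      by (simp add: abs_mult)
    also have "\<dots> \<le> 1 * \<bar>pderivs us (cutoff 0) (?c *\<^sub>R z)\<bar>"
      by (intro mult_right_mono power_le_one) auto
    also have "\<dots> \<le> C us" using C[of us] us by simp
    also have "C us = (\<Sum>us\<in>{us}. C us)" by simp
    also have "\<dots> \<le> (\<Sum>us\<in>?F. C us)"
      using us order_trans[OF abs_ge_zero C] by (intro sum_mono2 fin) auto
    finally show ?thesis .
  qed
  then show ?thesis by blast
qed

section \<open>Gaussian test functions and their approximation\<close>

text \<open>Polynomials in space with coefficients smooth in time. The coefficients are this general
  because the Gaussians below have a time dependent rate; the products of the class with one such
  Gaussian are stable under all derivatives.\<close>

inductive poly_space :: "(real \<times> 'a::euclidean_space \<Rightarrow> real) \<Rightarrow> bool" where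
  time: "smooth c \<Longrightarrow> poly_space (\<lambda>z. c (fst z))"
| coord: "poly_space (\<lambda>z. snd z \<bullet> b)"
| add: "poly_space p \<Longrightarrow> poly_space q \<Longrightarrow> poly_space (\<lambda>z. p z + q z)"
| mult: "poly_space p \<Longrightarrow> poly_space q \<Longrightarrow> poly_space (\<lambda>z. p z * q z)"

lemma smooth_time:
  assumes "smooth c" shows "smooth (\<lambda>z::real \<times> 'a::euclidean_space. c (fst z))"
  by (intro smooth_compose[OF assms] smooth_linear bounded_linear_fst)

lemma smooth_coord: "smooth (\<lambda>z::real \<times> 'a::euclidean_space. snd z \<bullet> b)"
  by (intro smooth_linear bounded_linear_compose[OF bounded_linear_inner_left bounded_linear_snd])

lemma poly_space_smooth: "poly_space p \<Longrightarrow> smooth p"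
  by (induction rule: poly_space.induct) (auto intro: smooth_time smooth_coord smooth_add smooth_mult)

lemma poly_space_const: "poly_space (\<lambda>z. c)"
  by (rule time[OF smooth_const])

lemma poly_space_cmult: "poly_space p \<Longrightarrow> poly_space (\<lambda>z. c * p z)"
  by (intro mult poly_space_const)

lemma poly_space_sum:
  "(\<And>i. i \<in> A \<Longrightarrow> poly_space (f i)) \<Longrightarrow> poly_space (\<lambda>z. \<Sum>i\<in>A. f i z)"
  by (induction A rule: infinite_finite_induct) (auto intro!: add poly_space_const)

lemma has_derivative_time:
  assumes "smooth c"
  shows "((\<lambda>z::real \<times> 'a::euclidean_space. c (fst z)) has_derivative (\<lambda>v. pderiv_dir 1 c (fst z) * fst v)) (at z)"
proof -
  have 1: "((\<lambda>z::real \<times> 'a. fst z) has_derivative fst) (at z)"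
    by (intro bounded_linear_imp_has_derivative bounded_linear_fst)
  have 2: "(c has_derivative (\<lambda>u. pderiv_dir 1 c (fst z) * u)) (at (fst z))"
    using has_real_derivative_pderiv_dir[OF assms] unfolding has_field_derivative_def .
  show ?thesis by (rule has_derivative_compose[OF 1 2])
qed

lemma poly_space_pderiv_dir: "poly_space p \<Longrightarrow> poly_space (pderiv_dir v p)"
proof (induction rule: poly_space.induct)
  case (time c)
  have "pderiv_dir v (\<lambda>z. c (fst z)) = (\<lambda>z. fst v * pderiv_dir 1 c (fst z))"
    by (rule ext) (subst pderiv_dir_eq[OF has_derivative_time[OF time]], simp)
  moreover have "smooth (pderiv_dir 1 c)" using time by (intro smooth_pderiv_dir) auto
  ultimately show ?case using poly_space_cmult[OF poly_space.time] by metis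
next
  case (coord b)
  have "((\<lambda>z::real \<times> 'a. snd z \<bullet> b) has_derivative (\<lambda>z. snd z \<bullet> b)) (at z)" for z
    by (intro bounded_linear_imp_has_derivative bounded_linear_compose[OF bounded_linear_inner_left bounded_linear_snd])
  then have "pderiv_dir v (\<lambda>z::real \<times> 'a. snd z \<bullet> b) = (\<lambda>z. snd v \<bullet> b)"
    by (intro ext pderiv_dir_eq)
  then show ?case by (simp add: poly_space_const)
next
  case (add p q)
  have "pderiv_dir v (\<lambda>z. p z + q z) = (\<lambda>z. pderiv_dir v p z + pderiv_dir v q z)"
    by (rule ext) (intro pderiv_dir_add smooth_differentiable poly_space_smooth add)
  then show ?case using add by (simp add: poly_space.add)
next
  case (mult p q)
  have "pderiv_dir v (\<lambda>z. p z * q z) = (\<lambda>z. pderiv_dir v p z * q z + p z * pderiv_dir v q z)"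
    by (rule ext) (intro pderiv_dir_mult smooth_differentiable poly_space_smooth mult)
  then show ?case using mult by (simp add: poly_space.add poly_space.mult)
qed

text \<open>Growth is measured by powers of \<open>1 + (norm (snd z))\<^sup>2\<close>: this base is
  at least 1, so exponents may be raised to a common one when sums are formed.\<close>

lemma poly_space_growth:
  "poly_space p \<Longrightarrow> \<exists>C n. 0 \<le> C \<and>
     (\<forall>z. fst z \<in> {\<alpha>..\<beta>} \<longrightarrow> \<bar>p z\<bar> \<le> C * (1 + (norm (snd z))\<^sup>2) ^ n)"
proof (induction rule: poly_space.induct)
  case (time c)
  have "compact (c ` {\<alpha>..\<beta>})"
    by (intro compact_continuous_image smooth_continuous_on time compact_Icc)
  then have "bounded (c ` {\<alpha>..\<beta>})" by (rule compact_imp_bounded)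
  then obtain C where C: "\<forall>t\<in>{\<alpha>..\<beta>}. \<bar>c t\<bar> \<le> C" unfolding bounded_iff by auto
  show ?case
  proof (intro exI[of _ "max C 0"] exI[of _ 0] conjI allI impI)
    fix z :: "real \<times> 'a" assume "fst z \<in> {\<alpha>..\<beta>}"
    from bspec[OF C this] show "\<bar>c (fst z)\<bar> \<le> max C 0 * (1 + (norm (snd z))\<^sup>2) ^ 0" by simp
  qed simp
next
  case (coord b)
  have "\<bar>x \<bullet> b\<bar> \<le> norm b * (1 + (norm x)\<^sup>2) ^ 1" for x :: 'a
  proof -
    have "norm x \<le> 1 + (norm x)\<^sup>2"
      using sum_squares_bound[of "norm x" 1] zero_le_power2[of "norm x"] norm_ge_zero[of x]
      by (simp del: norm_ge_zero zero_le_power2)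
    then have "norm x * norm b \<le> (1 + (norm x)\<^sup>2) * norm b" by (rule mult_right_mono) simp
    then show ?thesis using Cauchy_Schwarz_ineq2[of x b] by (simp add: mult.commute)
  qed
  then show ?case by (intro exI[of _ "norm b"] exI[of _ 1]) simp
next
  case (add p q)
  then obtain C n D m where C: "0 \<le> C" "0 \<le> D"
    "\<And>z. fst z \<in> {\<alpha>..\<beta>} \<Longrightarrow> \<bar>p z\<bar> \<le> C * (1 + (norm (snd z))\<^sup>2) ^ n"
    "\<And>z. fst z \<in> {\<alpha>..\<beta>} \<Longrightarrow> \<bar>q z\<bar> \<le> D * (1 + (norm (snd z))\<^sup>2) ^ m" by metis
  have "\<bar>p z + q z\<bar> \<le> (C + D) * (1 + (norm (snd z))\<^sup>2) ^ (n + m)" if "fst z \<in> {\<alpha>..\<beta>}" for z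
  proof -
    let ?r = "1 + (norm (snd z))\<^sup>2"
    have "C * ?r ^ n \<le> C * ?r ^ (n + m)" "D * ?r ^ m \<le> D * ?r ^ (n + m)"
      using C(1,2) by (auto intro!: mult_left_mono power_increasing)
    then show ?thesis using C(3,4)[OF that] by (simp add: distrib_right)
  qed
  then show ?case using C by (intro exI[of _ "C + D"] exI[of _ "n + m"]) auto
next
  case (mult p q)
  then obtain C n D m where C: "0 \<le> C" "0 \<le> D"
    "\<And>z. fst z \<in> {\<alpha>..\<beta>} \<Longrightarrow> \<bar>p z\<bar> \<le> C * (1 + (norm (snd z))\<^sup>2) ^ n"
    "\<And>z. fst z \<in> {\<alpha>..\<beta>} \<Longrightarrow> \<bar>q z\<bar> \<le> D * (1 + (norm (snd z))\<^sup>2) ^ m" by metis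
  have "\<bar>p z * q z\<bar> \<le> (C * D) * (1 + (norm (snd z))\<^sup>2) ^ (n + m)" if "fst z \<in> {\<alpha>..\<beta>}" for z
  proof -
    have "\<bar>p z * q z\<bar> \<le> (C * (1 + (norm (snd z))\<^sup>2) ^ n) * (D * (1 + (norm (snd z))\<^sup>2) ^ m)"
      unfolding abs_mult using C that by (intro mult_mono) auto
    then show ?thesis by (simp add: power_add mult.commute mult.left_commute)
  qed
  then show ?case using C by (intro exI[of _ "C * D"] exI[of _ "n + m"]) auto
qed

lemma pderivs_poly_exp:
  assumes "poly_space q" "poly_space p"
  shows "\<exists>p'. poly_space p' \<and> pderivs vs (\<lambda>z. p z * exp (q z)) = (\<lambda>z. p' z * exp (q z))"
proof (induction vs)
  case Nil
  then show ?case using assms by auto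
next
  case (Cons v vs)
  then obtain p' where p': "poly_space p'" "pderivs vs (\<lambda>z. p z * exp (q z)) = (\<lambda>z. p' z * exp (q z))"
    by blast
  have q: "smooth q" "smooth (\<lambda>z. exp (q z))" "smooth p'"
    using assms p' by (auto intro: poly_space_smooth smooth_compose smooth_exp)
  have e: "pderiv_dir 1 exp x = exp x" for x :: real
    by (rule pderiv_dir_1_eq) (rule DERIV_exp)
  have "pderiv_dir v (\<lambda>z. p' z * exp (q z)) = (\<lambda>z. (pderiv_dir v p' z + p' z * pderiv_dir v q z) * exp (q z))"
  proof
    fix z
    have "pderiv_dir v (\<lambda>z. p' z * exp (q z)) z
      = pderiv_dir v p' z * exp (q z) + p' z * pderiv_dir v (\<lambda>z. exp (q z)) z"
      by (intro pderiv_dir_mult smooth_differentiable q)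
    also have "pderiv_dir v (\<lambda>z. exp (q z)) z = exp (q z) * pderiv_dir v q z"
      using pderiv_dir_compose[of q z exp v] smooth_differentiable[OF q(1), of z]
        smooth_differentiable[OF smooth_exp, of "q z"] e[of "q z"] by simp
    finally show "pderiv_dir v (\<lambda>z. p' z * exp (q z)) z = (pderiv_dir v p' z + p' z * pderiv_dir v q z) * exp (q z)"
      by (simp add: algebra_simps)
  qed
  moreover have "poly_space (\<lambda>z. pderiv_dir v p' z + p' z * pderiv_dir v q z)"
    by (intro poly_space.add poly_space.mult poly_space_pderiv_dir p' assms)
  ultimately show ?case using p'(2) by auto
qed

text \<open>In three dimensions the weight is integrable over the slab, since it decays like
  |x|^(-4), and it is bounded by 1. For a field that is square integrable on bounded time intervals,
  both |U| and |U|^2 times this weight are therefore integrable.\<close>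

definition decay :: "real \<Rightarrow> real \<Rightarrow> real \<times> 'a::euclidean_space \<Rightarrow> real" where
  "decay \<alpha> \<beta> z = (if fst z \<in> {\<alpha>..\<beta>} then inverse ((1 + (norm (snd z))\<^sup>2)\<^sup>2) else 0)"

lemma decay_nonneg: "0 \<le> decay \<alpha> \<beta> z"
  by (simp add: decay_def)

section \<open>Decay of Gaussian test functions with all derivatives\<close>

lemma power_exp_bounded:
  assumes "0 < \<kappa>"
  shows "\<exists>C\<ge>0. \<forall>r\<ge>0. (1 + r) ^ n * exp (- (\<kappa> * r)) \<le> (C::real)"
proof (intro exI conjI allI impI)
  \<comment> \<open>With this choice \<open>?m * (1 + r)\<close> is at most
    \<open>1 + \<kappa> * r\<close>, so bounding a power of it by the exponential costs only
    constants.\<close>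
  let ?m = "min \<kappa> 1"
  have m: "0 < ?m" using assms by simp
  fix r :: real assume r: "0 \<le> r"
  have "(?m * (1 + r)) ^ n \<le> fact n * exp (?m * (1 + r))"
    using m r by (intro power_le_fact_exp) auto
  also have "\<dots> \<le> fact n * exp (1 + \<kappa> * r)"
  proof -
    have "?m * r \<le> \<kappa> * r" "?m \<le> 1" using r by (auto intro: mult_right_mono)
    then have "?m * (1 + r) \<le> 1 + \<kappa> * r" unfolding distrib_left mult_1_right by linarith
    then show ?thesis by simp
  qed
  finally have "?m ^ n * ((1 + r) ^ n) \<le> fact n * exp 1 * exp (\<kappa> * r)"
    by (simp add: power_mult_distrib exp_add mult.assoc)
  then have "(1 + r) ^ n \<le> fact n * exp 1 * exp (\<kappa> * r) / ?m ^ n"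
    using m by (simp add: pos_le_divide_eq mult.commute)
  then have "(1 + r) ^ n * exp (- (\<kappa> * r)) \<le> fact n * exp 1 * exp (\<kappa> * r) / ?m ^ n * exp (- (\<kappa> * r))"
    by (rule mult_right_mono) simp
  also have "\<dots> = fact n * exp 1 / ?m ^ n" by (simp add: exp_minus)
  finally show "(1 + r) ^ n * exp (- (\<kappa> * r)) \<le> fact n * exp 1 / ?m ^ n" .
qed (use assms in auto)

text \<open>A form of Peetre's inequality; it converts decay away from \<open>y\<close> into decay
  away from the origin, at the price of a constant depending on \<open>y\<close>.\<close>

lemma one_plus_norm_shift:
  "1 + (norm (x::'a::euclidean_space))\<^sup>2 \<le> 2 * (1 + (norm y)\<^sup>2) * (1 + (norm (x - y))\<^sup>2)"
proof -
  have "norm x \<le> norm y + norm (x - y)" using norm_triangle_ineq[of y "x - y"] by simp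
  then have "(norm x)\<^sup>2 \<le> (norm y + norm (x - y))\<^sup>2" by (intro power_mono) auto
  also have "\<dots> \<le> 2 * (norm y)\<^sup>2 + 2 * (norm (x - y))\<^sup>2"
    using sum_squares_bound[of "norm y" "norm (x - y)"] by (simp add: power2_sum)
  also have "\<dots> + 1 \<le> 2 * (1 + (norm y)\<^sup>2) * (1 + (norm (x - y))\<^sup>2)"
    by (simp add: algebra_simps)
  finally show ?thesis by simp
qed

text \<open>Every derivative is a polynomial in space times the same Gaussian. On the compact time
  interval the rate is bounded below, and the Gaussian beats the \<open>n\<close> powers of the
  polynomial together with the two powers demanded by \<open>decay\<close>.\<close>

lemma gaussian_decay:
  fixes y :: "'a::euclidean_space" and p :: "real \<times> 'a::euclidean_space \<Rightarrow> real"
  assumes p: "poly_space p" and \<kappa>: "smooth \<kappa>" "\<And>t. 0 < \<kappa> t"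
    and supp: "\<And>z. fst z \<notin> {\<alpha>..\<beta>} \<Longrightarrow> p z = 0"
  defines "F \<equiv> \<lambda>z. p z * exp (- (\<kappa> (fst z) * (norm (snd z - y))\<^sup>2))"
  shows "smooth F" "\<exists>C. \<forall>z. \<bar>pderivs vs F z\<bar> \<le> C * decay \<alpha> \<beta> z"
proof -
  define q where "q z = - 1 * (\<kappa> (fst z) * ((\<Sum>b\<in>Basis. (snd z \<bullet> b) * (snd z \<bullet> b)) + - 2 * (snd z \<bullet> y) + y \<bullet> y))"
    for z :: "real \<times> 'a"
  have q: "poly_space q"
    unfolding q_def[abs_def]
    by (intro poly_space.mult poly_space.add poly_space_const time poly_space_sum coord \<kappa>)
  have qe: "- (\<kappa> (fst z) * (norm (snd z - y))\<^sup>2) = q z" for z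
  proof -
    have "(norm (snd z - y))\<^sup>2 = snd z \<bullet> snd z + - 2 * (snd z \<bullet> y) + y \<bullet> y"
      by (simp add: power2_norm_eq_inner inner_diff_left inner_diff_right inner_commute)
    then show ?thesis by (simp add: q_def euclidean_inner[of "snd z" "snd z"])
  qed
  have F: "F = (\<lambda>z. p z * exp (q z))" by (simp add: F_def qe)
  show "smooth F" unfolding F
    by (intro smooth_mult smooth_compose[OF smooth_exp] poly_space_smooth p q)
  obtain p' where p': "poly_space p'" "pderivs vs F = (\<lambda>z. p' z * exp (q z))"
    using pderivs_poly_exp[OF q p] unfolding F by blast
  obtain C n where C: "0 \<le> C" "\<And>z. fst z \<in> {\<alpha>..\<beta>} \<Longrightarrow> \<bar>p' z\<bar> \<le> C * (1 + (norm (snd z))\<^sup>2) ^ n"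
    using poly_space_growth[OF p'(1), of \<alpha> \<beta>] by blast
  \<comment> \<open>A continuous positive rate has a positive minimum on a compact interval; on an
    empty interval any positive value serves.\<close>
  obtain \<kappa>0 where \<kappa>0: "0 < \<kappa>0" "\<And>t. t \<in> {\<alpha>..\<beta>} \<Longrightarrow> \<kappa>0 \<le> \<kappa> t"
  proof (cases "\<alpha> \<le> \<beta>")
    case True
    then obtain t0 where "\<forall>t\<in>{\<alpha>..\<beta>}. \<kappa> t0 \<le> \<kappa> t"
      using continuous_attains_inf[of "{\<alpha>..\<beta>}" \<kappa>] smooth_continuous_on[OF \<kappa>(1)] by auto
    then show ?thesis using that[of "\<kappa> t0"] \<kappa>(2) by blast
  qed (use that[of 1] in auto)
  obtain D where D: "0 \<le> D" "\<And>r. 0 \<le> r \<Longrightarrow> (1 + r) ^ (n + 2) * exp (- (\<kappa>0 * r)) \<le> D"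
    using power_exp_bounded[OF \<kappa>0(1), of "n + 2"] by blast
  define B where "B = (2 * (1 + (norm y)\<^sup>2)) ^ (n + 2)"
  have B: "0 \<le> B" by (simp add: B_def)
  have "\<bar>pderivs vs F z\<bar> \<le> (C * (B * D)) * decay \<alpha> \<beta> z" for z
  proof (cases "fst z \<in> {\<alpha>..\<beta>}")
    case True
    let ?x = "1 + (norm (snd z))\<^sup>2" and ?r = "(norm (snd z - y))\<^sup>2"
    have x: "1 \<le> ?x" by simp
    have "\<bar>pderivs vs F z\<bar> = \<bar>p' z\<bar> * exp (q z)" by (simp add: p'(2) abs_mult)
    also have "\<dots> \<le> (C * ?x ^ n) * exp (- (\<kappa>0 * ?r))"
      using \<kappa>0(2)[OF True] C True unfolding qe[symmetric]
      by (intro mult_mono) (auto intro: mult_right_mono)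
    also have "\<dots> = C * (?x ^ (n + 2) * exp (- (\<kappa>0 * ?r))) * inverse (?x\<^sup>2)"
    proof -
      have "?x ^ (n + 2) * inverse (?x\<^sup>2) = ?x ^ n" unfolding power_add mult.assoc
        using x by (subst right_inverse) (auto simp: add_nonneg_eq_0_iff)
      then show ?thesis by (simp add: mult.commute mult.left_commute)
    qed
    also have "\<dots> \<le> C * (B * D) * inverse (?x\<^sup>2)"
    proof (intro mult_right_mono mult_left_mono C(1))
      have "?x ^ (n + 2) \<le> (2 * (1 + (norm y)\<^sup>2) * (1 + ?r)) ^ (n + 2)"
        by (rule power_mono[OF one_plus_norm_shift]) simp
      also have "\<dots> = B * (1 + ?r) ^ (n + 2)" by (simp only: B_def power_mult_distrib)
      finally have "?x ^ (n + 2) * exp (- (\<kappa>0 * ?r)) \<le> B * (1 + ?r) ^ (n + 2) * exp (- (\<kappa>0 * ?r))"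
        by (rule mult_right_mono) simp
      also have "\<dots> = B * ((1 + ?r) ^ (n + 2) * exp (- (\<kappa>0 * ?r)))" by (simp only: mult.assoc)
      also have "\<dots> \<le> B * D" by (intro mult_left_mono B D) simp
      finally show "?x ^ (n + 2) * exp (- (\<kappa>0 * ?r)) \<le> B * D" .
    qed simp
    finally show ?thesis using True by (simp add: decay_def)
  next
    case False
    have "pderivs vs F z = 0"
    proof (rule pderivs_eq_0_outside[of "{\<alpha>..\<beta>} \<times> UNIV"])
      show "closed ({\<alpha>..\<beta>} \<times> (UNIV::'a set))" by (intro closed_Times closed_UNIV closed_atLeastAtMost)
      show "F z = 0" if "z \<notin> {\<alpha>..\<beta>} \<times> UNIV" for z
        using that supp[of z] by (cases z) (auto simp: F_def)
    qed (use False in \<open>cases z; auto\<close>)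
    then show ?thesis unfolding decay_def if_not_P[OF False] by simp
  qed
  then show "\<exists>C. \<forall>z. \<bar>pderivs vs F z\<bar> \<le> C * decay \<alpha> \<beta> z" by blast
qed

text \<open>Near a fixed point the cutoffs are eventually 1, so there all derivatives eventually
  agree with those of \<open>F\<close>. The uniform bound combines the product estimate with cutoff
  bounds that do not depend on \<open>n\<close>. Positivity of \<open>\<alpha>\<close> places the
  supports in positive times.\<close>

lemma decaying_approximation:
  fixes F :: "real \<times> 'a::euclidean_space \<Rightarrow> real"
  assumes F: "smooth F" "\<And>vs. set vs \<subseteq> Basis \<Longrightarrow> \<exists>C. \<forall>z. \<bar>pderivs vs F z\<bar> \<le> C * decay \<alpha> \<beta> z"
    and \<alpha>: "0 < \<alpha>"
  defines "F' \<equiv> \<lambda>n z. cutoff n z * F z"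
  shows "F' n \<in> test_functions ({0<..} \<times> UNIV)"
    and "(\<lambda>n. pderivs vs (F' n) z) \<longlonglongrightarrow> pderivs vs F z"
    and "set vs \<subseteq> Basis \<Longrightarrow> \<exists>C\<ge>0. \<forall>n z. \<bar>pderivs vs (F' n) z\<bar> \<le> C * decay \<alpha> \<beta> z"
proof -
  have F0: "F z = 0" if "fst z \<notin> {\<alpha>..\<beta>}" for z
  proof -
    obtain C where "\<And>z. \<bar>F z\<bar> \<le> C * decay \<alpha> \<beta> z" using F(2)[of "[]"] by auto
    from this[of z] show ?thesis using that by (auto simp: decay_def)
  qed
  show "F' n \<in> test_functions ({0<..} \<times> UNIV)"
  proof (rule test_functions_subset_compact)
    show "smooth (F' n)" unfolding F'_def by (intro smooth_mult smooth_cutoff F)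
    show "compact (cball 0 (real (Suc n)) \<inter> ({\<alpha>..\<beta>} \<times> (UNIV::'a set)))"
      by (intro compact_Int_closed compact_cball closed_Times closed_UNIV closed_atLeastAtMost)
    show "cball 0 (real (Suc n)) \<inter> ({\<alpha>..\<beta>} \<times> (UNIV::'a set)) \<subseteq> {0<..} \<times> UNIV"
      using \<alpha> by auto
    show "F' n y = 0" if "y \<notin> cball 0 (real (Suc n)) \<inter> ({\<alpha>..\<beta>} \<times> (UNIV::'a set))" for y
    proof (cases "fst y \<in> {\<alpha>..\<beta>}")
      case True
      then have "y \<notin> cball 0 (real (Suc n))" using that by (cases y) auto
      then have "cutoff n y = 0" by (intro cutoff_eq_0) simp
      then show ?thesis by (simp add: F'_def)
    qed (simp add: F'_def F0)
  qed
  show "(\<lambda>n. pderivs vs (F' n) z) \<longlonglongrightarrow> pderivs vs F z"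
  proof (rule tendsto_eventually)
    obtain N where N: "2 * (norm z + 1) \<le> real N" using real_arch_simple by blast
    have "pderivs vs (F' n) z = pderivs vs F z" if "N \<le> n" for n
    proof (rule pderivs_cong_open[OF open_ball[of z 1]])
      fix y assume "y \<in> ball z 1"
      then have "norm y \<le> norm z + 1"
        using norm_triangle_ineq[of z "y - z"] by (simp add: dist_norm norm_minus_commute)
      then have "cutoff n y = 1" using N that by (intro cutoff_eq_1) simp
      then show "F' n y = F y" by (simp add: F'_def)
    qed simp
    then show "\<forall>\<^sub>F n in sequentially. pderivs vs (F' n) z = pderivs vs F z"
      unfolding eventually_sequentially by blast
  qed
  show "\<exists>C\<ge>0. \<forall>n z. \<bar>pderivs vs (F' n) z\<bar> \<le> C * decay \<alpha> \<beta> z" if vs: "set vs \<subseteq> Basis"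
  proof -
    let ?L = "{us. set us \<subseteq> (Basis::(real \<times> 'a) set) \<and> length us \<le> length vs}"
    have fin: "finite ?L" by (rule finite_lists_length_le) simp
    obtain C where C: "\<And>us z. us \<in> ?L \<Longrightarrow> \<bar>pderivs us F z\<bar> \<le> C us * decay \<alpha> \<beta> z"
      using F(2) by (metis (mono_tags, lifting) mem_Collect_eq)
    define B where "B = (\<Sum>us\<in>?L. \<bar>C us\<bar>)"
    have B: "\<bar>pderivs us F z\<bar> \<le> B * decay \<alpha> \<beta> z" if "us \<in> ?L" for us z
    proof -
      have "C us \<le> \<bar>C us\<bar>" by simp
      also have "\<bar>C us\<bar> \<le> B" unfolding B_def using that fin by (intro member_le_sum) auto
      finally show ?thesis using C[OF that] decay_nonneg mult_right_mono order_trans by metis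
    qed
    obtain A where A: "\<And>n us z. set us \<subseteq> Basis \<and> length us \<le> length vs \<Longrightarrow>
        \<bar>pderivs us (cutoff n) (z::real \<times> 'a)\<bar> \<le> A"
      using cutoff_pderivs_bound[of "length vs"] by metis
    have "0 \<le> A" using A[of "[]" 0 0] by simp
    moreover have "0 \<le> B" by (simp add: B_def sum_nonneg)
    moreover have "\<bar>pderivs vs (F' n) z\<bar> \<le> 2 ^ length vs * (A * (B * decay \<alpha> \<beta> z))" for n z
      unfolding F'_def by (rule pderivs_mult_bound[OF smooth_cutoff F(1) vs]) (use A B in auto)
    ultimately show ?thesis
      by (intro exI[of _ "2 ^ length vs * (A * B)"]) (auto simp: mult.assoc)
  qed
qed

section \<open>The heat kernel\<close>

text \<open>Reduces a directional derivative of a differentiable function to one-variable calculus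
  along a line; the explicit derivatives of the heat kernel are computed this way.\<close>

lemma pderiv_dir_line:
  fixes f :: "'a::euclidean_space \<Rightarrow> real"
  assumes "f differentiable (at z)" "((\<lambda>s. f (z + s *\<^sub>R v)) has_real_derivative d) (at 0)"
  shows "pderiv_dir v f z = d"
proof -
  define D where "D = (\<lambda>v. pderiv_dir v f z)"
  have D: "(f has_derivative D) (at (z + 0 *\<^sub>R v))"
    using has_derivative_pderiv_dir[OF assms(1)] by (simp add: D_def)
  have 1: "((\<lambda>s. z + s *\<^sub>R v) has_derivative (\<lambda>k. k *\<^sub>R v)) (at 0)"
    using has_derivative_add[OF has_derivative_const
        bounded_linear_imp_has_derivative[OF bounded_linear_scaleR_left[of v]], of z "at 0"] by simp
  have "((\<lambda>s. f (z + s *\<^sub>R v)) has_derivative (\<lambda>k. D (k *\<^sub>R v))) (at 0)"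
    by (rule has_derivative_compose[OF 1 D])
  then have "(\<lambda>k. D (k *\<^sub>R v)) = (\<lambda>k. d * k)"
    by (rule has_derivative_unique) (rule assms(2)[unfolded has_field_derivative_def])
  from fun_cong[OF this, of 1] show ?thesis by (simp add: D_def)
qed

text \<open>The normalising factor $(4\pi)^{-3/2}$ is left out; exponentials keep the kernel visibly smooth in $s > 0$.\<close>

definition heat :: "real \<Rightarrow> real^3 \<Rightarrow> real" where
  "heat s x = exp (- (3/2) * ln s) * exp (- ((norm x)\<^sup>2 / (4 * s)))"

lemma norm_shift_power2: "(norm (x + s *\<^sub>R v))\<^sup>2 = (norm x)\<^sup>2 + 2 * s * (x \<bullet> v) + s\<^sup>2 * (v \<bullet> v)"
  unfolding power2_norm_eq_inner
  by (simp add: inner_add_left inner_add_right inner_commute[of v x] power2_eq_square algebra_simps)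

text \<open>The age \<open>\<sigma>\<close> of the kernel and the amplitude \<open>a\<close> are
  kept abstract because the same formulas are used twice, for an amplitude and for its
  derivative.\<close>

locale heat_test_function =
  fixes a \<sigma> :: "real \<Rightarrow> real" and y :: "real^3" and \<alpha> \<beta> :: real
  assumes a: "smooth a" and \<sigma>: "smooth \<sigma>" "\<And>t. 0 < \<sigma> t"
    and supp: "\<And>t. t \<notin> {\<alpha>..\<beta>} \<Longrightarrow> a t = 0"
begin

definition F :: "real \<times> (real^3) \<Rightarrow> real" where
  "F z = a (fst z) * heat (\<sigma> (fst z)) (snd z - y)"

lemma F_eq: "F = (\<lambda>z. (a (fst z) * exp (- (3/2) * ln (\<sigma> (fst z))))
    * exp (- (inverse (4 * \<sigma> (fst z)) * (norm (snd z - y))\<^sup>2)))"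
  by (rule ext) (simp only: F_def heat_def divide_inverse mult.assoc mult.commute[of "(norm _)\<^sup>2"])

lemma smooth_time_factor: "smooth (\<lambda>t. a t * exp (- (3/2) * ln (\<sigma> t)))"
  by (intro smooth_mult a smooth_compose[OF smooth_exp] smooth_ln \<sigma> smooth_const)

lemma poly_time_factor: "poly_space (\<lambda>z. a (fst z) * exp (- (3/2) * ln (\<sigma> (fst z))))"
  by (rule time[OF smooth_time_factor])

lemma smooth_rate: "smooth (\<lambda>t. inverse (4 * \<sigma> t))" "0 < inverse (4 * \<sigma> t)"
proof -
  have "4 * \<sigma> t \<noteq> 0" for t using \<sigma>(2)[of t] by simp
  then show "smooth (\<lambda>t. inverse (4 * \<sigma> t))"
    by (intro smooth_inverse smooth_mult \<sigma> smooth_const)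
qed (simp add: \<sigma>)

lemma smooth_F: "smooth F"
  and decay_F: "\<exists>C. \<forall>z. \<bar>pderivs vs F z\<bar> \<le> C * decay \<alpha> \<beta> z"
  unfolding F_eq
  by (rule gaussian_decay[OF poly_time_factor smooth_rate]; use supp in auto)+

lemma pderiv_1: "pderiv_dir (0, u) F = (\<lambda>z. - ((snd z - y) \<bullet> u) / (2 * \<sigma> (fst z)) * F z)"
proof
  fix z :: "real \<times> (real^3)"
  have s: "\<sigma> (fst z) \<noteq> 0" using \<sigma>(2)[of "fst z"] by simp
  have eq: "F (z + s *\<^sub>R (0, u)) = a (fst z) * (exp (- (3/2) * ln (\<sigma> (fst z)))
      * exp (- (((norm (snd z - y))\<^sup>2 + 2 * s * ((snd z - y) \<bullet> u) + s\<^sup>2 * (u \<bullet> u)) / (4 * \<sigma> (fst z)))))" for s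
    unfolding norm_shift_power2[symmetric] by (simp add: F_def heat_def algebra_simps)
  show "pderiv_dir (0, u) F z = - ((snd z - y) \<bullet> u) / (2 * \<sigma> (fst z)) * F z"
  proof (rule pderiv_dir_line[OF smooth_differentiable[OF smooth_F]])
    show "((\<lambda>s. F (z + s *\<^sub>R (0, u))) has_real_derivative - ((snd z - y) \<bullet> u) / (2 * \<sigma> (fst z)) * F z) (at 0)"
      unfolding eq using s
      by (auto intro!: derivative_eq_intros simp: F_def heat_def field_simps)
  qed
qed

lemma pderiv_2: "pderiv_dir (0, v) (pderiv_dir (0, u) F) =
   (\<lambda>z. (((snd z - y) \<bullet> u) * ((snd z - y) \<bullet> v) / (4 * (\<sigma> (fst z))\<^sup>2) - (u \<bullet> v) / (2 * \<sigma> (fst z))) * F z)"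
  if "(0::real, u) \<in> Basis"
proof
  fix z :: "real \<times> (real^3)"
  have s: "\<sigma> (fst z) \<noteq> 0" using \<sigma>(2)[of "fst z"] by simp
  have DF: "((\<lambda>s. F (z + s *\<^sub>R (0, v))) has_real_derivative - ((snd z - y) \<bullet> v) / (2 * \<sigma> (fst z)) * F z) (at 0)"
  proof -
    have eq: "F (z + s *\<^sub>R (0, v)) = a (fst z) * (exp (- (3/2) * ln (\<sigma> (fst z)))
      * exp (- (((norm (snd z - y))\<^sup>2 + 2 * s * ((snd z - y) \<bullet> v) + s\<^sup>2 * (v \<bullet> v)) / (4 * \<sigma> (fst z)))))" for s
      unfolding norm_shift_power2[symmetric] by (simp add: F_def heat_def algebra_simps)
    show ?thesis unfolding eq using s
      by (auto intro!: derivative_eq_intros simp: F_def heat_def field_simps)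
  qed
  have eq: "pderiv_dir (0, u) F (z + s *\<^sub>R (0, v))
      = - (((snd z - y) \<bullet> u) + s * (v \<bullet> u)) / (2 * \<sigma> (fst z)) * F (z + s *\<^sub>R (0, v))" for s
    unfolding pderiv_1 by (simp add: inner_diff_left inner_add_left algebra_simps)
  show "pderiv_dir (0, v) (pderiv_dir (0, u) F) z
    = (((snd z - y) \<bullet> u) * ((snd z - y) \<bullet> v) / (4 * (\<sigma> (fst z))\<^sup>2) - (u \<bullet> v) / (2 * \<sigma> (fst z))) * F z"
  proof (rule pderiv_dir_line)
    define f A B S where "f = (\<lambda>s. F (z + s *\<^sub>R (0, v)))"
      and "A = (snd z - y) \<bullet> u" and "B = (snd z - y) \<bullet> v" and "S = \<sigma> (fst z)"
    have f0: "f 0 = F z" by (simp add: f_def zero_prod_def[symmetric])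
    have Df: "(f has_real_derivative - B / (2 * S) * F z) (at 0)"
      using DF by (simp add: f_def B_def S_def)
    have S: "S \<noteq> 0" using s by (simp add: S_def)
    have "((\<lambda>s. - (A + s * (v \<bullet> u)) / (2 * S) * f s) has_real_derivative
        - (v \<bullet> u) / (2 * S) * f 0 + (- B / (2 * S) * F z) * (- (A + 0 * (v \<bullet> u)) / (2 * S))) (at 0)"
      by (rule DERIV_mult[OF _ Df]) (use S in \<open>auto intro!: derivative_eq_intros simp: field_simps\<close>)
    also have "- (v \<bullet> u) / (2 * S) * f 0 + (- B / (2 * S) * F z) * (- (A + 0 * (v \<bullet> u)) / (2 * S))
        = (A * B / (4 * S\<^sup>2) - (u \<bullet> v) / (2 * S)) * F z"
      using S by (simp add: f0 inner_commute[of v u] power2_eq_square field_simps)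
    finally show "((\<lambda>s. pderiv_dir (0, u) F (z + s *\<^sub>R (0, v))) has_real_derivative
      (((snd z - y) \<bullet> u) * ((snd z - y) \<bullet> v) / (4 * (\<sigma> (fst z))\<^sup>2) - (u \<bullet> v) / (2 * \<sigma> (fst z))) * F z) (at 0)"
      unfolding eq f_def A_def B_def S_def .
  qed (intro smooth_differentiable smooth_pderiv_dir smooth_F that)
qed

lemma pderiv_3: "pderiv_dir (0, w) (pderiv_dir (0, v) (pderiv_dir (0, u) F)) =
   (\<lambda>z. (- ((snd z - y) \<bullet> u) * ((snd z - y) \<bullet> v) * ((snd z - y) \<bullet> w) / (8 * (\<sigma> (fst z)) ^ 3)
      + ((u \<bullet> w) * ((snd z - y) \<bullet> v) + (v \<bullet> w) * ((snd z - y) \<bullet> u) + (u \<bullet> v) * ((snd z - y) \<bullet> w))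
        / (4 * (\<sigma> (fst z))\<^sup>2)) * F z)"
  if "(0::real, u) \<in> Basis" "(0::real, v) \<in> Basis"
proof
  fix z :: "real \<times> (real^3)"
  have s: "\<sigma> (fst z) \<noteq> 0" using \<sigma>(2)[of "fst z"] by simp
  have DF: "((\<lambda>s. F (z + s *\<^sub>R (0, w))) has_real_derivative - ((snd z - y) \<bullet> w) / (2 * \<sigma> (fst z)) * F z) (at 0)"
  proof -
    have eq: "F (z + s *\<^sub>R (0, w)) = a (fst z) * (exp (- (3/2) * ln (\<sigma> (fst z)))
      * exp (- (((norm (snd z - y))\<^sup>2 + 2 * s * ((snd z - y) \<bullet> w) + s\<^sup>2 * (w \<bullet> w)) / (4 * \<sigma> (fst z)))))" for s
      unfolding norm_shift_power2[symmetric] by (simp add: F_def heat_def algebra_simps)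
    show ?thesis unfolding eq using s
      by (auto intro!: derivative_eq_intros simp: F_def heat_def field_simps)
  qed
  define A B C where "A = (snd z - y) \<bullet> u" and "B = (snd z - y) \<bullet> v" and "C = (snd z - y) \<bullet> w"
  define S where "S = \<sigma> (fst z)"
  have eq: "pderiv_dir (0, v) (pderiv_dir (0, u) F) (z + s *\<^sub>R (0, w))
      = ((A + s * (u \<bullet> w)) * (B + s * (v \<bullet> w)) / (4 * S\<^sup>2) - (u \<bullet> v) / (2 * S)) * F (z + s *\<^sub>R (0, w))" for s
    unfolding pderiv_2[OF that(1)] A_def B_def S_def inner_commute[of u w] inner_commute[of v w]
    by (simp add: inner_diff_left inner_add_left algebra_simps)
  show "pderiv_dir (0, w) (pderiv_dir (0, v) (pderiv_dir (0, u) F)) z =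
     (- ((snd z - y) \<bullet> u) * ((snd z - y) \<bullet> v) * ((snd z - y) \<bullet> w) / (8 * (\<sigma> (fst z)) ^ 3)
      + ((u \<bullet> w) * ((snd z - y) \<bullet> v) + (v \<bullet> w) * ((snd z - y) \<bullet> u) + (u \<bullet> v) * ((snd z - y) \<bullet> w))
        / (4 * (\<sigma> (fst z))\<^sup>2)) * F z"
    unfolding A_def[symmetric] B_def[symmetric] C_def[symmetric] S_def[symmetric]
  proof (rule pderiv_dir_line)
    define f where "f = (\<lambda>s. F (z + s *\<^sub>R (0, w)))"
    have f0: "f 0 = F z" by (simp add: f_def zero_prod_def[symmetric])
    have Df: "(f has_real_derivative - C / (2 * S) * F z) (at 0)"
      using DF by (simp add: f_def C_def S_def)
    have S: "S \<noteq> 0" using s by (simp add: S_def)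
    have "((\<lambda>s. ((A + s * (u \<bullet> w)) * (B + s * (v \<bullet> w)) / (4 * S\<^sup>2) - (u \<bullet> v) / (2 * S)) * f s) has_real_derivative
        ((u \<bullet> w) * B + A * (v \<bullet> w)) / (4 * S\<^sup>2) * f 0
        + (- C / (2 * S) * F z) * ((A + 0 * (u \<bullet> w)) * (B + 0 * (v \<bullet> w)) / (4 * S\<^sup>2) - (u \<bullet> v) / (2 * S))) (at 0)"
      by (rule DERIV_mult[OF _ Df]) (use S in \<open>auto intro!: derivative_eq_intros simp: field_simps\<close>)
    also have "((u \<bullet> w) * B + A * (v \<bullet> w)) / (4 * S\<^sup>2) * f 0
        + (- C / (2 * S) * F z) * ((A + 0 * (u \<bullet> w)) * (B + 0 * (v \<bullet> w)) / (4 * S\<^sup>2) - (u \<bullet> v) / (2 * S))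
        = (- A * B * C / (8 * S ^ 3) + ((u \<bullet> w) * B + (v \<bullet> w) * A + (u \<bullet> v) * C) / (4 * S\<^sup>2)) * F z"
      using S by (simp add: f0 power2_eq_square power3_eq_cube field_simps)
    finally show "((\<lambda>s. pderiv_dir (0, v) (pderiv_dir (0, u) F) (z + s *\<^sub>R (0, w))) has_real_derivative
      (- A * B * C / (8 * S ^ 3) + ((u \<bullet> w) * B + (v \<bullet> w) * A + (u \<bullet> v) * C) / (4 * S\<^sup>2)) * F z) (at 0)"
      unfolding eq f_def .
  qed (intro smooth_differentiable smooth_pderiv_dir smooth_F that)
qed

lemma laplace_F: "(\<Sum>j\<in>UNIV. pderiv_dir (e_space j) (pderiv_dir (e_space j) F) z)
    = ((norm (snd z - y))\<^sup>2 / (4 * (\<sigma> (fst z))\<^sup>2) - 3 / (2 * \<sigma> (fst z))) * F z"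
proof -
  have b: "e_space j \<in> Basis" for j :: 3
    by (auto simp: Basis_prod_def axis_in_Basis_iff)
  have "(norm x)\<^sup>2 = (\<Sum>j\<in>UNIV. (x $ j) * (x $ j))" for x :: "real^3"
    by (simp add: power2_norm_eq_inner inner_vec_def)
  then show ?thesis
    unfolding pderiv_2[OF b]
    by (simp add: inner_axis inner_axis_axis sum_distrib_right[symmetric] sum_subtractf sum_divide_distrib[symmetric])
qed

text \<open>Where \<open>a\<close> is nonzero the age decreases at unit speed, so the kernel solves
  the backward heat equation and the derivative of the amplitude is the only extra term. Multiplying
  the condition on \<open>\<sigma>\<close> by \<open>a\<close> leaves \<open>\<sigma>\<close> free
  elsewhere.\<close>

lemma pderiv_time_F:
  assumes "\<And>t. a t * pderiv_dir 1 \<sigma> t = - a t"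
  shows "pderiv_dir e_time F z = pderiv_dir 1 a (fst z) * heat (\<sigma> (fst z)) (snd z - y)
     - (\<Sum>j\<in>UNIV. pderiv_dir (e_space j) (pderiv_dir (e_space j) F) z)"
proof (rule pderiv_dir_line[OF smooth_differentiable[OF smooth_F]])
  define t S S' where "t = fst z" and "S = \<sigma> t" and "S' = pderiv_dir 1 \<sigma> t"
  define N where "N = (norm (snd z - y))\<^sup>2"
  have S: "S > 0" using \<sigma> by (simp add: S_def)
  have as: "a t * S' = - a t" using assms by (simp add: S'_def)
  have sh: "((\<lambda>s. f (t + s)) has_real_derivative pderiv_dir 1 f t) (at 0)" if "smooth f" for f
    using has_real_derivative_pderiv_dir[OF that, of t] DERIV_shift[of f "pderiv_dir 1 f t" 0 t]
    by (simp add: add.commute)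
  have eq: "F (z + s *\<^sub>R e_time) = a (t + s) * (exp (- (3/2) * ln (\<sigma> (t + s))) * exp (- (N / (4 * \<sigma> (t + s)))))" for s
    by (simp add: F_def heat_def t_def N_def)
  define E G where "E = exp (- (3/2) * ln S)" and "G = exp (- (N / (4 * S)))"
  have D\<sigma>: "((\<lambda>s. \<sigma> (t + s)) has_real_derivative S') (at 0)"
    unfolding S'_def by (rule sh[OF \<sigma>(1)])
  have "((\<lambda>u. exp (- (3/2) * ln u)) has_real_derivative E * (- (3/2) * (1 / S))) (at (\<sigma> (t + 0)))"
    using S by (auto intro!: derivative_eq_intros simp: S_def[symmetric] E_def field_simps)
  from DERIV_chain2[OF this D\<sigma>]
  have 1: "((\<lambda>s. exp (- (3/2) * ln (\<sigma> (t + s)))) has_real_derivative E * (- (3/2) * (S' / S))) (at 0)"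
    by (simp add: mult.assoc)
  have "((\<lambda>u. exp (- (N / (4 * u)))) has_real_derivative G * (N / (4 * S\<^sup>2))) (at (\<sigma> (t + 0)))"
    using S by (auto intro!: derivative_eq_intros simp: S_def[symmetric] G_def power2_eq_square field_simps)
  from DERIV_chain2[OF this D\<sigma>]
  have 2: "((\<lambda>s. exp (- (N / (4 * \<sigma> (t + s))))) has_real_derivative G * (N * S' / (4 * S\<^sup>2))) (at 0)"
    by (simp add: mult.assoc)
  have 3: "((\<lambda>s. a (t + s)) has_real_derivative pderiv_dir 1 a t) (at 0)" by (rule sh[OF a])
  have "((\<lambda>s. F (z + s *\<^sub>R e_time)) has_real_derivative
     pderiv_dir 1 a t * (E * G) + (E * (- (3/2) * (S' / S)) * G + G * (N * S' / (4 * S\<^sup>2)) * E) * a t) (at 0)"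
    unfolding eq using DERIV_mult[OF 3 DERIV_mult[OF 1 2]] by (simp add: E_def G_def S_def)
  also have "pderiv_dir 1 a t * (E * G) + (E * (- (3/2) * (S' / S)) * G + G * (N * S' / (4 * S\<^sup>2)) * E) * a t
      = pderiv_dir 1 a t * (E * G) + (a t * S') * ((N / (4 * S\<^sup>2) - 3 / (2 * S)) * (E * G))"
    using S by (simp add: power2_eq_square field_simps)
  finally have "((\<lambda>s. F (z + s *\<^sub>R e_time)) has_real_derivative
     pderiv_dir 1 a t * (E * G) + (a t * S') * ((N / (4 * S\<^sup>2) - 3 / (2 * S)) * (E * G))) (at 0)" .
  then show "((\<lambda>s. F (z + s *\<^sub>R e_time)) has_real_derivative
     pderiv_dir 1 a (fst z) * heat (\<sigma> (fst z)) (snd z - y)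
     - (\<Sum>j\<in>UNIV. pderiv_dir (e_space j) (pderiv_dir (e_space j) F) z)) (at 0)"
    unfolding laplace_F as by (simp add: F_def heat_def S_def t_def N_def E_def G_def mult.left_commute)
qed

end


section \<open>Bounds of the kernel and its derivatives by parabolic powers\<close>

lemma heat_pos: "0 < heat s x"
  by (simp add: heat_def)

lemma heat_eq: "0 < s \<Longrightarrow> heat s x = s powr (-3/2) * exp (- ((norm x)\<^sup>2 / (4 * s)))"
  by (simp add: heat_def powr_def)

text \<open>Trades the Gaussian for powers of the parabolic ratio
  \<open>s / (s + (norm x)\<^sup>2)\<close>. Each power contributes a factor \<open>s\<close>, which
  cancels negative powers of \<open>s\<close> in the kernel and its derivatives.\<close>

lemma gaussian_ratio_bound:
  "\<exists>C\<ge>0. \<forall>s>0. \<forall>x::real^3. exp (- ((norm x)\<^sup>2 / (4 * s))) \<le> C * (s / (s + (norm x)\<^sup>2)) ^ n"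
proof -
  have p: "(0::real) < 1/4" by simp
  obtain C :: real where C: "0 \<le> C" "\<And>r. 0 \<le> r \<Longrightarrow> (1 + r) ^ n * exp (- (1/4 * r)) \<le> C"
    using power_exp_bounded[OF p, of n] by blast
  have "exp (- ((norm x)\<^sup>2 / (4 * s))) \<le> C * (s / (s + (norm x)\<^sup>2)) ^ n" if s: "0 < s" for s and x :: "real^3"
  proof -
    let ?r = "(norm x)\<^sup>2 / s"
    have r: "0 \<le> ?r" using s by simp
    have "(1 + ?r) ^ n * exp (- ((norm x)\<^sup>2 / (4 * s))) \<le> C"
      using C(2)[OF r] by (simp add: mult.commute)
    then have "exp (- ((norm x)\<^sup>2 / (4 * s))) \<le> C / (1 + ?r) ^ n"
      using r by (simp add: pos_le_divide_eq mult.commute add_pos_nonneg)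
    also have "\<dots> = C * (1 / (1 + ?r)) ^ n" by (simp add: power_divide)
    also have "1 / (1 + ?r) = s / (s + (norm x)\<^sup>2)" using s by (simp add: field_simps)
    finally show ?thesis .
  qed
  then show ?thesis using C(1) by blast
qed

lemma ratio_powr:
  assumes "0 < s" "0 \<le> (N::real)"
  shows "s powr (- p) * (s / (s + N)) powr p = (s + N) powr (- p)"
  using assms by (simp add: powr_divide powr_minus field_simps)

lemma ratio_power_le_powr:
  assumes "0 < s" "0 \<le> (N::real)" "p \<le> real n"
  shows "(s / (s + N)) ^ n \<le> (s / (s + N)) powr p"
proof -
  have "(s / (s + N)) ^ n = (s / (s + N)) powr real n"
    using assms by (intro powr_realpow[symmetric]) (auto intro: divide_pos_pos add_pos_nonneg)
  also have "\<dots> \<le> (s / (s + N)) powr p"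
    using assms by (intro powr_mono') (auto simp: divide_le_eq)
  finally show ?thesis .
qed

text \<open>The exponents here and in the next two bounds are dictated by parabolic scaling: 3/2 for
  the kernel itself and 1/2 more for each space derivative.\<close>

lemma heat_bound:
  "\<exists>C\<ge>0. \<forall>s>0. \<forall>x. heat s x \<le> C * (s + (norm x)\<^sup>2) powr (-3/2)"
proof -
  obtain C where C: "0 \<le> C" "\<And>s x. 0 < s \<Longrightarrow> exp (- ((norm (x::real^3))\<^sup>2 / (4 * s))) \<le> C * (s / (s + (norm x)\<^sup>2)) ^ 2"
    using gaussian_ratio_bound[of 2] by blast
  have "heat s x \<le> C * (s + (norm x)\<^sup>2) powr (-3/2)" if s: "0 < s" for s x
  proof -
    let ?\<rho> = "s / (s + (norm x)\<^sup>2)"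
    have "heat s x \<le> s powr (-3/2) * (C * ?\<rho> ^ 2)"
      unfolding heat_eq[OF s] by (intro mult_left_mono C s) simp
    also have "\<dots> \<le> s powr (-3/2) * (C * ?\<rho> powr (3/2))"
      by (intro mult_left_mono ratio_power_le_powr C s) auto
    also have "\<dots> = C * (s powr (- (3/2)) * ?\<rho> powr (3/2))" by simp
    also have "\<dots> = C * (s + (norm x)\<^sup>2) powr (- (3/2))"
      by (subst ratio_powr) (use s in auto)
    finally show ?thesis by simp
  qed
  then show ?thesis using C(1) by blast
qed

lemma heat_laplace_bound:
  "\<exists>C\<ge>0. \<forall>s>0. \<forall>x. \<bar>((norm x)\<^sup>2 / (4 * s\<^sup>2) - 3 / (2 * s)) * heat s x\<bar> \<le> C * (s + (norm x)\<^sup>2) powr (-5/2)"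
proof -
  obtain C where C: "0 \<le> C" "\<And>s x. 0 < s \<Longrightarrow> exp (- ((norm (x::real^3))\<^sup>2 / (4 * s))) \<le> C * (s / (s + (norm x)\<^sup>2)) ^ 4"
    using gaussian_ratio_bound[of 4] by blast
  have "\<bar>((norm x)\<^sup>2 / (4 * s\<^sup>2) - 3 / (2 * s)) * heat s x\<bar> \<le> 2 * C * (s + (norm x)\<^sup>2) powr (-5/2)" if s: "0 < s" for s x
  proof -
    let ?N = "(norm x)\<^sup>2"
    let ?\<rho> = "s / (s + ?N)"
    have \<rho>: "0 < ?\<rho>" using s by (intro divide_pos_pos add_pos_nonneg) auto
    have "\<bar>?N / (4 * s\<^sup>2) - 3 / (2 * s)\<bar> \<le> ?N / (4 * s\<^sup>2) + 3 / (2 * s)"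
      using s by (intro order_trans[OF abs_triangle_ineq4]) simp
    also have "\<dots> \<le> 2 * (s + ?N) / s\<^sup>2"
      using s by (simp add: field_simps power2_eq_square)
    also have "\<dots> = 2 / s * (1 / ?\<rho>)" using s by (simp add: field_simps power2_eq_square)
    finally have 1: "\<bar>?N / (4 * s\<^sup>2) - 3 / (2 * s)\<bar> \<le> 2 / s * (1 / ?\<rho>)" .
    have "\<bar>(?N / (4 * s\<^sup>2) - 3 / (2 * s)) * heat s x\<bar> = \<bar>?N / (4 * s\<^sup>2) - 3 / (2 * s)\<bar> * heat s x"
      using heat_pos[of s x] by (simp add: abs_mult)
    also have "\<dots> \<le> (2 / s * (1 / ?\<rho>)) * (s powr (-3/2) * (C * ?\<rho> ^ 4))"
      unfolding heat_eq[OF s] using s \<rho> by (intro mult_mono[OF 1] mult_left_mono C s) (auto intro: add_nonneg_nonneg)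
    also have "\<dots> = 2 * C * (s powr (-3/2) / s) * (?\<rho> ^ 4 * (1 / ?\<rho>))" by simp
    also have "?\<rho> ^ 4 * (1 / ?\<rho>) = ?\<rho> ^ 3" using \<rho> by (simp add: power_def eval_nat_numeral)
    also have "s powr (-3/2) / s = s powr (- (5/2))"
      using powr_diff[of s "-3/2" 1] s by simp
    also have "2 * C * s powr (- (5/2)) * ?\<rho> ^ 3 \<le> 2 * C * s powr (- (5/2)) * ?\<rho> powr (5/2)"
      by (intro mult_left_mono ratio_power_le_powr s) (use C in auto)
    also have "\<dots> = 2 * C * (s powr (- (5/2)) * ?\<rho> powr (5/2))" by simp
    also have "\<dots> = 2 * C * (s + (norm x)\<^sup>2) powr (- (5/2))"
      by (subst ratio_powr) (use s in auto)
    finally show ?thesis by simp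
  qed
  then show ?thesis using C(1) by (intro exI[of _ "2 * C"]) auto
qed

text \<open>Writing \<open>s = h\<^sup>2\<close> and \<open>norm x = h * m\<close> bounds the
  derivative by a polynomial in \<open>m\<close> over the sixth power of \<open>h\<close>, times the
  Gaussian. Of the five powers of the ratio taken from the Gaussian, two absorb the polynomial and
  three remain as the bound.\<close>

lemma heat_third_derivative_bound:
  "\<exists>C\<ge>0. \<forall>s>0. \<forall>x u v w. norm u \<le> 1 \<and> norm v \<le> 1 \<and> norm w \<le> 1 \<longrightarrow>
    \<bar>(- (x \<bullet> u) * (x \<bullet> v) * (x \<bullet> w) / (8 * s ^ 3)
      + ((u \<bullet> w) * (x \<bullet> v) + (v \<bullet> w) * (x \<bullet> u) + (u \<bullet> v) * (x \<bullet> w)) / (4 * s\<^sup>2)) * heat s x\<bar>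
    \<le> C * (s + (norm x)\<^sup>2) powr (-3)"
proof -
  obtain C where C: "0 \<le> C" "\<And>s x. 0 < s \<Longrightarrow> exp (- ((norm (x::real^3))\<^sup>2 / (4 * s))) \<le> C * (s / (s + (norm x)\<^sup>2)) ^ 5"
    using gaussian_ratio_bound[of 5] by blast
  have "\<bar>(- (x \<bullet> u) * (x \<bullet> v) * (x \<bullet> w) / (8 * s ^ 3)
      + ((u \<bullet> w) * (x \<bullet> v) + (v \<bullet> w) * (x \<bullet> u) + (u \<bullet> v) * (x \<bullet> w)) / (4 * s\<^sup>2)) * heat s x\<bar>
    \<le> C * (s + (norm x)\<^sup>2) powr (-3)"
    if s: "0 < s" and n: "norm u \<le> 1" "norm v \<le> 1" "norm w \<le> 1" for s and x u v w :: "real^3"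
  proof -
    define h m where "h = sqrt s" and "m = norm x / h"
    have h: "0 < h" "s = h\<^sup>2" using s by (auto simp: h_def)
    have m: "0 \<le> m" "norm x = h * m" using h by (auto simp: m_def)
    let ?\<rho> = "s / (s + (norm x)\<^sup>2)"
    have cs: "\<bar>a \<bullet> b\<bar> \<le> norm a" if "norm b \<le> 1" for a b :: "real^3"
      using Cauchy_Schwarz_ineq2[of a b] mult_left_le[OF that norm_ge_zero[of a]] by linarith
    have c1: "\<bar>a \<bullet> b\<bar> \<le> 1" if "norm a \<le> 1" "norm b \<le> 1" for a b :: "real^3"
      using cs[OF that(2), of a] that(1) by linarith
    have "\<bar>- (x \<bullet> u) * (x \<bullet> v) * (x \<bullet> w)\<bar> \<le> norm x * norm x * norm x"
      unfolding abs_mult abs_minus_cancel by (intro mult_mono cs n) auto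
    then have t1: "\<bar>- (x \<bullet> u) * (x \<bullet> v) * (x \<bullet> w) / (8 * s ^ 3)\<bar> \<le> norm x * norm x * norm x / (8 * s ^ 3)"
      using s by (simp add: abs_divide divide_right_mono)
    have "\<bar>(u \<bullet> w) * (x \<bullet> v)\<bar> \<le> 1 * norm x" "\<bar>(v \<bullet> w) * (x \<bullet> u)\<bar> \<le> 1 * norm x" "\<bar>(u \<bullet> v) * (x \<bullet> w)\<bar> \<le> 1 * norm x"
      unfolding abs_mult by (intro mult_mono c1 cs n; simp)+
    then have "\<bar>(u \<bullet> w) * (x \<bullet> v) + (v \<bullet> w) * (x \<bullet> u) + (u \<bullet> v) * (x \<bullet> w)\<bar> \<le> 3 * norm x" by linarith
    then have t2: "\<bar>((u \<bullet> w) * (x \<bullet> v) + (v \<bullet> w) * (x \<bullet> u) + (u \<bullet> v) * (x \<bullet> w)) / (4 * s\<^sup>2)\<bar> \<le> 3 * norm x / (4 * s\<^sup>2)"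
      using s by (simp add: abs_divide divide_right_mono)
    define L where "L = - (x \<bullet> u) * (x \<bullet> v) * (x \<bullet> w) / (8 * s ^ 3)
      + ((u \<bullet> w) * (x \<bullet> v) + (v \<bullet> w) * (x \<bullet> u) + (u \<bullet> v) * (x \<bullet> w)) / (4 * s\<^sup>2)"
    have "\<bar>L\<bar> \<le> norm x * norm x * norm x / (8 * s ^ 3) + 3 * norm x / (4 * s\<^sup>2)"
      unfolding L_def using t1 t2 by (intro order_trans[OF abs_triangle_ineq]) (rule add_mono)
    also have "\<dots> = (m ^ 3 / 8 + 3 * m / 4) / h ^ 3"
      using h by (simp add: m(2) field_simps eval_nat_numeral)
    also have "\<dots> \<le> (1 + m\<^sup>2)\<^sup>2 / h ^ 3"
    proof -
      \<comment> \<open>\<open>q\<close> and \<open>r\<close> stand for the second and fourth powers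
        of \<open>m\<close> and \<open>c\<close> for the third, so that only linear arithmetic is
        left.\<close>
      have lin: "c / 8 + 3 * m / 4 \<le> 1 + 2 * q + r"
        if "m \<le> (1 + q) / 2" "c \<le> (q + r) / 2" "0 \<le> q" "0 \<le> r" for c q r :: real
        using that by argo
      have 1: "m \<le> (1 + m\<^sup>2) / 2" using sum_squares_bound[of m 1] by simp
      have 2: "m ^ 3 \<le> (m\<^sup>2 + m ^ 4) / 2"
        using mult_left_mono[OF 1 zero_le_power2[of m]] by (simp add: eval_nat_numeral algebra_simps)
      have "m ^ 3 / 8 + 3 * m / 4 \<le> 1 + 2 * m\<^sup>2 + m ^ 4"
        by (rule lin[OF 1 2]) simp_all
      also have "\<dots> = (1 + m\<^sup>2)\<^sup>2" by (simp add: power2_sum power_mult[symmetric])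
      finally have "m ^ 3 / 8 + 3 * m / 4 \<le> (1 + m\<^sup>2)\<^sup>2" .
      then show ?thesis using h by (intro divide_right_mono) auto
    qed
    finally have L: "\<bar>L\<bar> \<le> (1 + m\<^sup>2)\<^sup>2 / h ^ 3" .
    have \<rho>: "?\<rho> = 1 / (1 + m\<^sup>2)"
    proof -
      have "s + (norm x)\<^sup>2 = h\<^sup>2 * (1 + m\<^sup>2)" by (simp add: h(2) m(2) power_mult_distrib distrib_left)
      then show ?thesis using h by simp
    qed
    have m1: "0 < 1 + m\<^sup>2" by (simp add: add_pos_nonneg)
    have hs: "s powr (-3/2) = 1 / h ^ 3"
    proof -
      have "s powr (-3/2) = h powr (-3)"
        using powr_powr[of h 2 "-3/2"] powr_realpow[of h 2] h by simp
      also have "\<dots> = 1 / h ^ 3" using h powr_minus_divide[of h 3] powr_realpow[of h 3] by simp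
      finally show ?thesis .
    qed
    have "\<bar>L * heat s x\<bar> = \<bar>L\<bar> * heat s x" using heat_pos[of s x] by (simp add: abs_mult)
    also have "\<dots> \<le> ((1 + m\<^sup>2)\<^sup>2 / h ^ 3) * (1 / h ^ 3 * (C * ?\<rho> ^ 5))"
      unfolding heat_eq[OF s] hs using h by (intro mult_mono[OF L] mult_left_mono C s) auto
    also have "\<dots> = C * (?\<rho> ^ 3 / h ^ 6)"
    proof -
      have "M\<^sup>2 / h ^ 3 * (1 / h ^ 3 * (C * (1 / M) ^ 5)) = C * ((1 / M) ^ 3 / h ^ 6)" if "M \<noteq> 0" for M
        using that h by (simp add: field_simps eval_nat_numeral)
      then show ?thesis unfolding \<rho> using m1 by simp
    qed
    also have "?\<rho> ^ 3 / h ^ 6 = 1 / (s + (norm x)\<^sup>2) ^ 3"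
    proof -
      have "h ^ 6 = s ^ 3" by (simp add: h(2) power_mult[symmetric])
      then show ?thesis using s by (simp add: power_divide)
    qed
    also have "\<dots> = (s + (norm x)\<^sup>2) powr (-3)"
      using s powr_minus_divide[of "s + (norm x)\<^sup>2" 3] powr_realpow[of "s + (norm x)\<^sup>2" 3]
      by (simp add: add_pos_nonneg)
    finally show ?thesis unfolding L_def .
  qed
  then show ?thesis using C(1) by blast
qed

text \<open>The constants chosen with \<open>SOME\<close> here and below exist by the bounds proved just before; fixing them
  makes the later estimates uniform in the solution.\<close>

definition heat3_const :: real where
  "heat3_const = (SOME C. 0 < C \<and> (\<forall>s>0. \<forall>x u v w. norm u \<le> 1 \<and> norm v \<le> 1 \<and> norm w \<le> 1 \<longrightarrow>
    \<bar>(- (x \<bullet> u) * (x \<bullet> v) * (x \<bullet> w) / (8 * s ^ 3)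
      + ((u \<bullet> w) * (x \<bullet> v) + (v \<bullet> w) * (x \<bullet> u) + (u \<bullet> v) * (x \<bullet> w)) / (4 * s\<^sup>2)) * heat s x\<bar>
    \<le> C * (s + (norm x)\<^sup>2) powr (-3)))"

lemma heat3_const:
  "0 < heat3_const"
  "0 < s \<Longrightarrow> norm u \<le> 1 \<and> norm v \<le> 1 \<and> norm w \<le> 1 \<Longrightarrow>
    \<bar>(- (x \<bullet> u) * (x \<bullet> v) * (x \<bullet> w) / (8 * s ^ 3)
      + ((u \<bullet> w) * (x \<bullet> v) + (v \<bullet> w) * (x \<bullet> u) + (u \<bullet> v) * (x \<bullet> w)) / (4 * s\<^sup>2)) * heat s x\<bar>
    \<le> heat3_const * (s + (norm x)\<^sup>2) powr (-3)"
proof -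
  define P where "P C \<longleftrightarrow> 0 < C \<and> (\<forall>s>0. \<forall>x u v w. norm u \<le> 1 \<and> norm v \<le> 1 \<and> norm w \<le> 1 \<longrightarrow>
    \<bar>(- (x \<bullet> u) * (x \<bullet> v) * (x \<bullet> w) / (8 * s ^ 3)
      + ((u \<bullet> w) * (x \<bullet> v) + (v \<bullet> w) * (x \<bullet> u) + (u \<bullet> v) * (x \<bullet> w)) / (4 * s\<^sup>2)) * heat s x\<bar>
    \<le> C * (s + (norm x)\<^sup>2) powr (-3))" for C
  obtain C where C: "0 \<le> C" "\<forall>s>0. \<forall>x u v w. norm u \<le> 1 \<and> norm v \<le> 1 \<and> norm w \<le> 1 \<longrightarrow>
    \<bar>(- (x \<bullet> u) * (x \<bullet> v) * (x \<bullet> w) / (8 * s ^ 3)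
      + ((u \<bullet> w) * (x \<bullet> v) + (v \<bullet> w) * (x \<bullet> u) + (u \<bullet> v) * (x \<bullet> w)) / (4 * s\<^sup>2)) * heat s x\<bar>
    \<le> C * (s + (norm x)\<^sup>2) powr (-3)"
    using heat_third_derivative_bound by blast
  have "C * (s + (norm (x::real^3))\<^sup>2) powr (-3) \<le> (C + 1) * (s + (norm x)\<^sup>2) powr (-3)" for s x
    by (rule mult_right_mono) auto
  with C have "P (C + 1)" unfolding P_def by (meson add_nonneg_pos order_trans zero_less_one)
  then have "P heat3_const" unfolding heat3_const_def P_def[symmetric] by (rule someI)
  then show "0 < heat3_const"
    "0 < s \<Longrightarrow> norm u \<le> 1 \<and> norm v \<le> 1 \<and> norm w \<le> 1 \<Longrightarrow>
    \<bar>(- (x \<bullet> u) * (x \<bullet> v) * (x \<bullet> w) / (8 * s ^ 3)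
      + ((u \<bullet> w) * (x \<bullet> v) + (v \<bullet> w) * (x \<bullet> u) + (u \<bullet> v) * (x \<bullet> w)) / (4 * s\<^sup>2)) * heat s x\<bar>
    \<le> heat3_const * (s + (norm x)\<^sup>2) powr (-3)"
    unfolding P_def by blast+
qed

definition heat_const :: real where
  "heat_const = (SOME C. 0 < C \<and> (\<forall>s>0. \<forall>x. heat s x \<le> C * (s + (norm x)\<^sup>2) powr (-3/2)))"

lemma heat_const:
  "0 < heat_const"
  "0 < s \<Longrightarrow> heat s x \<le> heat_const * (s + (norm x)\<^sup>2) powr (-3/2)"
proof -
  define P where "P C \<longleftrightarrow> 0 < C \<and> (\<forall>s>0. \<forall>x. heat s x \<le> C * (s + (norm x)\<^sup>2) powr (-3/2))" for C
  obtain C where C: "0 \<le> C" "\<forall>s>0. \<forall>x. heat s x \<le> C * (s + (norm x)\<^sup>2) powr (-3/2)"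
    using heat_bound by blast
  have "C * (s + (norm (x::real^3))\<^sup>2) powr (-3/2) \<le> (C + 1) * (s + (norm x)\<^sup>2) powr (-3/2)" for s x
    by (rule mult_right_mono) auto
  with C have "P (C + 1)" unfolding P_def by (meson add_nonneg_pos order_trans zero_less_one)
  then have "P heat_const" unfolding heat_const_def P_def[symmetric] by (rule someI)
  then show "0 < heat_const" "0 < s \<Longrightarrow> heat s x \<le> heat_const * (s + (norm x)\<^sup>2) powr (-3/2)"
    unfolding P_def by blast+
qed

lemma heat_has_derivative_time:
  assumes "0 < s"
  shows "((\<lambda>s. heat s x) has_real_derivative ((norm x)\<^sup>2 / (4 * s\<^sup>2) - 3 / (2 * s)) * heat s x) (at s)"
proof -
  define N where "N = (norm x)\<^sup>2"
  have 1: "((\<lambda>s. exp (- (3/2) * ln s)) has_real_derivative exp (- (3/2) * ln s) * (- (3/2) * (1 / s))) (at s)"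
    using assms by (auto intro!: derivative_eq_intros)
  have 2: "((\<lambda>s. exp (- (N / (4 * s)))) has_real_derivative exp (- (N / (4 * s))) * (N / (4 * s\<^sup>2))) (at s)"
    using assms by (auto intro!: derivative_eq_intros simp: power2_eq_square field_simps)
  show ?thesis
    unfolding heat_def using DERIV_mult[OF 1 2] unfolding N_def by (simp add: algebra_simps)
qed

section \<open>Parabolic kernels and a nonlinear integral inequality\<close>

lemma nn_integral_spacetime:
  fixes f :: "real \<times> (real^3) \<Rightarrow> ennreal"
  assumes "f \<in> borel_measurable borel"
  shows "(\<integral>\<^sup>+z. f z \<partial>lborel) = (\<integral>\<^sup>+t. \<integral>\<^sup>+x. f (t, x) \<partial>lborel \<partial>lborel)"
  using lborel.nn_integral_fst[of f lborel] assms by (simp add: lborel_prod)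

lemma nn_integral_translate_reflect:
  fixes f :: "'a::euclidean_space \<Rightarrow> ennreal"
  assumes [measurable]: "f \<in> borel_measurable borel"
  shows "(\<integral>\<^sup>+\<zeta>. f (z - \<zeta>) \<partial>lborel) = (\<integral>\<^sup>+\<zeta>. f \<zeta> \<partial>lborel)"
    and "(\<integral>\<^sup>+\<zeta>. f (\<zeta> - z) \<partial>lborel) = (\<integral>\<^sup>+\<zeta>. f \<zeta> \<partial>lborel)"
proof -
  show "(\<integral>\<^sup>+\<zeta>. f (z - \<zeta>) \<partial>lborel) = (\<integral>\<^sup>+\<zeta>. f \<zeta> \<partial>lborel)"
    by (subst (2) lborel_affine[of "-1" z]) (simp_all add: nn_integral_density nn_integral_distr)
  show "(\<integral>\<^sup>+\<zeta>. f (\<zeta> - z) \<partial>lborel) = (\<integral>\<^sup>+\<zeta>. f \<zeta> \<partial>lborel)"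
    by (subst (2) lborel_affine[of 1 "- z"]) (simp_all add: nn_integral_density nn_integral_distr)
qed

text \<open>Split at the parabolic scale |x| = sqrt \<open>\<tau>\<close>: inside, the integrand is
  at most \<open>\<tau> powr - q\<close>; outside, it is at most |x|^(-2q), whose tail converges
  because 2q > 1.\<close>

lemma nn_integral_inverse_power_line:
  assumes q: "1/2 < (q::real)"
  shows "\<exists>c\<ge>0. \<forall>\<tau>>0. (\<integral>\<^sup>+x. ennreal ((\<tau> + x\<^sup>2) powr - q) \<partial>lborel) \<le> ennreal (c * \<tau> powr (1/2 - q))"
proof (intro exI conjI allI impI)
  fix \<tau> :: real assume \<tau>: "0 < \<tau>"
  define h where "h = \<tau> powr (1/2)"
  have h: "0 < h" "h * h = \<tau>" using \<tau> by (auto simp: h_def powr_add[symmetric])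
  define f where "f x = ennreal (indicat_real {h..} x * x powr (- 2 * q))" for x
  have [measurable]: "f \<in> borel_measurable borel" unfolding f_def by measurable
  have "(\<integral>\<^sup>+x. f x \<partial>lborel) = ennreal (- (h powr (- 2 * q + 1)) / (- 2 * q + 1))"
    unfolding f_def using q h
    by (intro nn_integral_has_integral_lebesgue has_integral_powr_to_inf) auto
  also have "- (h powr (- 2 * q + 1)) / (- 2 * q + 1) = 1 / (2 * q - 1) * \<tau> powr (1/2 - q)"
  proof -
    have "h powr (- 2 * q + 1) = \<tau> powr (1/2 - q)" by (simp add: h_def powr_powr algebra_simps)
    then show ?thesis using q by (simp add: field_simps)
  qed
  finally have f: "(\<integral>\<^sup>+x. f x \<partial>lborel) = ennreal (1 / (2 * q - 1) * \<tau> powr (1/2 - q))" .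
  have f': "(\<integral>\<^sup>+x. f (- x) \<partial>lborel) = (\<integral>\<^sup>+x. f x \<partial>lborel)"
    using nn_integral_translate_reflect(1)[of f 0] by simp
  have "(\<integral>\<^sup>+x. ennreal ((\<tau> + x\<^sup>2) powr - q) \<partial>lborel)
     \<le> (\<integral>\<^sup>+x. ennreal (\<tau> powr - q) * indicator {-h..h} x + (f x + f (- x)) \<partial>lborel)"
  proof (rule nn_integral_mono)
    fix x :: real
    have big: "(\<tau> + x\<^sup>2) powr - q \<le> \<bar>x\<bar> powr (- 2 * q)" if "h \<le> \<bar>x\<bar>"
    proof -
      have x0: "0 < \<bar>x\<bar>" using that h by linarith
      have "(\<tau> + x\<^sup>2) powr - q \<le> (x\<^sup>2) powr - q"
        using \<tau> q x0 by (intro powr_mono2') auto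
      also have "(x\<^sup>2) powr - q = (\<bar>x\<bar> powr 2) powr - q" using x0 by simp
      also have "\<dots> = \<bar>x\<bar> powr (- 2 * q)" by (simp only: powr_powr) simp
      finally show ?thesis .
    qed
    have small: "(\<tau> + x\<^sup>2) powr - q \<le> \<tau> powr - q" using \<tau> q by (intro powr_mono2') auto
    consider "x \<in> {-h..h}" | "h \<le> x" | "h \<le> - x" by fastforce
    then show "ennreal ((\<tau> + x\<^sup>2) powr - q) \<le> ennreal (\<tau> powr - q) * indicator {-h..h} x + (f x + f (- x))"
    proof cases
      case 1 then show ?thesis using small by (simp add: add_increasing2)
    next
      case 2
      then have "ennreal ((\<tau> + x\<^sup>2) powr - q) \<le> f x" using big h by (simp add: f_def)
      then show ?thesis by (simp add: add_increasing add_increasing2)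
    next
      case 3
      then have "ennreal ((\<tau> + x\<^sup>2) powr - q) \<le> f (- x)" using big h by (simp add: f_def)
      then show ?thesis by (simp add: add_increasing)
    qed
  qed
  also have "\<dots> = ennreal (\<tau> powr - q) * ennreal (2 * h) + (ennreal (1 / (2 * q - 1) * \<tau> powr (1/2 - q)) + ennreal (1 / (2 * q - 1) * \<tau> powr (1/2 - q)))"
    using h by (subst nn_integral_add; (subst nn_integral_add)?) (simp_all add: nn_integral_cmult f f')
  also have "\<dots> = ennreal (\<tau> powr - q * (2 * h) + (1 / (2 * q - 1) * \<tau> powr (1/2 - q) + 1 / (2 * q - 1) * \<tau> powr (1/2 - q)))"
    using q h by (simp add: ennreal_mult[symmetric] ennreal_plus[symmetric] del: ennreal_plus)
  also have "\<tau> powr - q * (2 * h) = 2 * \<tau> powr (1/2 - q)"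
    by (simp add: h_def powr_add[symmetric])
  finally show "(\<integral>\<^sup>+x. ennreal ((\<tau> + x\<^sup>2) powr - q) \<partial>lborel) \<le> ennreal ((2 + 2 / (2 * q - 1)) * \<tau> powr (1/2 - q))"
    by (simp add: algebra_simps add_divide_distrib)
qed (use q in auto)

text \<open>In place of polar coordinates the power is shared out equally among the three
  coordinates: \<open>\<tau> + (norm x)\<^sup>2\<close> dominates
  \<open>\<tau> + (x \<bullet> b)\<^sup>2\<close> for every basis vector, and the integral of the
  product factors. The one-dimensional condition p/3 > 1/2 is exactly p > 3/2.\<close>

lemma nn_integral_inverse_power_space:
  assumes p: "3/2 < (p::real)"
  shows "\<exists>c\<ge>0. \<forall>\<tau>>0. (\<integral>\<^sup>+x. ennreal ((\<tau> + (norm (x::real^3))\<^sup>2) powr - p) \<partial>lborel) \<le> ennreal (c * \<tau> powr (3/2 - p))"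
proof -
  have "1/2 < p/3" using p by simp
  then obtain c where c: "0 \<le> c"
    "\<And>\<tau>. 0 < \<tau> \<Longrightarrow> (\<integral>\<^sup>+x. ennreal ((\<tau> + x\<^sup>2) powr - (p/3)) \<partial>lborel) \<le> ennreal (c * \<tau> powr (1/2 - p/3))"
    using nn_integral_inverse_power_line[of "p/3"] by blast
  have "(\<integral>\<^sup>+x. ennreal ((\<tau> + (norm (x::real^3))\<^sup>2) powr - p) \<partial>lborel) \<le> ennreal (c ^ 3 * \<tau> powr (3/2 - p))"
    if \<tau>: "0 < \<tau>" for \<tau>
  proof -
    have "(\<integral>\<^sup>+x. ennreal ((\<tau> + (norm (x::real^3))\<^sup>2) powr - p) \<partial>lborel)
      \<le> (\<integral>\<^sup>+x. (\<Prod>b\<in>Basis. ennreal ((\<tau> + ((x::real^3) \<bullet> b)\<^sup>2) powr - (p/3))) \<partial>lborel)"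
    proof (rule nn_integral_mono)
      fix x :: "real^3"
      let ?s = "\<tau> + (norm x)\<^sup>2"
      have s: "0 < ?s" using \<tau> by (simp add: add_pos_nonneg)
      have "?s powr - p = (?s powr - (p/3)) ^ 3"
        using s by (simp add: powr_power)
      also have "\<dots> = (\<Prod>b\<in>(Basis::(real^3) set). ?s powr - (p/3))" by simp
      also have "\<dots> \<le> (\<Prod>b\<in>(Basis::(real^3) set). (\<tau> + (x \<bullet> b)\<^sup>2) powr - (p/3))"
      proof (rule prod_mono, intro conjI)
        fix b :: "real^3" assume b: "b \<in> Basis"
        have "\<bar>x \<bullet> b\<bar> \<le> norm x" by (rule Basis_le_norm[OF b])
        then have "(x \<bullet> b)\<^sup>2 \<le> (norm x)\<^sup>2" using power_mono[of "\<bar>x \<bullet> b\<bar>" "norm x" 2] by simp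
        then show "?s powr - (p/3) \<le> (\<tau> + (x \<bullet> b)\<^sup>2) powr - (p/3)"
          using \<tau> p by (intro powr_mono2') (auto simp: add_pos_nonneg)
      qed simp
      finally show "ennreal (?s powr - p) \<le> (\<Prod>b\<in>Basis. ennreal ((\<tau> + (x \<bullet> b)\<^sup>2) powr - (p/3)))"
        by (subst prod_ennreal) (auto intro: ennreal_leI)
    qed
    also have "\<dots> = (\<Prod>b\<in>(Basis::(real^3) set). (\<integral>\<^sup>+x. ennreal ((\<tau> + x\<^sup>2) powr - (p/3)) \<partial>lborel))"
      by (rule nn_integral_lborel_prod) auto
    also have "\<dots> \<le> (\<Prod>b\<in>(Basis::(real^3) set). ennreal (c * \<tau> powr (1/2 - p/3)))"
      by (intro prod_mono_ennreal c \<tau>)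
    also have "\<dots> = ennreal ((c * \<tau> powr (1/2 - p/3)) ^ 3)"
      using c by (simp add: ennreal_power)
    also have "(c * \<tau> powr (1/2 - p/3)) ^ 3 = c ^ 3 * \<tau> powr (3/2 - p)"
      using \<tau> by (simp add: power_mult_distrib powr_power algebra_simps)
    finally show ?thesis .
  qed
  then show ?thesis using c(1) by (intro exI[of _ "c ^ 3"]) auto
qed

text \<open>Zero at nonpositive times, so that convolution with it sees only the past. The family is
  closed under powers, which suits Hoelder's inequality with exponent 6/5.\<close>

definition kern :: "real \<Rightarrow> real \<times> (real^3) \<Rightarrow> real" where
  "kern p z = (if 0 < fst z then (fst z + (norm (snd z))\<^sup>2) powr - p else 0)"

lemma measurable_fst_snd_borel [measurable]:
  "(fst :: 'a::topological_space \<times> 'b::topological_space \<Rightarrow> 'a) \<in> borel_measurable borel"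
  "(snd :: 'a \<times> 'b \<Rightarrow> 'b) \<in> borel_measurable borel"
  by (intro borel_measurable_continuous_onI continuous_intros)+

lemma kern_measurable [measurable]: "kern p \<in> borel_measurable borel"
  unfolding kern_def[abs_def] by measurable

lemma kern_nonneg: "0 \<le> kern p z"
  by (simp add: kern_def)

lemma kern_powr: "kern p z powr q = kern (p * q) z"
  by (simp add: kern_def powr_powr)

text \<open>Integrating out space leaves a multiple of \<open>t powr (3/2 - p)\<close>, which is
  integrable at 0 because p < 5/2.\<close>

lemma nn_integral_kern:
  assumes p: "3/2 < p" "p < 5/2"
  shows "\<exists>c\<ge>0. \<forall>R>0. (\<integral>\<^sup>+z. ennreal (kern p z) * indicator {z. fst z < R} z \<partial>lborel) \<le> ennreal (c * R powr (5/2 - p))"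
proof -
  obtain c where c: "0 \<le> c"
    "\<And>\<tau>. 0 < \<tau> \<Longrightarrow> (\<integral>\<^sup>+x. ennreal ((\<tau> + (norm (x::real^3))\<^sup>2) powr - p) \<partial>lborel) \<le> ennreal (c * \<tau> powr (3/2 - p))"
    using nn_integral_inverse_power_space[OF p(1)] by blast
  have "(\<integral>\<^sup>+z. ennreal (kern p z) * indicator {z. fst z < R} z \<partial>lborel) \<le> ennreal (c * (1 / (5/2 - p)) * R powr (5/2 - p))"
    if R: "0 < R" for R
  proof -
    have "(\<integral>\<^sup>+z. ennreal (kern p z) * indicator {z. fst z < R} z \<partial>lborel)
       = (\<integral>\<^sup>+t. \<integral>\<^sup>+x. ennreal (kern p (t, x)) * indicator {z. fst z < R} (t, x) \<partial>lborel \<partial>lborel)"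
    proof (rule nn_integral_spacetime)
      have [measurable]: "{z::real \<times> (real^3). fst z < R} \<in> sets borel"
        by (intro borel_open open_Collect_less continuous_intros)
      show "(\<lambda>z. ennreal (kern p z) * indicator {z. fst z < R} z) \<in> borel_measurable borel" by measurable
    qed
    also have "\<dots> \<le> (\<integral>\<^sup>+t. ennreal c * ennreal (indicat_real {0..R} t * t powr (3/2 - p)) \<partial>lborel)"
    proof (rule nn_integral_mono)
      fix t :: real
      show "(\<integral>\<^sup>+x. ennreal (kern p (t, x)) * indicator {z. fst z < R} (t, x) \<partial>lborel)
        \<le> ennreal c * ennreal (indicat_real {0..R} t * t powr (3/2 - p))"
      proof (cases "0 < t \<and> t < R")
        case True
        then have "(\<integral>\<^sup>+x. ennreal (kern p (t, x)) * indicator {z. fst z < R} (t, x) \<partial>lborel) \<le> ennreal (c * t powr (3/2 - p))"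
          using c(2)[of t] by (simp add: kern_def)
        then show ?thesis using True c(1) by (simp add: ennreal_mult)
      next
        case False
        then have "(\<lambda>x. ennreal (kern p (t, x)) * indicator {z. fst z < R} (t, x)) = (\<lambda>x. 0)"
          by (auto simp: kern_def indicator_def)
        then show ?thesis by simp
      qed
    qed
    also have "\<dots> = ennreal c * ennreal (R powr (3/2 - p + 1) / (3/2 - p + 1))"
    proof -
      have I: "((\<lambda>t. t powr (3/2 - p)) has_integral R powr (3/2 - p + 1) / (3/2 - p + 1)) {0..R}"
        using p R by (intro has_integral_powr_from_0) auto
      show ?thesis
        by (subst nn_integral_cmult, measurable) (simp only: nn_integral_has_integral_lebesgue[OF powr_ge_zero I])
    qed
    also have "\<dots> = ennreal (c * (1 / (5/2 - p)) * R powr (5/2 - p))"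
      using c(1) p by (simp add: ennreal_mult[symmetric] field_simps)
    finally show ?thesis .
  qed
  then show ?thesis using c(1) p by (intro exI[of _ "c * (1 / (5/2 - p))"]) auto
qed

text \<open>Young's inequality for \<open>\<mu> * f\<close> and \<open>g / \<mu>\<close>, with
  \<open>\<mu>\<close> optimised. The real bounds \<open>A\<close> and \<open>Y\<close> stand in for
  the integrals, so that extended real powers are avoided.\<close>

lemma Hoelder_6:
  fixes f g :: "'a \<Rightarrow> real"
  assumes [measurable]: "f \<in> borel_measurable M" "g \<in> borel_measurable M"
    and nonneg: "\<And>x. 0 \<le> f x" "\<And>x. 0 \<le> g x"
    and A: "0 < A" "(\<integral>\<^sup>+x. ennreal (f x ^ 6) \<partial>M) \<le> ennreal A"
    and Y: "0 \<le> Y" "(\<integral>\<^sup>+x. ennreal (g x powr (6/5)) \<partial>M) \<le> ennreal Y"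
  shows "(\<integral>\<^sup>+x. ennreal (f x * g x) \<partial>M) \<le> ennreal (A powr (1/6) * Y powr (5/6))"
proof -
  have young: "(\<integral>\<^sup>+x. ennreal (f x * g x) \<partial>M) \<le> ennreal (\<mu> ^ 6 * A / 6 + 5/6 * \<mu> powr (-6/5) * Y)" if \<mu>: "0 < \<mu>" for \<mu>
  proof -
    have "(\<integral>\<^sup>+x. ennreal (f x * g x) \<partial>M)
        \<le> (\<integral>\<^sup>+x. ennreal (\<mu> ^ 6 / 6) * ennreal (f x ^ 6) + ennreal (5/6 * \<mu> powr (-6/5)) * ennreal (g x powr (6/5)) \<partial>M)"
    proof (rule nn_integral_mono)
      fix x
      have "(\<mu> * f x) * (g x / \<mu>) \<le> (\<mu> * f x) powr 6 / 6 + (g x / \<mu>) powr (6/5) / (6/5)"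
        by (rule Youngs_inequality) (use \<mu> nonneg in auto)
      also have "(\<mu> * f x) powr 6 = \<mu> ^ 6 * f x ^ 6"
        using \<mu> nonneg[of x] powr_realpow'[of "\<mu> * f x" 6] by (simp add: power_mult_distrib)
      also have "(g x / \<mu>) powr (6/5) = \<mu> powr (-6/5) * g x powr (6/5)"
        using \<mu> nonneg[of x] by (simp add: powr_divide powr_minus field_simps)
      finally have "f x * g x \<le> \<mu> ^ 6 / 6 * f x ^ 6 + 5/6 * \<mu> powr (-6/5) * g x powr (6/5)"
        using \<mu> by simp
      then show "ennreal (f x * g x) \<le> ennreal (\<mu> ^ 6 / 6) * ennreal (f x ^ 6) + ennreal (5/6 * \<mu> powr (-6/5)) * ennreal (g x powr (6/5))"
        using \<mu> nonneg by (simp add: ennreal_mult[symmetric] ennreal_plus[symmetric] del: ennreal_plus)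
    qed
    also have "\<dots> = ennreal (\<mu> ^ 6 / 6) * (\<integral>\<^sup>+x. ennreal (f x ^ 6) \<partial>M) + ennreal (5/6 * \<mu> powr (-6/5)) * (\<integral>\<^sup>+x. ennreal (g x powr (6/5)) \<partial>M)"
      by (simp add: nn_integral_add nn_integral_cmult)
    also have "\<dots> \<le> ennreal (\<mu> ^ 6 / 6) * ennreal A + ennreal (5/6 * \<mu> powr (-6/5)) * ennreal Y"
      by (intro add_mono mult_left_mono A Y) auto
    also have "\<dots> = ennreal (\<mu> ^ 6 * A / 6 + 5/6 * \<mu> powr (-6/5) * Y)"
      using \<mu> A Y by (simp add: ennreal_mult[symmetric] ennreal_plus[symmetric] del: ennreal_plus)
    finally show ?thesis .
  qed
  show ?thesis
  proof (cases "Y = 0")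
    case True
    have "(\<integral>\<^sup>+x. ennreal (f x * g x) \<partial>M) \<le> 0"
    proof (rule ennreal_le_epsilon)
      fix e :: real assume e: "0 < e"
      \<comment> \<open>With \<open>Y = 0\<close> the first term alone survives, and this
        \<open>\<mu>\<close> makes it equal to \<open>e\<close>.\<close>
      define \<mu> where "\<mu> = (6 * e / A) powr (1/6)"
      have "0 < \<mu>" using e A by (simp add: \<mu>_def)
      moreover have "\<mu> ^ 6 * A / 6 = e" using e A by (simp add: \<mu>_def powr_power)
      ultimately show "(\<integral>\<^sup>+x. ennreal (f x * g x) \<partial>M) \<le> 0 + ennreal e" using young[of \<mu>] True by simp
    qed
    then show ?thesis by (simp add: True)
  next
    case False
    then have Y0: "0 < Y" using Y by simp
    \<comment> \<open>Balances the two terms: \<open>\<mu> ^ 6 * A = \<mu> powr (-6/5) * Y\<close>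
      forces the power 36/5 of \<open>\<mu>\<close> to be \<open>Y / A\<close>.\<close>
    define \<mu> where "\<mu> = (Y / A) powr (5/36)"
    have \<mu>: "0 < \<mu>" using Y0 A by (simp add: \<mu>_def)
    have 1: "\<mu> ^ 6 = (Y / A) powr (5/6)" using Y0 A by (simp add: \<mu>_def powr_power)
    have 2: "\<mu> powr (-6/5) = (Y / A) powr (-1/6)" by (simp add: \<mu>_def powr_powr)
    have e1: "\<mu> ^ 6 * A = A powr (1/6) * Y powr (5/6)"
    proof -
      have "A / A powr (5/6) = A powr (1/6)" using A powr_diff[of A 1 "5/6"] by simp
      then show ?thesis unfolding 1 using Y0 A by (simp add: powr_divide) (metis mult.commute times_divide_eq_right)
    qed
    have e2: "\<mu> powr (-6/5) * Y = A powr (1/6) * Y powr (5/6)"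
    proof -
      have "Y powr (-1/6) * Y = Y powr (5/6)" using Y0 powr_add[of Y "-1/6" 1] by simp
      moreover have "(Y / A) powr (-1/6) = A powr (1/6) * Y powr (-1/6)"
        using Y0 A by (simp add: powr_divide powr_minus field_simps)
      ultimately show ?thesis unfolding 2 by simp
    qed
    have "\<mu> ^ 6 * A / 6 + 5/6 * \<mu> powr (-6/5) * Y = A powr (1/6) * Y powr (5/6)"
      using e1 e2 by simp
    then show ?thesis using young[OF \<mu>] by simp
  qed
qed


text \<open>The part of \<open>w\<close> below \<open>2 * M\<close> contributes at most
  \<open>M\<close> to the convolution term, because the smallness condition on \<open>C\<close>
  bounds the operator on bounded functions by 1/2. Hence the excess of \<open>w\<close> over
  \<open>2 * M\<close> satisfies the same inequality without \<open>M\<close>. On L^(6/5) the same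
  constant makes the operator a contraction, so the excess, whose norm there is finite, is
  zero.\<close>

lemma convolution_inequality_bounded:
  fixes v w :: "real \<times> (real^3) \<Rightarrow> real"
  assumes [measurable]: "v \<in> borel_measurable borel" "w \<in> borel_measurable borel"
    and nonneg: "\<And>z. 0 \<le> v z" "\<And>z. 0 \<le> w z"
    and supp: "\<And>z. fst z \<notin> {a<..<a + R} \<Longrightarrow> w z = 0"
    and ineq: "AE z in lborel. fst z \<in> {a<..<a + R} \<longrightarrow>
      ennreal (w z) \<le> ennreal M + ennreal C * (\<integral>\<^sup>+\<zeta>. ennreal (kern 2 (z - \<zeta>) * v \<zeta> * w \<zeta>) \<partial>lborel)"
    and w2: "(\<integral>\<^sup>+z. ennreal ((w z)\<^sup>2) \<partial>lborel) < \<infinity>"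
    and A: "0 < A" "(\<integral>\<^sup>+z. ennreal (v z ^ 6) \<partial>lborel) \<le> ennreal A"
    and \<kappa>: "0 < \<kappa>" "(\<integral>\<^sup>+z. ennreal (kern (12/5) z) * indicator {z. fst z < R} z \<partial>lborel) \<le> ennreal \<kappa>"
    and C: "0 < C" "C * (A powr (1/6) * \<kappa> powr (5/6)) \<le> 1/2" and M: "0 < M" and R: "0 < R"
  shows "AE z in lborel. w z \<le> 2 * M"
proof -
  let ?W = "{z::real \<times> (real^3). fst z \<in> {a<..<a + R}}"
  have W[measurable]: "?W \<in> sets borel"
    by (simp only: greaterThanLessThan_iff) (intro borel_open open_Collect_conj open_Collect_less continuous_intros)
  have [measurable]: "{z::real \<times> (real^3). fst z < R} \<in> sets borel"
    by (intro borel_open open_Collect_less continuous_intros)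
  have Wz: "fst z \<in> {a<..<a + R} \<longleftrightarrow> z \<in> ?W" for z by simp
  \<comment> \<open>\<open>kern (12/5)\<close> is the 6/5-th power of \<open>kern 2\<close>. Times
    inside the window differ by less than \<open>R\<close>, so there the truncated kernel, which is
    integrable, may replace the full one.\<close>
  define k where "k z = kern (12/5) z * indicat_real {z. fst z < R} z" for z
  have [measurable]: "k \<in> borel_measurable borel" unfolding k_def[abs_def] by measurable
  have k0: "0 \<le> k z" for z by (simp add: k_def kern_nonneg)
  have k: "(\<integral>\<^sup>+z. ennreal (k z) \<partial>lborel) \<le> ennreal \<kappa>"
    using \<kappa>(2) by (simp add: k_def ennreal_mult' kern_nonneg ennreal_indicator)
  have kk: "kern 2 (z - \<zeta>) powr (6/5) = k (z - \<zeta>)" if "z \<in> ?W" "\<zeta> \<in> ?W" for z \<zeta>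
  proof -
    have "fst (z - \<zeta>) < R" using that by auto
    then show ?thesis by (simp add: kern_powr k_def)
  qed
  define w' where "w' z = max (w z - 2 * M) 0" for z
  have [measurable]: "w' \<in> borel_measurable borel" unfolding w'_def[abs_def] by measurable
  have w'0: "0 \<le> w' z" for z by (simp add: w'_def)
  have w'W: "w' z = 0" if "z \<notin> ?W" for z using supp[of z] that M by (auto simp: w'_def)
  define N where "N = (\<integral>\<^sup>+z. ennreal (w' z powr (6/5)) \<partial>lborel)"
  have Nfin: "N < \<infinity>"
  proof -
    \<comment> \<open>Where \<open>w\<close> exceeds \<open>2 * M\<close>, its power 6/5 is at most
      \<open>(2 * M) powr (-4/5)\<close> times its square. Finiteness of \<open>N\<close> is what
      later allows it to be absorbed.\<close>
    have "N \<le> (\<integral>\<^sup>+z. ennreal ((2 * M) powr (-4/5)) * ennreal ((w z)\<^sup>2) \<partial>lborel)"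
      unfolding N_def
    proof (rule nn_integral_mono)
      fix z
      have "w' z powr (6/5) \<le> (2 * M) powr (-4/5) * (w z)\<^sup>2"
      proof (cases "2 * M < w z")
        case True
        have "w' z powr (6/5) \<le> w z powr (6/5)"
          using True M by (intro powr_mono2) (auto simp: w'_def)
        also have "w z powr (6/5) = w z powr (-4/5) * (w z)\<^sup>2"
          using True M powr_add[of "w z" "-4/5" 2] by simp
        also have "\<dots> \<le> (2 * M) powr (-4/5) * (w z)\<^sup>2"
          using True M by (intro mult_right_mono powr_mono2') auto
        finally show ?thesis .
      qed (simp add: w'_def)
      then show "ennreal (w' z powr (6/5)) \<le> ennreal ((2 * M) powr (-4/5)) * ennreal ((w z)\<^sup>2)"
        by (simp add: ennreal_mult[symmetric])
    qed
    also have "\<dots> < \<infinity>"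
      using w2 by (subst nn_integral_cmult) (auto simp: ennreal_mult_less_top)
    finally show ?thesis .
  qed
  \<comment> \<open>The operator applied to the indicator of the window, that is, its norm on
    bounded functions up to the factor \<open>C\<close>.\<close>
  have Kv: "(\<integral>\<^sup>+\<zeta>. ennreal (kern 2 (z - \<zeta>) * v \<zeta> * indicat_real ?W \<zeta>) \<partial>lborel) \<le> ennreal (A powr (1/6) * \<kappa> powr (5/6))"
    if z: "z \<in> ?W" for z
  proof -
    have "(\<integral>\<^sup>+\<zeta>. ennreal ((kern 2 (z - \<zeta>) * indicat_real ?W \<zeta>) powr (6/5)) \<partial>lborel) \<le> (\<integral>\<^sup>+\<zeta>. ennreal (k (z - \<zeta>)) \<partial>lborel)"
      by (intro nn_integral_mono) (use kk[OF z] k0 in \<open>auto simp: indicator_def\<close>)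
    also have "\<dots> = (\<integral>\<^sup>+\<zeta>. ennreal (k \<zeta>) \<partial>lborel)"
      by (rule nn_integral_translate_reflect(1)[of "\<lambda>x. ennreal (k x)"]) measurable
    also note k
    finally have Y: "(\<integral>\<^sup>+\<zeta>. ennreal ((kern 2 (z - \<zeta>) * indicat_real ?W \<zeta>) powr (6/5)) \<partial>lborel) \<le> ennreal \<kappa>" .
    have "(\<integral>\<^sup>+\<zeta>. ennreal (v \<zeta> * (kern 2 (z - \<zeta>) * indicat_real ?W \<zeta>)) \<partial>lborel) \<le> ennreal (A powr (1/6) * \<kappa> powr (5/6))"
    proof (rule Hoelder_6[OF _ _ nonneg(1) _ A _ Y])
      show "0 \<le> kern 2 (z - \<zeta>) * indicat_real ?W \<zeta>" for \<zeta> by (simp add: kern_nonneg)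
      show "0 \<le> \<kappa>" using \<kappa>(1) by simp
    qed measurable
    then show ?thesis by (simp only: mult.left_commute[of "v _"] mult.assoc)
  qed
  have ineq': "ennreal (w' z) \<le> ennreal C * (\<integral>\<^sup>+\<zeta>. ennreal (kern 2 (z - \<zeta>) * v \<zeta> * w' \<zeta>) \<partial>lborel)"
    if z: "z \<in> ?W" and iz: "ennreal (w z) \<le> ennreal M + ennreal C * (\<integral>\<^sup>+\<zeta>. ennreal (kern 2 (z - \<zeta>) * v \<zeta> * w \<zeta>) \<partial>lborel)" for z
  proof -
    let ?J = "\<integral>\<^sup>+\<zeta>. ennreal (kern 2 (z - \<zeta>) * v \<zeta> * w' \<zeta>) \<partial>lborel"
    have "(\<integral>\<^sup>+\<zeta>. ennreal (kern 2 (z - \<zeta>) * v \<zeta> * w \<zeta>) \<partial>lborel)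
       \<le> (\<integral>\<^sup>+\<zeta>. ennreal (2 * M) * ennreal (kern 2 (z - \<zeta>) * v \<zeta> * indicat_real ?W \<zeta>) + ennreal (kern 2 (z - \<zeta>) * v \<zeta> * w' \<zeta>) \<partial>lborel)"
    proof (rule nn_integral_mono)
      fix \<zeta>
      have "w \<zeta> \<le> 2 * M * indicat_real ?W \<zeta> + w' \<zeta>"
        using supp[of \<zeta>] by (auto simp: w'_def indicator_def)
      then have "kern 2 (z - \<zeta>) * v \<zeta> * w \<zeta> \<le> kern 2 (z - \<zeta>) * v \<zeta> * (2 * M * indicat_real ?W \<zeta> + w' \<zeta>)"
        using nonneg kern_nonneg by (intro mult_left_mono) auto
      also have "\<dots> = 2 * M * (kern 2 (z - \<zeta>) * v \<zeta> * indicat_real ?W \<zeta>) + kern 2 (z - \<zeta>) * v \<zeta> * w' \<zeta>"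
        by (simp add: algebra_simps)
      finally show "ennreal (kern 2 (z - \<zeta>) * v \<zeta> * w \<zeta>)
        \<le> ennreal (2 * M) * ennreal (kern 2 (z - \<zeta>) * v \<zeta> * indicat_real ?W \<zeta>) + ennreal (kern 2 (z - \<zeta>) * v \<zeta> * w' \<zeta>)"
        using M nonneg kern_nonneg w'0
        by (simp add: ennreal_mult[symmetric] ennreal_plus[symmetric] del: ennreal_plus)
    qed
    also have "\<dots> = ennreal (2 * M) * (\<integral>\<^sup>+\<zeta>. ennreal (kern 2 (z - \<zeta>) * v \<zeta> * indicat_real ?W \<zeta>) \<partial>lborel) + ?J"
      by (subst nn_integral_add, measurable) (subst nn_integral_cmult, measurable)
    also have "\<dots> \<le> ennreal (2 * M) * ennreal (A powr (1/6) * \<kappa> powr (5/6)) + ?J"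
      by (intro add_mono mult_left_mono Kv z) auto
    finally have "ennreal C * (\<integral>\<^sup>+\<zeta>. ennreal (kern 2 (z - \<zeta>) * v \<zeta> * w \<zeta>) \<partial>lborel)
      \<le> ennreal C * (ennreal (2 * M) * ennreal (A powr (1/6) * \<kappa> powr (5/6)) + ?J)"
      by (rule mult_left_mono) simp
    also have "\<dots> = ennreal (2 * M * (C * (A powr (1/6) * \<kappa> powr (5/6)))) + ennreal C * ?J"
    proof -
      have P: "ennreal (2 * M * (C * P)) = ennreal C * (ennreal (2 * M) * ennreal P)" if "0 \<le> P" for P
      proof -
        have "2 * M * (C * P) = C * (2 * M * P)" by (rule mult.left_commute)
        then show ?thesis using C M that by (simp add: ennreal_mult mult.left_commute)
      qed
      show ?thesis by (subst P) (simp_all add: distrib_left)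
    qed
    also have "\<dots> \<le> ennreal M + ennreal C * ?J"
      using mult_left_mono[OF C(2), of "2 * M"] M by (intro add_mono ennreal_leI) auto
    finally have "ennreal (w z) \<le> ennreal M + (ennreal M + ennreal C * ?J)"
      using iz add_left_mono order_trans by blast
    also have "\<dots> = ennreal (2 * M) + ennreal C * ?J"
      using M by (simp add: add.assoc[symmetric] ennreal_plus[symmetric] del: ennreal_plus)
    finally have *: "ennreal (w z) \<le> ennreal (2 * M) + ennreal C * ?J" .
    show ?thesis
    proof (cases "w z \<le> 2 * M")
      case True then show ?thesis by (simp add: w'_def)
    next
      case False
      then have "ennreal (w z) = ennreal (2 * M) + ennreal (w' z)"
        using M by (simp add: w'_def ennreal_plus[symmetric] del: ennreal_plus)
      then show ?thesis using * by (simp add: ennreal_add_left_cancel_le)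
    qed
  qed
  \<comment> \<open>Hoelder against \<open>v\<close> at a fixed point leaves the convolution of the
    6/5-th powers of the kernel and of \<open>w'\<close>; its total integral factors by
    Tonelli.\<close>
  define Y where "Y z = (\<integral>\<^sup>+\<zeta>. ennreal (k (z - \<zeta>) * w' \<zeta> powr (6/5)) \<partial>lborel)" for z
  have contr: "ennreal (w' z powr (6/5)) \<le> ennreal ((C * A powr (1/6)) powr (6/5)) * Y z"
    if z: "z \<in> ?W" and iz: "ennreal (w' z) \<le> ennreal C * (\<integral>\<^sup>+\<zeta>. ennreal (kern 2 (z - \<zeta>) * v \<zeta> * w' \<zeta>) \<partial>lborel)" for z
  proof (cases "Y z = \<infinity>")
    case True
    then show ?thesis using C A by (simp add: ennreal_mult_top)
  next
    case False
    define y where "y = enn2real (Y z)"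
    have y: "Y z = ennreal y" "0 \<le> y" using False by (auto simp: y_def ennreal_enn2real_if)
    have "(\<integral>\<^sup>+\<zeta>. ennreal ((kern 2 (z - \<zeta>) * w' \<zeta>) powr (6/5)) \<partial>lborel) = Y z"
      unfolding Y_def
    proof (rule nn_integral_cong)
      fix \<zeta>
      show "ennreal ((kern 2 (z - \<zeta>) * w' \<zeta>) powr (6/5)) = ennreal (k (z - \<zeta>) * w' \<zeta> powr (6/5))"
        using kk[OF z, of \<zeta>] w'W[of \<zeta>] kern_nonneg w'0 by (cases "\<zeta> \<in> ?W") (simp_all add: powr_mult)
    qed
    then have Yz: "(\<integral>\<^sup>+\<zeta>. ennreal ((kern 2 (z - \<zeta>) * w' \<zeta>) powr (6/5)) \<partial>lborel) \<le> ennreal y"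
      using y by simp
    have "(\<integral>\<^sup>+\<zeta>. ennreal (v \<zeta> * (kern 2 (z - \<zeta>) * w' \<zeta>)) \<partial>lborel) \<le> ennreal (A powr (1/6) * y powr (5/6))"
    proof (rule Hoelder_6[OF _ _ nonneg(1) _ A y(2) Yz])
      show "0 \<le> kern 2 (z - \<zeta>) * w' \<zeta>" for \<zeta> by (simp add: kern_nonneg w'0)
    qed measurable
    then have "ennreal C * (\<integral>\<^sup>+\<zeta>. ennreal (kern 2 (z - \<zeta>) * v \<zeta> * w' \<zeta>) \<partial>lborel) \<le> ennreal C * ennreal (A powr (1/6) * y powr (5/6))"
      by (intro mult_left_mono) (simp_all add: mult.commute mult.left_commute)
    then have "ennreal (w' z) \<le> ennreal (C * A powr (1/6) * y powr (5/6))"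
      using iz C by (simp add: ennreal_mult[symmetric] mult.assoc order_trans)
    then have "w' z \<le> C * A powr (1/6) * y powr (5/6)"
      using C y by (simp add: ennreal_le_iff)
    then have "w' z powr (6/5) \<le> (C * A powr (1/6) * y powr (5/6)) powr (6/5)"
      using w'0 by (intro powr_mono2) auto
    also have "\<dots> = (C * A powr (1/6)) powr (6/5) * y"
      using C y by (simp add: powr_mult powr_powr)
    finally show ?thesis using y by (simp add: ennreal_mult[symmetric])
  qed
  have Y_meas: "Y \<in> borel_measurable borel"
    unfolding Y_def[abs_def] by measurable
  have YN: "(\<integral>\<^sup>+z. Y z \<partial>lborel) \<le> ennreal \<kappa> * N"
  proof -
    have "(\<integral>\<^sup>+z. Y z \<partial>lborel) = (\<integral>\<^sup>+\<zeta>. \<integral>\<^sup>+z. ennreal (k (z - \<zeta>) * w' \<zeta> powr (6/5)) \<partial>lborel \<partial>lborel)"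
      unfolding Y_def by (rule lborel_pair.Fubini'[symmetric]) measurable
    also have "\<dots> = (\<integral>\<^sup>+\<zeta>. (\<integral>\<^sup>+z. ennreal (k (z - \<zeta>)) \<partial>lborel) * ennreal (w' \<zeta> powr (6/5)) \<partial>lborel)"
      by (subst nn_integral_multc[symmetric], measurable) (simp add: ennreal_mult k0)
    also have "\<dots> = (\<integral>\<^sup>+\<zeta>. (\<integral>\<^sup>+z. ennreal (k z) \<partial>lborel) * ennreal (w' \<zeta> powr (6/5)) \<partial>lborel)"
      by (subst nn_integral_translate_reflect(2)[of "\<lambda>x. ennreal (k x)"]) auto
    also have "\<dots> = (\<integral>\<^sup>+z. ennreal (k z) \<partial>lborel) * N"
      unfolding N_def by (rule nn_integral_cmult) measurable
    also have "\<dots> \<le> ennreal \<kappa> * N" by (intro mult_right_mono k) simp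
    finally show ?thesis .
  qed
  have "N \<le> (\<integral>\<^sup>+z. ennreal ((C * A powr (1/6)) powr (6/5)) * Y z \<partial>lborel)"
    unfolding N_def
  proof (rule nn_integral_mono_AE, use ineq in eventually_elim)
    fix z assume iz: "fst z \<in> {a<..<a + R} \<longrightarrow>
      ennreal (w z) \<le> ennreal M + ennreal C * (\<integral>\<^sup>+\<zeta>. ennreal (kern 2 (z - \<zeta>) * v \<zeta> * w \<zeta>) \<partial>lborel)"
    show "ennreal (w' z powr (6/5)) \<le> ennreal ((C * A powr (1/6)) powr (6/5)) * Y z"
    proof (cases "z \<in> ?W")
      case True
      then show ?thesis using contr[OF True ineq'[OF True]] iz by simp
    qed (simp add: w'W)
  qed
  also have "\<dots> = ennreal ((C * A powr (1/6)) powr (6/5)) * (\<integral>\<^sup>+z. Y z \<partial>lborel)"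
    using Y_meas by (subst nn_integral_cmult) auto
  also have "\<dots> \<le> ennreal ((C * A powr (1/6)) powr (6/5)) * (ennreal \<kappa> * N)"
    by (intro mult_left_mono YN) simp
  also have "\<dots> = ennreal ((C * A powr (1/6)) powr (6/5) * \<kappa>) * N"
    using \<kappa> by (simp add: ennreal_mult mult.assoc)
  finally have "N \<le> ennreal ((C * A powr (1/6)) powr (6/5) * \<kappa>) * N" .
  moreover have "(C * A powr (1/6)) powr (6/5) * \<kappa> < 1"
  proof -
    have "(C * A powr (1/6)) powr (6/5) * \<kappa> = (C * (A powr (1/6) * \<kappa> powr (5/6))) powr (6/5)"
      using C A \<kappa> by (simp add: powr_mult powr_powr)
    also have "\<dots> \<le> (1/2) powr (6/5)" using C A \<kappa> by (intro powr_mono2) auto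
    also have "\<dots> < 1 powr (6/5)" by (rule powr_less_mono2) auto
    finally show ?thesis by simp
  qed
  \<comment> \<open>\<open>N\<close> is at most itself times a number below 1; being finite, it
    vanishes.\<close>
  ultimately have "N = 0"
  proof -
    define n where "n = enn2real N"
    have n: "N = ennreal n" "0 \<le> n" using Nfin by (auto simp: n_def ennreal_enn2real_if)
    let ?q = "(C * A powr (1/6)) powr (6/5) * \<kappa>"
    assume "N \<le> ennreal ?q * N" and q: "?q < 1"
    then have "ennreal n \<le> ennreal (?q * n)" using n \<kappa> by (simp add: ennreal_mult)
    then have "n \<le> ?q * n" using n \<kappa> by (simp add: ennreal_le_iff)
    then have "(1 - ?q) * n \<le> 0" by (simp only: left_diff_distrib)
    then have "n = 0" using q n(2) by (metis diff_gt_0_iff_gt linorder_not_le mult_pos_pos order_le_less)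
    then show "N = 0" using n by simp
  qed
  then have "AE z in lborel. ennreal (w' z powr (6/5)) = 0"
    unfolding N_def by (subst (asm) nn_integral_0_iff_AE) auto
  then show ?thesis
  proof eventually_elim
    case (elim z)
    then have "w' z powr (6/5) = 0" by (simp add: ennreal_eq_0_iff)
    then have "w' z = 0" by simp
    then show ?case by (simp add: w'_def max_def split: if_splits)
  qed
qed

section \<open>The equation without pressure\<close>

lemma e_space_Basis: "e_space j \<in> Basis" and e_time_Basis: "e_time \<in> Basis"
  by (auto simp: Basis_prod_def axis_in_Basis_iff)

lemma pderiv_dir_test_functions:
  "\<phi> \<in> test_functions \<Omega> \<Longrightarrow> b \<in> Basis \<Longrightarrow> pderiv_dir b \<phi> \<in> test_functions \<Omega>"
  using pderivs_test_functions[of \<phi> \<Omega> "[b]"] by simp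

lemma test_functions_smooth: "\<phi> \<in> test_functions \<Omega> \<Longrightarrow> smooth \<phi>"
  by (simp add: test_functions_def)

text \<open>The pressure is eliminated by testing the $i$-th equation with $\partial_i\partial_k\Psi$, summing
  over $i$, and subtracting the $k$-th equation tested with $\Delta\Psi$.\<close>

lemma pressure_free_equation:
  assumes NS: "NS_equations u p" and \<Psi>: "\<Psi> \<in> test_functions spacetime"
  defines "d \<equiv> \<lambda>j. pderiv_dir (e_space j)"
  shows "(\<Sum>j\<in>UNIV. dist_of spacetime (\<lambda>(t, x). u t x $ k) (pderiv_dir e_time (d j (d j \<Psi>))))
      + (\<Sum>j\<in>UNIV. \<Sum>l\<in>UNIV. dist_of spacetime (\<lambda>(t, x). u t x $ k) (d l (d l (d j (d j \<Psi>)))))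
    = (\<Sum>i\<in>UNIV. \<Sum>j\<in>UNIV. dist_of spacetime (\<lambda>(t, x). u t x $ i * u t x $ j) (d j (d i (d k \<Psi>))))
      - (\<Sum>j\<in>UNIV. \<Sum>l\<in>UNIV. dist_of spacetime (\<lambda>(t, x). u t x $ k * u t x $ l) (d l (d j (d j \<Psi>))))"
proof -
  define f where "f i = dist_of spacetime (\<lambda>(t, x). u t x $ i)" for i
  define g where "g i j = dist_of spacetime (\<lambda>(t, x). u t x $ i * u t x $ j)" for i j
  let ?t = "pderiv_dir e_time"
  have test: "d j \<phi> \<in> test_functions spacetime" "?t \<phi> \<in> test_functions spacetime"
    if "\<phi> \<in> test_functions spacetime" for \<phi> j
    unfolding d_def using that by (auto intro: pderiv_dir_test_functions e_space_Basis e_time_Basis)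
  have comm: "d i (d j \<phi>) = d j (d i \<phi>)" "?t (d j \<phi>) = d j (?t \<phi>)" if "\<phi> \<in> test_functions spacetime" for \<phi> i j
    unfolding d_def using test_functions_smooth[OF that]
    by (auto intro: pderiv_dir_commute e_space_Basis e_time_Basis)
  have E: "f i (?t \<phi>) + (\<Sum>j\<in>UNIV. f i (d j (d j \<phi>))) + (\<Sum>j\<in>UNIV. g i j (d j \<phi>)) + p (d i \<phi>) = 0"
    if "\<phi> \<in> test_functions spacetime" for \<phi> i
  proof -
    have "dist_deriv e_time (f i) \<phi> - (\<Sum>j\<in>UNIV. dist_deriv (e_space j) (dist_deriv (e_space j) (f i)) \<phi>)
           + (\<Sum>j\<in>UNIV. dist_deriv (e_space j) (g i j) \<phi>) + dist_deriv (e_space i) p \<phi> = 0"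
      using NS that unfolding NS_equations_def f_def g_def by blast
    then show ?thesis by (simp add: dist_deriv_def d_def sum_negf)
  qed
  have div: "(\<Sum>j\<in>UNIV. f j (d j \<phi>)) = 0" if "\<phi> \<in> test_functions spacetime" for \<phi>
  proof -
    have "(\<Sum>j\<in>UNIV. dist_deriv (e_space j) (f j) \<phi>) = 0"
      using NS that unfolding NS_equations_def f_def by blast
    then show ?thesis by (simp add: dist_deriv_def d_def sum_negf)
  qed
  \<comment> \<open>Tested with gradients the linear terms disappear: after commuting derivatives
    each is the weak divergence of \<open>u\<close> against a test function.\<close>
  have "(\<Sum>i\<in>UNIV. f i (?t (d i (d k \<Psi>)))) = (\<Sum>i\<in>UNIV. f i (d i (?t (d k \<Psi>))))"
    by (intro sum.cong refl) (simp add: comm test \<Psi>)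
  also have "\<dots> = 0" by (intro div test \<Psi>)
  finally have 1: "(\<Sum>i\<in>UNIV. f i (?t (d i (d k \<Psi>)))) = 0" .
  have "(\<Sum>i\<in>UNIV. \<Sum>j\<in>UNIV. f i (d j (d j (d i (d k \<Psi>)))))
      = (\<Sum>j\<in>UNIV. \<Sum>i\<in>UNIV. f i (d j (d j (d i (d k \<Psi>)))))" by (rule sum.swap)
  also have "\<dots> = (\<Sum>j\<in>UNIV. \<Sum>i\<in>UNIV. f i (d i (d j (d j (d k \<Psi>)))))"
  proof (intro sum.cong refl)
    fix j i :: 3
    have "d j (d j (d i (d k \<Psi>))) = d j (d i (d j (d k \<Psi>)))"
      using comm(1)[of "d k \<Psi>" j i] test \<Psi> by simp
    also have "\<dots> = d i (d j (d j (d k \<Psi>)))"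
      using comm(1)[of "d j (d k \<Psi>)" j i] test \<Psi> by simp
    finally show "f i (d j (d j (d i (d k \<Psi>)))) = f i (d i (d j (d j (d k \<Psi>))))" by simp
  qed
  also have "\<dots> = 0" by (simp add: div test \<Psi>)
  finally have 2: "(\<Sum>i\<in>UNIV. \<Sum>j\<in>UNIV. f i (d j (d j (d i (d k \<Psi>))))) = 0" .
  have "(\<Sum>i\<in>UNIV. f i (?t (d i (d k \<Psi>))) + (\<Sum>j\<in>UNIV. f i (d j (d j (d i (d k \<Psi>)))))
      + (\<Sum>j\<in>UNIV. g i j (d j (d i (d k \<Psi>)))) + p (d i (d i (d k \<Psi>)))) = 0"
    by (simp add: E test \<Psi>)
  then have 3: "(\<Sum>i\<in>UNIV. \<Sum>j\<in>UNIV. g i j (d j (d i (d k \<Psi>)))) + (\<Sum>i\<in>UNIV. p (d i (d i (d k \<Psi>)))) = 0"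
    using 1 2 by (simp add: sum.distrib)
  have "(\<Sum>j\<in>UNIV. f k (?t (d j (d j \<Psi>))) + (\<Sum>l\<in>UNIV. f k (d l (d l (d j (d j \<Psi>)))))
      + (\<Sum>l\<in>UNIV. g k l (d l (d j (d j \<Psi>)))) + p (d k (d j (d j \<Psi>)))) = 0"
    by (simp add: E test \<Psi>)
  then have 4: "(\<Sum>j\<in>UNIV. f k (?t (d j (d j \<Psi>)))) + (\<Sum>j\<in>UNIV. \<Sum>l\<in>UNIV. f k (d l (d l (d j (d j \<Psi>)))))
      + (\<Sum>j\<in>UNIV. \<Sum>l\<in>UNIV. g k l (d l (d j (d j \<Psi>)))) + (\<Sum>j\<in>UNIV. p (d k (d j (d j \<Psi>)))) = 0"
    by (simp add: sum.distrib)
  have "(\<Sum>j\<in>UNIV. p (d k (d j (d j \<Psi>)))) = (\<Sum>i\<in>UNIV. p (d i (d i (d k \<Psi>))))"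
  proof (intro sum.cong refl)
    fix j :: 3
    have "d k (d j (d j \<Psi>)) = d j (d k (d j \<Psi>))" using comm(1)[of "d j \<Psi>" k j] test \<Psi> by simp
    also have "\<dots> = d j (d j (d k \<Psi>))" using comm(1)[of \<Psi> k j] \<Psi> by simp
    finally show "p (d k (d j (d j \<Psi>))) = p (d j (d j (d k \<Psi>)))" by simp
  qed
  then show ?thesis using 3 4 unfolding f_def[symmetric] g_def[symmetric] by linarith
qed

text \<open>Moves from a Lebesgue measurable density on the half-space to a Borel function on the
  whole space, where product measures and Fubini apply directly. Values of \<open>V\<close> at
  nonpositive times do not matter, because the test functions vanish there.\<close>

lemma dist_of_spacetime_eq:
  fixes V :: "real \<times> (real^3) \<Rightarrow> real"
  assumes f: "f \<in> borel_measurable (lebesgue_on spacetime)" and [measurable]: "V \<in> borel_measurable borel"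
    and eq: "AE z in lborel. 0 < fst z \<longrightarrow> f z = V z"
    and \<phi>: "\<phi> \<in> test_functions spacetime"
  shows "dist_of spacetime f \<phi> = (\<integral>z. V z * \<phi> z \<partial>lborel)"
proof -
  have S: "spacetime \<in> sets lebesgue"
    by (intro lborelD sets_completionI_sets borel_open open_Times) auto
  have \<phi>b[measurable]: "\<phi> \<in> borel_measurable borel" by (intro smooth_borel test_functions_smooth[OF \<phi>])
  have \<phi>0: "\<phi> z = 0" if "z \<notin> spacetime" for z
  proof -
    have "support_on UNIV \<phi> \<subseteq> spacetime"
      using \<phi> closure_subset[of "support_on UNIV \<phi>"] unfolding test_functions_def by blast
    then show ?thesis using that by (auto simp: support_on_def)
  qed
  have \<phi>l: "\<phi> \<in> borel_measurable lebesgue" "(\<lambda>z. V z * \<phi> z) \<in> borel_measurable lebesgue"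
    by (intro measurable_completion; simp)+
  have fi: "(\<lambda>z. indicator spacetime z *\<^sub>R f z) \<in> borel_measurable lebesgue"
    using f S by (subst (asm) borel_measurable_restrict_space_iff) auto
  have "dist_of spacetime f \<phi> = (\<integral>z. indicator spacetime z *\<^sub>R (f z * \<phi> z) \<partial>lebesgue)"
    unfolding dist_of_def using S by (subst integral_restrict_space) auto
  also have "\<dots> = (\<integral>z. V z * \<phi> z \<partial>lebesgue)"
  proof (rule integral_cong_AE)
    have "(\<lambda>z. (indicator spacetime z *\<^sub>R f z) * \<phi> z) \<in> borel_measurable lebesgue"
      by (intro borel_measurable_times fi \<phi>l)
    then show "(\<lambda>z. indicator spacetime z *\<^sub>R (f z * \<phi> z)) \<in> borel_measurable lebesgue"
      by (simp add: mult.assoc)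
    have "AE z in lebesgue. 0 < fst z \<longrightarrow> f z = V z" using eq by (rule AE_completion)
    then show "AE z in lebesgue. indicator spacetime z *\<^sub>R (f z * \<phi> z) = V z * \<phi> z"
    proof eventually_elim
      case (elim z)
      show ?case
      proof (cases "z \<in> spacetime")
        case True
        then have "0 < fst z" by (cases z) auto
        then show ?thesis using elim True by simp
      qed (simp add: \<phi>0)
    qed
  qed (use \<phi>l in auto)
  also have "\<dots> = (\<integral>z. V z * \<phi> z \<partial>lborel)" by (rule integral_completion) simp
  finally show ?thesis .
qed

section \<open>Extension of the weak identity to functions that decay in space\<close>

lemma decay_measurable [measurable]: "decay \<alpha> \<beta> \<in> borel_measurable (borel :: (real \<times> (real^3)) measure)"
  unfolding decay_def[abs_def] by measurable

lemma nn_integral_decay: "(\<integral>\<^sup>+z. ennreal (decay \<alpha> \<beta> (z::real \<times> (real^3))) \<partial>lborel) < \<infinity>"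
proof -
  obtain c where c: "\<And>\<tau>. 0 < \<tau> \<Longrightarrow> (\<integral>\<^sup>+x. ennreal ((\<tau> + (norm (x::real^3))\<^sup>2) powr - 2) \<partial>lborel) \<le> ennreal (c * \<tau> powr (3/2 - 2))"
    using nn_integral_inverse_power_space[of 2] by auto
  have "(\<integral>\<^sup>+z. ennreal (decay \<alpha> \<beta> (z::real \<times> (real^3))) \<partial>lborel) = (\<integral>\<^sup>+t. \<integral>\<^sup>+x. ennreal (decay \<alpha> \<beta> (t, x::real^3)) \<partial>lborel \<partial>lborel)"
    by (rule nn_integral_spacetime) measurable
  also have "\<dots> \<le> (\<integral>\<^sup>+t. ennreal c * indicator {\<alpha>..\<beta>} t \<partial>lborel)"
  proof (rule nn_integral_mono)
    fix t :: real
    have e: "inverse ((1 + (norm x)\<^sup>2)\<^sup>2) = (1 + (norm x)\<^sup>2) powr - 2" for x :: "real^3"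
    proof -
      have "0 < 1 + (norm x)\<^sup>2" by (simp add: add_pos_nonneg)
      then show ?thesis by (simp add: powr_minus)
    qed
    show "(\<integral>\<^sup>+x. ennreal (decay \<alpha> \<beta> (t, x::real^3)) \<partial>lborel) \<le> ennreal c * indicator {\<alpha>..\<beta>} t"
      using c[of 1] by (cases "t \<in> {\<alpha>..\<beta>}") (auto simp: decay_def e)
  qed
  also have "\<dots> < \<infinity>"
    by (subst nn_integral_cmult_indicator) (auto simp: ennreal_mult_less_top emeasure_lborel_Icc_eq)
  finally show ?thesis .
qed

text \<open>Collects what the interior estimate works with: a Borel field on all of space-time,
  square integrable over bounded intervals of positive times, and the identity that remains after
  the pressure is eliminated.\<close>

locale pressure_free_flow =
  fixes U :: "real \<times> (real^3) \<Rightarrow> real^3"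
  assumes U_meas [measurable]: "U \<in> borel_measurable borel"
    and U_L2: "\<And>b. (\<integral>\<^sup>+z. ennreal ((norm (U z))\<^sup>2) * indicator {z. 0 < fst z \<and> fst z < b} z \<partial>lborel) < \<infinity>"
    and weak: "\<And>\<Psi> k. \<Psi> \<in> test_functions spacetime \<Longrightarrow>
      (\<Sum>j\<in>UNIV. \<integral>z. U z $ k * pderivs [e_time, e_space j, e_space j] \<Psi> z \<partial>lborel)
      + (\<Sum>j\<in>UNIV. \<Sum>l\<in>UNIV. \<integral>z. U z $ k * pderivs [e_space l, e_space l, e_space j, e_space j] \<Psi> z \<partial>lborel)
    = (\<Sum>i\<in>UNIV. \<Sum>j\<in>UNIV. \<integral>z. (U z $ i * U z $ j) * pderivs [e_space j, e_space i, e_space k] \<Psi> z \<partial>lborel)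
      - (\<Sum>j\<in>UNIV. \<Sum>l\<in>UNIV. \<integral>z. (U z $ k * U z $ l) * pderivs [e_space l, e_space j, e_space j] \<Psi> z \<partial>lborel)"
begin

lemma component_measurable [measurable]: "(\<lambda>z. U z $ i) \<in> borel_measurable borel"
  by (rule measurable_compose[OF U_meas]) (intro borel_measurable_continuous_onI continuous_intros)

text \<open>The slab lies in positive times, where the square of \<open>U\<close> is integrable. The
  first power follows from |U| \<le> 1 + |U|^2, the 1 being integrable against the weight.\<close>

lemma integrable_decay:
  assumes "0 < \<alpha>"
  shows "integrable lborel (\<lambda>z. (norm (U z))\<^sup>2 * decay \<alpha> \<beta> z)" "integrable lborel (\<lambda>z. norm (U z) * decay \<alpha> \<beta> z)"
proof -
  have [measurable]: "{z::real \<times> (real^3). 0 < fst z \<and> fst z < b} \<in> sets borel" for b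
    by (intro borel_open open_Collect_conj open_Collect_less continuous_intros)
  have d1: "decay \<alpha> \<beta> z \<le> 1" for z :: "real \<times> (real^3)"
    by (simp add: decay_def inverse_le_1_iff one_le_power)
  have "(\<integral>\<^sup>+z. ennreal ((norm (U z))\<^sup>2 * decay \<alpha> \<beta> z) \<partial>lborel)
     \<le> (\<integral>\<^sup>+z. ennreal ((norm (U z))\<^sup>2) * indicator {z. 0 < fst z \<and> fst z < \<beta> + 1} z \<partial>lborel)"
  proof (rule nn_integral_mono)
    fix z
    show "ennreal ((norm (U z))\<^sup>2 * decay \<alpha> \<beta> z) \<le> ennreal ((norm (U z))\<^sup>2) * indicator {z. 0 < fst z \<and> fst z < \<beta> + 1} z"
    proof (cases "fst z \<in> {\<alpha>..\<beta>}")
      case True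
      then have "z \<in> {z. 0 < fst z \<and> fst z < \<beta> + 1}" using assms by auto
      then show ?thesis using mult_left_mono[OF d1[of z], of "(norm (U z))\<^sup>2"] by (simp add: ennreal_leI)
    next
      case False
      then have "decay \<alpha> \<beta> z = 0" unfolding decay_def by (rule if_not_P)
      then show ?thesis by simp
    qed
  qed
  also have "\<dots> < \<infinity>" by (rule U_L2)
  finally have U2: "(\<integral>\<^sup>+z. ennreal ((norm (U z))\<^sup>2 * decay \<alpha> \<beta> z) \<partial>lborel) < \<infinity>" .
  then show i2: "integrable lborel (\<lambda>z. (norm (U z))\<^sup>2 * decay \<alpha> \<beta> z)"
    by (intro integrableI_nonneg) (auto simp: decay_nonneg)
  have id: "integrable lborel (\<lambda>z::real \<times> (real^3). decay \<alpha> \<beta> z)"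
    using nn_integral_decay by (intro integrableI_nonneg) (auto simp: decay_nonneg)
  show "integrable lborel (\<lambda>z. norm (U z) * decay \<alpha> \<beta> z)"
  proof (rule Bochner_Integration.integrable_bound[OF Bochner_Integration.integrable_add[OF id i2]])
    have "norm (U z) * decay \<alpha> \<beta> z \<le> decay \<alpha> \<beta> z + (norm (U z))\<^sup>2 * decay \<alpha> \<beta> z" for z
    proof -
      have "norm (U z) \<le> 1 + (norm (U z))\<^sup>2"
        using sum_squares_bound[of "norm (U z)" 1] zero_le_power2[of "norm (U z)"] norm_ge_zero[of "U z"]
        by (simp del: norm_ge_zero zero_le_power2)
      from mult_right_mono[OF this decay_nonneg] show ?thesis by (simp add: distrib_right)
    qed
    then show "AE z in lborel. norm (norm (U z) * decay \<alpha> \<beta> z) \<le> norm (decay \<alpha> \<beta> z + (norm (U z))\<^sup>2 * decay \<alpha> \<beta> z)"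
      by (intro AE_I2) (simp add: decay_nonneg)
  qed measurable
qed

lemma component_le: "\<bar>U z $ i\<bar> \<le> norm (U z)" "\<bar>U z $ i * U z $ j\<bar> \<le> (norm (U z))\<^sup>2"
proof -
  show 1: "\<bar>U z $ i\<bar> \<le> norm (U z)" for i by (rule component_le_norm_cart)
  show "\<bar>U z $ i * U z $ j\<bar> \<le> (norm (U z))\<^sup>2"
    unfolding abs_mult power2_eq_square by (intro mult_mono 1) auto
qed

lemma integrable_mult_decaying:
  assumes \<alpha>: "0 < \<alpha>" and [measurable]: "g \<in> borel_measurable borel" and g: "\<And>z. \<bar>g z\<bar> \<le> C * decay \<alpha> \<beta> z"
  shows "integrable lborel (\<lambda>z. U z $ k * g z)" "integrable lborel (\<lambda>z. (U z $ i * U z $ j) * g z)"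
proof -
  show "integrable lborel (\<lambda>z. U z $ k * g z)"
  proof (rule Bochner_Integration.integrable_bound[OF integrable_mult_right[OF integrable_decay(2)[OF \<alpha>, of \<beta>], of C]])
    have "\<bar>U z $ k * g z\<bar> \<le> norm (U z) * (C * decay \<alpha> \<beta> z)" for z
      unfolding abs_mult by (intro mult_mono component_le g) auto
    then show "AE z in lborel. norm (U z $ k * g z) \<le> norm (C * (norm (U z) * decay \<alpha> \<beta> z))"
      by (intro AE_I2) (metis abs_ge_self mult.left_commute order_trans real_norm_def)
  qed measurable
  show "integrable lborel (\<lambda>z. (U z $ i * U z $ j) * g z)"
  proof (rule Bochner_Integration.integrable_bound[OF integrable_mult_right[OF integrable_decay(1)[OF \<alpha>, of \<beta>], of C]])
    have "\<bar>(U z $ i * U z $ j) * g z\<bar> \<le> (norm (U z))\<^sup>2 * (C * decay \<alpha> \<beta> z)" for z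
      unfolding abs_mult[of "U z $ i * U z $ j"] by (intro mult_mono component_le g) auto
    then show "AE z in lborel. norm ((U z $ i * U z $ j) * g z) \<le> norm (C * ((norm (U z))\<^sup>2 * decay \<alpha> \<beta> z))"
      by (intro AE_I2) (metis abs_ge_self mult.left_commute order_trans real_norm_def)
  qed measurable
qed

text \<open>The truncated functions are test functions, and their derivatives converge pointwise
  under an integrable majorant in every term. Dominated convergence thus admits functions whose
  support is unbounded in space.\<close>

lemma weak_decaying:
  assumes F: "smooth F" "\<And>vs. set vs \<subseteq> Basis \<Longrightarrow> \<exists>C. \<forall>z. \<bar>pderivs vs F z\<bar> \<le> C * decay \<alpha> \<beta> z"
    and \<alpha>: "0 < \<alpha>"
  shows "(\<Sum>j\<in>UNIV. \<integral>z. U z $ k * pderivs [e_time, e_space j, e_space j] F z \<partial>lborel)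
      + (\<Sum>j\<in>UNIV. \<Sum>l\<in>UNIV. \<integral>z. U z $ k * pderivs [e_space l, e_space l, e_space j, e_space j] F z \<partial>lborel)
    = (\<Sum>i\<in>UNIV. \<Sum>j\<in>UNIV. \<integral>z. (U z $ i * U z $ j) * pderivs [e_space j, e_space i, e_space k] F z \<partial>lborel)
      - (\<Sum>j\<in>UNIV. \<Sum>l\<in>UNIV. \<integral>z. (U z $ k * U z $ l) * pderivs [e_space l, e_space j, e_space j] F z \<partial>lborel)"
    (is "?L F = ?R F")
proof -
  define G where "G n z = cutoff n z * F z" for n z
  have approx1: "G n \<in> test_functions spacetime" for n
    unfolding G_def by (rule decaying_approximation(1)[OF F(1) _ \<alpha>]) (rule F(2))
  have approx2: "(\<lambda>n. pderivs vs (G n) z) \<longlonglongrightarrow> pderivs vs F z" for vs z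
    unfolding G_def by (rule decaying_approximation(2)[OF F(1) _ \<alpha>]) (rule F(2))
  have approx3: "\<exists>C\<ge>0. \<forall>n z. \<bar>pderivs vs (G n) z\<bar> \<le> C * decay \<alpha> \<beta> z" if "set vs \<subseteq> Basis" for vs
    unfolding G_def by (rule decaying_approximation(3)[OF F(1) _ \<alpha> that]) (rule F(2))
  have Gs: "smooth (G n)" for n unfolding G_def by (intro smooth_mult smooth_cutoff F)
  have lim: "(\<lambda>n. \<integral>z. U z $ k * pderivs vs (G n) z \<partial>lborel) \<longlonglongrightarrow> (\<integral>z. U z $ k * pderivs vs F z \<partial>lborel)" (is ?A)
    "(\<lambda>n. \<integral>z. (U z $ i * U z $ j) * pderivs vs (G n) z \<partial>lborel) \<longlonglongrightarrow> (\<integral>z. (U z $ i * U z $ j) * pderivs vs F z \<partial>lborel)" (is ?B)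
    if vs: "set vs \<subseteq> Basis" for vs k i j
  proof -
    obtain C where C: "0 \<le> C" "\<And>n z. \<bar>pderivs vs (G n) z\<bar> \<le> C * decay \<alpha> \<beta> z"
      using approx3[OF vs] by blast
    have [measurable]: "pderivs vs F \<in> borel_measurable borel" "\<And>n. pderivs vs (G n) \<in> borel_measurable borel"
      by (intro smooth_borel smooth_pderivs F Gs vs)+
    show ?A
    proof (rule integral_dominated_convergence)
      show "integrable lborel (\<lambda>z. C * (norm (U z) * decay \<alpha> \<beta> z))"
        by (intro integrable_mult_right integrable_decay \<alpha>)
      show "AE z in lborel. (\<lambda>n. U z $ k * pderivs vs (G n) z) \<longlonglongrightarrow> U z $ k * pderivs vs F z"
        by (intro AE_I2 tendsto_intros approx2)
      have "\<bar>U z $ k * pderivs vs (G n) z\<bar> \<le> norm (U z) * (C * decay \<alpha> \<beta> z)" for n z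
        unfolding abs_mult by (intro mult_mono component_le C) auto
      then show "AE z in lborel. norm (U z $ k * pderivs vs (G n) z) \<le> C * (norm (U z) * decay \<alpha> \<beta> z)" for n
        by (intro AE_I2) (simp add: mult.left_commute)
    qed measurable
    show ?B
    proof (rule integral_dominated_convergence)
      show "integrable lborel (\<lambda>z. C * ((norm (U z))\<^sup>2 * decay \<alpha> \<beta> z))"
        by (intro integrable_mult_right integrable_decay \<alpha>)
      show "AE z in lborel. (\<lambda>n. (U z $ i * U z $ j) * pderivs vs (G n) z) \<longlonglongrightarrow> (U z $ i * U z $ j) * pderivs vs F z"
        by (intro AE_I2 tendsto_intros approx2)
      have "\<bar>(U z $ i * U z $ j) * pderivs vs (G n) z\<bar> \<le> (norm (U z))\<^sup>2 * (C * decay \<alpha> \<beta> z)" for n z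
        unfolding abs_mult[of "U z $ i * U z $ j"] by (intro mult_mono component_le C) auto
      then show "AE z in lborel. norm ((U z $ i * U z $ j) * pderivs vs (G n) z) \<le> C * ((norm (U z))\<^sup>2 * decay \<alpha> \<beta> z)" for n
        by (intro AE_I2) (simp add: mult.left_commute)
    qed measurable
  qed
  have sub: "set [e_time, e_space j, e_space j] \<subseteq> Basis" "set [e_space l, e_space l, e_space j, e_space j] \<subseteq> Basis"
    "set [e_space l, e_space i, e_space j] \<subseteq> Basis" for i j l :: 3
    using e_space_Basis e_time_Basis by auto
  have "(\<lambda>n. ?L (G n)) \<longlonglongrightarrow> ?L F"
    by (intro tendsto_add tendsto_sum lim sub)
  moreover have "(\<lambda>n. ?R (G n)) \<longlonglongrightarrow> ?R F"
    by (intro tendsto_diff tendsto_sum lim sub)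
  moreover have "?L (G n) = ?R (G n)" for n by (rule weak[OF approx1])
  ultimately show ?thesis using LIMSEQ_unique by simp
qed

end

text \<open>The closed form of both the Laplacian in \<open>x\<close> and the derivative in
  \<open>s\<close> of \<open>heat s x\<close>; the heat equation is the coincidence of the
  two.\<close>

definition laplace_heat :: "real \<Rightarrow> real^3 \<Rightarrow> real" where
  "laplace_heat s x = ((norm x)\<^sup>2 / (4 * s\<^sup>2) - 3 / (2 * s)) * heat s x"

lemma pderiv_dir_diff_sum:
  assumes "smooth f" "\<And>i. i \<in> A \<Longrightarrow> smooth (g i)"
  shows "pderiv_dir v (\<lambda>z. f z - (\<Sum>i\<in>A. g i z)) = (\<lambda>z. pderiv_dir v f z - (\<Sum>i\<in>A. pderiv_dir v (g i) z))"
proof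
  fix z
  have "((\<lambda>z. f z - (\<Sum>i\<in>A. g i z)) has_derivative (\<lambda>v. pderiv_dir v f z - (\<Sum>i\<in>A. pderiv_dir v (g i) z))) (at z)"
    by (intro has_derivative_diff has_derivative_sum smooth_has_derivative assms)
  then show "pderiv_dir v (\<lambda>z. f z - (\<Sum>i\<in>A. g i z)) z = pderiv_dir v f z - (\<Sum>i\<in>A. pderiv_dir v (g i) z)"
    by (rule pderiv_dir_eq)
qed

section \<open>Integration over the age of the kernel\<close>

lemma powr_tail_integral:
  assumes p: "1 < p" and m: "0 < e + m"
  shows "(\<integral>\<^sup>+s. ennreal (indicat_real {e<..} s * (s + m) powr - p) \<partial>lborel) = ennreal ((e + m) powr (1 - p) / (p - 1))"
proof -
  have I: "((\<lambda>x. x powr - p) has_integral - ((e + m) powr (- p + 1)) / (- p + 1)) {e + m..}"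
    by (rule has_integral_powr_to_inf) (use p m in auto)
  define f where "f x = ennreal (indicat_real {e + m..} x * x powr - p)" for x
  have [measurable]: "f \<in> borel_measurable borel" unfolding f_def[abs_def] by measurable
  have "(\<integral>\<^sup>+s. ennreal (indicat_real {e<..} s * (s + m) powr - p) \<partial>lborel) = (\<integral>\<^sup>+s. f (s - (- m)) \<partial>lborel)"
  proof (rule nn_integral_cong_AE, rule AE_mp[OF AE_lborel_singleton[of e]], rule AE_I2, rule impI)
    fix s assume "s \<noteq> e"
    then show "ennreal (indicat_real {e<..} s * (s + m) powr - p) = f (s - (- m))"
      by (simp add: f_def indicator_def)
  qed
  also have "\<dots> = (\<integral>\<^sup>+s. f s \<partial>lborel)" by (rule nn_integral_translate_reflect(2)) measurable
  also have "\<dots> = ennreal (- ((e + m) powr (- p + 1)) / (- p + 1))"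
    unfolding f_def by (rule nn_integral_has_integral_lebesgue[OF powr_ge_zero I])
  also have "- ((e + m) powr (- p + 1)) / (- p + 1) = (e + m) powr (1 - p) / (p - 1)"
    using p by (simp add: field_simps)
  finally show ?thesis .
qed

lemma heat_measurable [measurable]:
  assumes [measurable]: "f \<in> borel_measurable M" "h \<in> borel_measurable M"
  shows "(\<lambda>x. heat (f x) (h x)) \<in> borel_measurable M" "(\<lambda>x. laplace_heat (f x) (h x)) \<in> borel_measurable M"
  unfolding laplace_heat_def heat_def by measurable

text \<open>Fundamental theorem of calculus on a half-line: the integrand is the
  \<open>s\<close>-derivative of the kernel, which tends to 0 as \<open>s\<close> grows.\<close>

lemma laplace_heat_integral:
  assumes m: "0 < e + m"
  shows "integrable lborel (\<lambda>s. indicat_real {e<..} s * laplace_heat (s + m) x)"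
    and "(\<integral>s. indicat_real {e<..} s * laplace_heat (s + m) x \<partial>lborel) = - heat (e + m) x"
proof -
  obtain C where C: "0 \<le> C" "\<And>s x. 0 < s \<Longrightarrow> \<bar>laplace_heat s x\<bar> \<le> C * (s + (norm x)\<^sup>2) powr (-5/2)"
    using heat_laplace_bound unfolding laplace_heat_def by blast
  obtain D where D: "0 \<le> D" "\<And>s x. 0 < s \<Longrightarrow> heat s x \<le> D * (s + (norm x)\<^sup>2) powr (-3/2)"
    using heat_bound by blast
  have "(\<integral>\<^sup>+s. ennreal (norm (indicat_real {e<..} s * laplace_heat (s + m) x)) \<partial>lborel)
      \<le> (\<integral>\<^sup>+s. ennreal C * ennreal (indicat_real {e<..} s * (s + (m + (norm x)\<^sup>2)) powr - (5/2)) \<partial>lborel)"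
  proof (rule nn_integral_mono)
    fix s
    show "ennreal (norm (indicat_real {e<..} s * laplace_heat (s + m) x)) \<le> ennreal C * ennreal (indicat_real {e<..} s * (s + (m + (norm x)\<^sup>2)) powr - (5/2))"
    proof (cases "e < s")
      case True
      then have "0 < s + m" using m by simp
      from C(2)[OF this, of x] True C(1) show ?thesis
        by (simp add: ennreal_mult[symmetric] add.assoc ennreal_leI)
    qed simp
  qed
  also have "\<dots> = ennreal C * ennreal ((e + (m + (norm x)\<^sup>2)) powr (1 - 5/2) / (5/2 - 1))"
    by (subst nn_integral_cmult, measurable) (subst powr_tail_integral, use m in \<open>auto simp: add.assoc[symmetric] add_pos_nonneg\<close>)
  also have "\<dots> < \<infinity>" by (simp add: ennreal_mult_less_top)
  finally show int: "integrable lborel (\<lambda>s. indicat_real {e<..} s * laplace_heat (s + m) x)"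
    by (intro integrableI_bounded) measurable
  have eI: "einterval (ereal e) \<infinity> = {e<..}" by (auto simp: einterval_def)
  have "(LBINT s=ereal e..\<infinity>. laplace_heat (s + m) x) = 0 - heat (e + m) x"
  proof (rule interval_integral_FTC_integrable)
    fix s assume "ereal e < ereal s" "ereal s < \<infinity>"
    then have s: "0 < s + m" using m by simp
    have "((\<lambda>s. heat (s + m) x) has_real_derivative laplace_heat (s + m) x) (at s)"
      using heat_has_derivative_time[OF s, of x] DERIV_shift[of "\<lambda>s. heat s x" _ s m]
      unfolding laplace_heat_def by simp
    then show "((\<lambda>s. heat (s + m) x) has_vector_derivative laplace_heat (s + m) x) (at s)"
      by (simp add: has_real_derivative_iff_has_vector_derivative)
    show "isCont (\<lambda>s. laplace_heat (s + m) x) s"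
      unfolding laplace_heat_def heat_def using s by (intro continuous_intros) auto
  next
    show "set_integrable lborel (einterval (ereal e) \<infinity>) (\<lambda>s. laplace_heat (s + m) x)"
      using int by (simp add: eI set_integrable_def)
  next
    have "isCont (\<lambda>s. heat (s + m) x) e"
      unfolding heat_def using m by (intro continuous_intros) auto
    then have "((\<lambda>s. heat (s + m) x) \<longlongrightarrow> heat (e + m) x) (at_right e)"
      by (simp add: continuous_within filterlim_at_split isCont_def)
    then show "(((\<lambda>s. heat (s + m) x) \<circ> real_of_ereal) \<longlongrightarrow> heat (e + m) x) (at_right (ereal e))"
      by (simp add: ereal_tendsto_simps)
  next
    have "((\<lambda>s. D * (s + m) powr (-3/2)) \<longlongrightarrow> D * 0) at_top"
      by (intro tendsto_mult tendsto_const tendsto_neg_powr filterlim_tendsto_add_at_top[OF tendsto_const filterlim_ident, of m, simplified add.commute[of m]]) auto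
    then have lim: "((\<lambda>s. D * (s + m) powr (-3/2)) \<longlongrightarrow> 0) at_top" by simp
    have "((\<lambda>s. heat (s + m) x) \<longlongrightarrow> 0) at_top"
    proof (rule Lim_null_comparison[OF _ lim])
      show "\<forall>\<^sub>F s in at_top. norm (heat (s + m) x) \<le> D * (s + m) powr (-3/2)"
        using eventually_gt_at_top[of e]
      proof eventually_elim
        case (elim s)
        then have s: "0 < s + m" using m by simp
        have "heat (s + m) x \<le> D * (s + m + (norm x)\<^sup>2) powr (-3/2)" by (rule D(2)[OF s])
        also have "\<dots> \<le> D * (s + m) powr (-3/2)"
          using s by (intro mult_left_mono D powr_mono2') auto
        finally show ?case using heat_pos[of "s + m" x] by simp
      qed
    qed
    then show "(((\<lambda>s. heat (s + m) x) \<circ> real_of_ereal) \<longlongrightarrow> 0) (at_left \<infinity>)"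
      by (simp add: ereal_tendsto_simps)
  qed simp
  then show "(\<integral>s. indicat_real {e<..} s * laplace_heat (s + m) x \<partial>lborel) = - heat (e + m) x"
    by (simp add: interval_lebesgue_integral_def eI set_lebesgue_integral_def)
qed

context pressure_free_flow
begin

text \<open>The identity is tested with \<open>a\<close> times the kernel of age
  \<open>s + (t0 - t)\<close>. The backward heat equation makes the sums of fourth derivatives
  cancel, so the linear side keeps just the Laplacian of the term with the derivative of
  \<open>a\<close>. On the quadratic side two double sums of nine third derivatives each account for
  the factor 18.\<close>

lemma heat_identity_bound:
  assumes a: "smooth a" "\<And>t. t \<notin> {\<alpha>..\<beta>} \<Longrightarrow> a t = 0" and \<alpha>: "0 < \<alpha>" and \<beta>: "\<beta> < t0" and s: "0 < s"
  shows "ennreal \<bar>\<integral>z. U z $ k * (pderiv_dir 1 a (fst z) * laplace_heat (s + (t0 - fst z)) (snd z - y)) \<partial>lborel\<bar>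
    \<le> ennreal (18 * heat3_const) * (\<integral>\<^sup>+z. ennreal ((norm (U z))\<^sup>2 * \<bar>a (fst z)\<bar> * kern 3 (s + (t0 - fst z), snd z - y)) \<partial>lborel)"
proof -
  note C3 = less_imp_le[OF heat3_const(1)] heat3_const(2)
  \<comment> \<open>equals \<open>s + (t0 - t)\<close> on the support of \<open>a\<close> and is positive everywhere, so that the test function is
    smooth on the whole space-time\<close>
  define \<sigma> where "\<sigma> t = s + (t0 - t) * smooth_step ((t0 - t) * inverse (t0 - \<beta>))" for t
  have \<sigma>s: "smooth \<sigma>"
    unfolding \<sigma>_def[abs_def]
    by (intro smooth_add smooth_mult smooth_diff smooth_const smooth_id smooth_compose[OF smooth_smooth_step])
  have \<sigma>pos: "0 < \<sigma> t" for t
  proof (cases "t \<le> t0")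
    case True
    then show ?thesis using s smooth_step_bounds by (simp add: \<sigma>_def add_pos_nonneg)
  next
    case False
    then have "smooth_step ((t0 - t) * inverse (t0 - \<beta>)) = 0"
      using \<beta> by (intro smooth_step_eq_0 order_trans[OF mult_nonpos_nonneg]) auto
    then show ?thesis using s by (simp add: \<sigma>_def)
  qed
  have \<sigma>eq: "\<sigma> t = s + (t0 - t)" if "t < (t0 + \<beta>) / 2" for t
  proof -
    have "1/2 \<le> (t0 - t) * inverse (t0 - \<beta>)"
      using that \<beta> by (simp add: divide_inverse[symmetric] pos_le_divide_eq field_simps)
    then show ?thesis by (simp add: \<sigma>_def smooth_step_eq_1)
  qed
  have \<beta>2: "t < (t0 + \<beta>) / 2" if "t \<in> {\<alpha>..\<beta>}" for t using that \<beta> by auto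
  have a\<sigma>: "a t * pderiv_dir 1 \<sigma> t = - a t" for t
  proof (cases "t \<in> {\<alpha>..\<beta>}")
    case True
    have "((\<lambda>t. s + (t0 - t)) has_real_derivative - 1) (at t)" by (auto intro!: derivative_eq_intros)
    then have "(\<sigma> has_real_derivative - 1) (at t)"
      by (rule has_field_derivative_transform_within_open[where S="{..<(t0 + \<beta>) / 2}"]) (use \<beta>2[OF True] \<sigma>eq in auto)
    then show ?thesis using pderiv_dir_1_eq by simp
  qed (simp add: a)
  let ?a' = "pderiv_dir 1 a"
  have a': "smooth ?a'" using a by (intro smooth_pderiv_dir) auto
  have a'0: "?a' t = 0" if "t \<notin> {\<alpha>..\<beta>}" for t
    using pderivs_eq_0_outside[OF closed_atLeastAtMost a(2) that, where vs="[1]"] by simp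
  interpret H: heat_test_function a \<sigma> y \<alpha> \<beta>
    by unfold_locales (use a \<sigma>s \<sigma>pos in auto)
  interpret H': heat_test_function ?a' \<sigma> y \<alpha> \<beta>
    by unfold_locales (use a' a'0 \<sigma>s \<sigma>pos in auto)
  define d where "d j = pderiv_dir (e_space j)" for j
  have sm: "smooth (d j f)" if "smooth f" for j and f :: "real \<times> (real^3) \<Rightarrow> real"
    unfolding d_def by (intro smooth_pderiv_dir that e_space_Basis)
  have comm: "pderiv_dir e_time (d j f) = d j (pderiv_dir e_time f)" if "smooth f" for f j
    unfolding d_def by (intro pderiv_dir_commute that e_space_Basis e_time_Basis)
  have time: "pderiv_dir e_time H.F = (\<lambda>z. H'.F z - (\<Sum>l\<in>UNIV. d l (d l H.F) z))"
    by (rule ext) (simp add: H.pderiv_time_F[OF a\<sigma>] H'.F_def d_def)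
  have dd: "pderiv_dir e_time (d j (d j H.F)) = (\<lambda>z. d j (d j H'.F) z - (\<Sum>l\<in>UNIV. d j (d j (d l (d l H.F))) z))" for j
  proof -
    have "pderiv_dir e_time (d j (d j H.F)) = d j (d j (\<lambda>z. H'.F z - (\<Sum>l\<in>UNIV. d l (d l H.F) z)))"
      by (simp add: comm sm H.smooth_F time)
    also have "d j (\<lambda>z. H'.F z - (\<Sum>l\<in>UNIV. d l (d l H.F) z)) = (\<lambda>z. d j H'.F z - (\<Sum>l\<in>UNIV. d j (d l (d l H.F)) z))"
      unfolding d_def[of j] by (rule pderiv_dir_diff_sum) (intro sm H.smooth_F H'.smooth_F)+
    also have "d j (\<lambda>z. d j H'.F z - (\<Sum>l\<in>UNIV. d j (d l (d l H.F)) z))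
      = (\<lambda>z. d j (d j H'.F) z - (\<Sum>l\<in>UNIV. d j (d j (d l (d l H.F))) z))"
      unfolding d_def[of j] by (rule pderiv_dir_diff_sum) (fold d_def, (intro sm H.smooth_F H'.smooth_F)+)
    finally show ?thesis .
  qed
  have sub: "set [e_space j, e_space j] \<subseteq> Basis" "set [e_space l, e_space l, e_space j, e_space j] \<subseteq> Basis"
    "set [e_space l, e_space i, e_space j] \<subseteq> Basis" for i j l :: 3
    using e_space_Basis by auto
  have integr: "integrable lborel (\<lambda>z. U z $ k * pderivs vs H.F z)" "integrable lborel (\<lambda>z. (U z $ i * U z $ j) * pderivs vs H.F z)"
    "integrable lborel (\<lambda>z. U z $ k * pderivs vs H'.F z)"
    if "set vs \<subseteq> Basis" for vs k i j
  proof -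
    obtain C where C: "\<And>z. \<bar>pderivs vs H.F z\<bar> \<le> C * decay \<alpha> \<beta> z" using H.decay_F by blast
    obtain C' where C': "\<And>z. \<bar>pderivs vs H'.F z\<bar> \<le> C' * decay \<alpha> \<beta> z" using H'.decay_F by blast
    show "integrable lborel (\<lambda>z. U z $ k * pderivs vs H.F z)" "integrable lborel (\<lambda>z. (U z $ i * U z $ j) * pderivs vs H.F z)"
      by (rule integrable_mult_decaying[OF \<alpha> _ C]; intro smooth_borel smooth_pderivs H.smooth_F that)+
    show "integrable lborel (\<lambda>z. U z $ k * pderivs vs H'.F z)"
      by (rule integrable_mult_decaying[OF \<alpha> _ C']; intro smooth_borel smooth_pderivs H'.smooth_F that)
  qed
  have ifF: "integrable lborel (\<lambda>z. U z $ k * d l (d l (d j (d j H.F))) z)" for l j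
    using integr(1)[OF sub(2), of k l j] by (simp add: d_def)
  have ifF': "integrable lborel (\<lambda>z. U z $ k * d j (d j H'.F) z)" for j
    using integr(3)[OF sub(1), of k j] by (simp add: d_def)
  define L where "L l j = (\<integral>z. U z $ k * d l (d l (d j (d j H.F))) z \<partial>lborel)" for l j
  define B where "B i j l = (\<integral>z. (U z $ i * U z $ j) * pderivs l H.F z \<partial>lborel)" for i j and l :: "(real \<times> (real^3)) list"
  have "(\<integral>z. U z $ k * pderiv_dir e_time (d j (d j H.F)) z \<partial>lborel)
      = (\<integral>z. U z $ k * d j (d j H'.F) z \<partial>lborel) - (\<Sum>l\<in>UNIV. L j l)" for j
  proof -
    have "(\<integral>z. U z $ k * pderiv_dir e_time (d j (d j H.F)) z \<partial>lborel)
      = (\<integral>z. U z $ k * d j (d j H'.F) z - (\<Sum>l\<in>UNIV. U z $ k * d j (d j (d l (d l H.F))) z) \<partial>lborel)"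
      unfolding dd by (simp add: right_diff_distrib sum_distrib_left)
    also have "\<dots> = (\<integral>z. U z $ k * d j (d j H'.F) z \<partial>lborel) - (\<integral>z. (\<Sum>l\<in>UNIV. U z $ k * d j (d j (d l (d l H.F))) z) \<partial>lborel)"
      by (intro Bochner_Integration.integral_diff ifF' Bochner_Integration.integrable_sum ifF)
    also have "(\<integral>z. (\<Sum>l\<in>UNIV. U z $ k * d j (d j (d l (d l H.F))) z) \<partial>lborel) = (\<Sum>l\<in>UNIV. L j l)"
      unfolding L_def by (intro Bochner_Integration.integral_sum ifF)
    finally show ?thesis .
  qed
  moreover have "(\<Sum>j\<in>UNIV. \<integral>z. U z $ k * pderiv_dir e_time (d j (d j H.F)) z \<partial>lborel) + (\<Sum>j\<in>UNIV. \<Sum>l\<in>UNIV. L l j)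
     = (\<Sum>i\<in>UNIV. \<Sum>j\<in>UNIV. B i j [e_space j, e_space i, e_space k]) - (\<Sum>j\<in>UNIV. \<Sum>l\<in>UNIV. B k l [e_space l, e_space j, e_space j])"
    using weak_decaying[OF H.smooth_F H.decay_F \<alpha>, of k] unfolding L_def B_def d_def by simp
  \<comment> \<open>The two fourth order sums differ only in the order of summation, which is why
    they cancel.\<close>
  moreover have "(\<Sum>j\<in>UNIV. \<Sum>l\<in>UNIV. L j l) = (\<Sum>j\<in>UNIV. \<Sum>l\<in>UNIV. L l j)" by (rule sum.swap)
  ultimately have main: "(\<Sum>j\<in>UNIV. \<integral>z. U z $ k * d j (d j H'.F) z \<partial>lborel)
     = (\<Sum>i\<in>UNIV. \<Sum>j\<in>UNIV. B i j [e_space j, e_space i, e_space k]) - (\<Sum>j\<in>UNIV. \<Sum>l\<in>UNIV. B k l [e_space l, e_space j, e_space j])"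
    by (simp add: sum_subtractf)
  have "(\<Sum>j\<in>UNIV. \<integral>z. U z $ k * d j (d j H'.F) z \<partial>lborel) = (\<integral>z. (\<Sum>j\<in>UNIV. U z $ k * d j (d j H'.F) z) \<partial>lborel)"
    by (rule Bochner_Integration.integral_sum[symmetric]) (rule ifF')
  also have "\<dots> = (\<integral>z. U z $ k * (?a' (fst z) * laplace_heat (s + (t0 - fst z)) (snd z - y)) \<partial>lborel)"
  proof (intro Bochner_Integration.integral_cong refl)
    fix z
    have "(\<Sum>j\<in>UNIV. U z $ k * d j (d j H'.F) z) = U z $ k * (\<Sum>j\<in>UNIV. d j (d j H'.F) z)"
      by (rule sum_distrib_left[symmetric])
    also have "(\<Sum>j\<in>UNIV. d j (d j H'.F) z) = ?a' (fst z) * laplace_heat (\<sigma> (fst z)) (snd z - y)"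
      using H'.laplace_F[of z] by (simp add: d_def H'.F_def laplace_heat_def)
    also have "\<dots> = ?a' (fst z) * laplace_heat (s + (t0 - fst z)) (snd z - y)"
      using a'0[of "fst z"] \<sigma>eq \<beta>2 by (cases "fst z \<in> {\<alpha>..\<beta>}") auto
    finally show "(\<Sum>j\<in>UNIV. U z $ k * d j (d j H'.F) z) = U z $ k * (?a' (fst z) * laplace_heat (s + (t0 - fst z)) (snd z - y))" .
  qed
  finally have lhs: "(\<integral>z. U z $ k * (?a' (fst z) * laplace_heat (s + (t0 - fst z)) (snd z - y)) \<partial>lborel)
    = (\<Sum>i\<in>UNIV. \<Sum>j\<in>UNIV. B i j [e_space j, e_space i, e_space k]) - (\<Sum>j\<in>UNIV. \<Sum>l\<in>UNIV. B k l [e_space l, e_space j, e_space j])"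
    using main by simp
  define J where "J = (\<integral>\<^sup>+z. ennreal ((norm (U z))\<^sup>2 * \<bar>a (fst z)\<bar> * kern 3 (s + (t0 - fst z), snd z - y)) \<partial>lborel)"
  have pt: "\<bar>pderivs [e_space l, e_space i, e_space j] H.F z\<bar> \<le> heat3_const * (\<bar>a (fst z)\<bar> * kern 3 (s + (t0 - fst z), snd z - y))" for i j l z
  proof (cases "fst z \<in> {\<alpha>..\<beta>}")
    case True
    let ?X = "snd z - y"
    have \<sigma>z: "\<sigma> (fst z) = s + (t0 - fst z)" using \<sigma>eq \<beta>2[OF True] by simp
    have pos: "0 < s + (t0 - fst z)" using \<sigma>pos[of "fst z"] \<sigma>z by simp
    let ?u = "axis j 1 :: real^3" and ?v = "axis i 1 :: real^3" and ?w = "axis l 1 :: real^3"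
    define q where "q = - (?X \<bullet> ?u) * (?X \<bullet> ?v) * (?X \<bullet> ?w) / (8 * (\<sigma> (fst z)) ^ 3)
      + ((?u \<bullet> ?w) * (?X \<bullet> ?v) + (?v \<bullet> ?w) * (?X \<bullet> ?u) + (?u \<bullet> ?v) * (?X \<bullet> ?w)) / (4 * (\<sigma> (fst z))\<^sup>2)"
    have "pderivs [e_space l, e_space i, e_space j] H.F z = q * H.F z"
      using H.pderiv_3[OF e_space_Basis e_space_Basis, of "axis l 1" i j] by (simp add: q_def)
    then have "\<bar>pderivs [e_space l, e_space i, e_space j] H.F z\<bar> = \<bar>a (fst z)\<bar> * \<bar>q * heat (\<sigma> (fst z)) ?X\<bar>"
      by (simp add: H.F_def abs_mult)
    also have "\<dots> \<le> \<bar>a (fst z)\<bar> * (heat3_const * (\<sigma> (fst z) + (norm ?X)\<^sup>2) powr (-3))"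
      unfolding q_def by (intro mult_left_mono C3 \<sigma>pos) (auto simp: norm_axis_1)
    also have "\<dots> = heat3_const * (\<bar>a (fst z)\<bar> * kern 3 (s + (t0 - fst z), ?X))"
      using pos by (simp add: kern_def \<sigma>z)
    finally show ?thesis .
  next
    case False
    have "pderivs [e_space l, e_space i, e_space j] H.F z = 0"
      using H.decay_F[of "[e_space l, e_space i, e_space j]"] False by (metis decay_def abs_le_zero_iff mult_zero_right)
    then show ?thesis using C3 kern_nonneg by (simp only: abs_zero) (intro mult_nonneg_nonneg; simp)
  qed
  have Bb: "ennreal \<bar>B i' j' [e_space l, e_space i, e_space j]\<bar> \<le> ennreal heat3_const * J" for i' j' i j l
  proof -
    have "ennreal \<bar>B i' j' [e_space l, e_space i, e_space j]\<bar>
       \<le> (\<integral>\<^sup>+z. ennreal (norm ((U z $ i' * U z $ j') * pderivs [e_space l, e_space i, e_space j] H.F z)) \<partial>lborel)"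
      unfolding B_def using integral_norm_bound_ennreal[OF integr(2)[OF sub(3)]] by simp
    also have "\<dots> \<le> (\<integral>\<^sup>+z. ennreal heat3_const * ennreal ((norm (U z))\<^sup>2 * \<bar>a (fst z)\<bar> * kern 3 (s + (t0 - fst z), snd z - y)) \<partial>lborel)"
    proof (rule nn_integral_mono)
      fix z
      have "\<bar>(U z $ i' * U z $ j') * pderivs [e_space l, e_space i, e_space j] H.F z\<bar>
        \<le> (norm (U z))\<^sup>2 * (heat3_const * (\<bar>a (fst z)\<bar> * kern 3 (s + (t0 - fst z), snd z - y)))"
        unfolding abs_mult[of "U z $ i' * U z $ j'"] by (intro mult_mono component_le pt) auto
      also have "\<dots> = heat3_const * ((norm (U z))\<^sup>2 * \<bar>a (fst z)\<bar> * kern 3 (s + (t0 - fst z), snd z - y))"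
        by (simp only: mult.assoc mult.left_commute[of heat3_const])
      finally show "ennreal (norm ((U z $ i' * U z $ j') * pderivs [e_space l, e_space i, e_space j] H.F z))
         \<le> ennreal heat3_const * ennreal ((norm (U z))\<^sup>2 * \<bar>a (fst z)\<bar> * kern 3 (s + (t0 - fst z), snd z - y))"
        using C3(1) by (simp add: ennreal_mult'[symmetric] ennreal_leI del: ennreal_mult)
    qed
    also have "\<dots> = ennreal heat3_const * J"
      unfolding J_def
    proof (rule nn_integral_cmult)
      have [measurable]: "a \<in> borel_measurable borel" by (rule smooth_borel[OF a(1)])
      show "(\<lambda>z. ennreal ((norm (U z))\<^sup>2 * \<bar>a (fst z)\<bar> * kern 3 (s + (t0 - fst z), snd z - y))) \<in> borel_measurable lborel"
        by (intro measurable_compose[OF _ measurable_ennreal] borel_measurable_times measurable_compose[OF _ kern_measurable]) measurable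
    qed
    finally show ?thesis .
  qed
  show ?thesis
  proof (cases "ennreal heat3_const * J = \<infinity>")
    case True
    have "ennreal (18 * heat3_const) * J = 18 * (ennreal heat3_const * J)"
      using C3 by (simp add: ennreal_mult' mult.assoc)
    then show ?thesis unfolding J_def[symmetric] using True by (simp add: ennreal_mult_top)
  next
    case False
    define b where "b = enn2real (ennreal heat3_const * J)"
    have b: "ennreal heat3_const * J = ennreal b" "0 \<le> b" using False by (auto simp: b_def ennreal_enn2real_if)
    have Bb': "\<bar>B i' j' [e_space l, e_space i, e_space j]\<bar> \<le> b" for i' j' i j l
      using Bb[of i' j' l i j] b by (simp add: ennreal_le_iff)
    have "\<bar>\<Sum>i\<in>(UNIV::3 set). \<Sum>j\<in>(UNIV::3 set). B i j [e_space j, e_space i, e_space k]\<bar> \<le> (\<Sum>i\<in>(UNIV::3 set). \<Sum>j\<in>(UNIV::3 set). b)"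
      by (intro order_trans[OF sum_abs] sum_mono Bb')
    moreover have "\<bar>\<Sum>j\<in>(UNIV::3 set). \<Sum>l\<in>(UNIV::3 set). B k l [e_space l, e_space j, e_space j]\<bar> \<le> (\<Sum>i\<in>(UNIV::3 set). \<Sum>j\<in>(UNIV::3 set). b)"
      by (intro order_trans[OF sum_abs] sum_mono Bb')
    ultimately have "\<bar>\<integral>z. U z $ k * (?a' (fst z) * laplace_heat (s + (t0 - fst z)) (snd z - y)) \<partial>lborel\<bar> \<le> 18 * b"
      unfolding lhs by simp
    then have "ennreal \<bar>\<integral>z. U z $ k * (?a' (fst z) * laplace_heat (s + (t0 - fst z)) (snd z - y)) \<partial>lborel\<bar> \<le> 18 * ennreal b"
      using b(2) by (simp add: ennreal_mult''[symmetric] ennreal_leI ennreal_numeral[symmetric] del: ennreal_numeral)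
    also have "18 * ennreal b = ennreal (18 * heat3_const) * J"
      unfolding b(1)[symmetric] using C3 by (simp add: ennreal_mult' mult.assoc)
    finally show ?thesis unfolding J_def .
  qed
qed

end

lemma powr_mono_base: "0 < b \<Longrightarrow> b \<le> c \<Longrightarrow> 0 \<le> p \<Longrightarrow> c powr - p \<le> (b::real) powr - p"
  by (intro powr_mono2') auto

context pressure_free_flow
begin

text \<open>The bound for a fixed age \<open>s\<close> is integrated over
  \<open>s > \<epsilon>\<close>. On the left Fubini and the integral of \<open>laplace_heat\<close>
  restore the kernel itself. On the right the exponent 3 drops to 2 with a factor 1/2, which turns
  18 into 9; the shift by \<open>\<epsilon>\<close> is then discarded by monotonicity, so the right
  side is independent of it.\<close>

lemma heat_test_bound:
  assumes a: "smooth a" "\<And>t. t \<notin> {\<alpha>..\<beta>} \<Longrightarrow> a t = 0" and \<alpha>: "0 < \<alpha>" and \<beta>: "\<beta> < t0" and \<epsilon>: "0 < \<epsilon>"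
  shows "ennreal \<bar>\<integral>z. U z $ k * (pderiv_dir 1 a (fst z) * heat (\<epsilon> + (t0 - fst z)) (snd z - y)) \<partial>lborel\<bar>
    \<le> ennreal (9 * heat3_const) * (\<integral>\<^sup>+z. ennreal ((norm (U z))\<^sup>2 * \<bar>a (fst z)\<bar> * kern 2 (t0 - fst z, snd z - y)) \<partial>lborel)"
proof -
  note C3 = less_imp_le[OF heat3_const(1)] heat3_const(2)
  let ?a' = "pderiv_dir 1 a"
  have a': "smooth ?a'" using a by (intro smooth_pderiv_dir) auto
  have [measurable]: "a \<in> borel_measurable borel" "?a' \<in> borel_measurable borel"
    by (intro smooth_borel a a')+
  have a'0: "?a' t = 0" if "t \<notin> {\<alpha>..\<beta>}" for t
    using pderivs_eq_0_outside[OF closed_atLeastAtMost a(2) that, where vs="[1]"] by simp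
  obtain A where A: "\<And>t. \<bar>?a' t\<bar> \<le> A"
  proof -
    have "\<exists>C. \<forall>x. \<bar>pderivs [1] a x\<bar> \<le> C"
      by (rule bounded_pderivs_compact_support[OF a(1) compact_Icc[of \<alpha> \<beta>] a(2)]) auto
    then show ?thesis using that by auto
  qed
  have A0: "0 \<le> A" using A[of 0] by linarith
  obtain C2 where C2: "0 \<le> C2" "\<And>s x. 0 < s \<Longrightarrow> \<bar>laplace_heat s x\<bar> \<le> C2 * (s + (norm x)\<^sup>2) powr (-5/2)"
    using heat_laplace_bound unfolding laplace_heat_def by blast
  define h where "h z = U z $ k * ?a' (fst z)" for z
  have [measurable]: "h \<in> borel_measurable borel" unfolding h_def[abs_def] by measurable
  have h0: "h z = 0" if "fst z \<notin> {\<alpha>..\<beta>}" for z using a'0[OF that] by (simp add: h_def)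
  have \<tau>: "0 < t0 - fst z" if "fst z \<in> {\<alpha>..\<beta>}" for z :: "real \<times> (real^3)" using that \<beta> by auto
  define N where "N z = (norm (snd z - y))\<^sup>2" for z :: "real \<times> (real^3)"
  have [measurable]: "N \<in> borel_measurable borel" unfolding N_def[abs_def] by measurable
  have N0: "0 \<le> N z" for z by (simp add: N_def)
  define g where "g s z = indicat_real {\<epsilon><..} s * (h z * laplace_heat (s + (t0 - fst z)) (snd z - y))" for s z
  have g_meas: "(\<lambda>(s, z). g s z) \<in> borel_measurable (lborel \<Otimes>\<^sub>M lborel)"
    unfolding g_def[abs_def] by measurable
  have inner: "(\<integral>\<^sup>+s. ennreal \<bar>g s z\<bar> \<partial>lborel) \<le> ennreal (C2 * (\<bar>h z\<bar> * (\<epsilon> + N z) powr (-3/2)))" for z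
  proof (cases "fst z \<in> {\<alpha>..\<beta>}")
    case True
    let ?m = "t0 - fst z + N z"
    have m: "0 < \<epsilon> + ?m" using \<tau>[OF True] \<epsilon> N0[of z] by linarith
    have "(\<integral>\<^sup>+s. ennreal \<bar>g s z\<bar> \<partial>lborel)
        \<le> (\<integral>\<^sup>+s. ennreal (C2 * \<bar>h z\<bar>) * ennreal (indicat_real {\<epsilon><..} s * (s + ?m) powr - (5/2)) \<partial>lborel)"
    proof (rule nn_integral_mono)
      fix s
      show "ennreal \<bar>g s z\<bar> \<le> ennreal (C2 * \<bar>h z\<bar>) * ennreal (indicat_real {\<epsilon><..} s * (s + ?m) powr - (5/2))"
      proof (cases "\<epsilon> < s")
        case s: True
        then have "0 < s + (t0 - fst z)" using \<epsilon> \<tau>[OF True] by simp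
        from C2(2)[OF this, of "snd z - y"]
        have "\<bar>laplace_heat (s + (t0 - fst z)) (snd z - y)\<bar> \<le> C2 * (s + ?m) powr - (5/2)"
          by (simp add: N_def add.assoc)
        from mult_left_mono[OF this abs_ge_zero[of "h z"]] show ?thesis
          using s C2(1) by (simp add: g_def abs_mult ennreal_mult[symmetric] ennreal_leI mult.assoc mult.left_commute)
      qed (simp add: g_def)
    qed
    also have "\<dots> = ennreal (C2 * \<bar>h z\<bar>) * ennreal ((\<epsilon> + ?m) powr (1 - 5/2) / (5/2 - 1))"
      by (subst nn_integral_cmult, measurable) (subst powr_tail_integral[OF _ m], auto)
    also have "\<dots> \<le> ennreal (C2 * (\<bar>h z\<bar> * (\<epsilon> + N z) powr (-3/2)))"
    proof -
      have "(\<epsilon> + ?m) powr (1 - 5/2) / (5/2 - 1) \<le> (\<epsilon> + ?m) powr (-3/2)"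
        by (simp add: field_simps)
      also have "\<dots> \<le> (\<epsilon> + N z) powr (-3/2)"
        using powr_mono_base[of "\<epsilon> + N z" "\<epsilon> + ?m" "3/2"] \<epsilon> \<tau>[OF True] N0[of z] by simp
      finally have "(C2 * \<bar>h z\<bar>) * ((\<epsilon> + ?m) powr (1 - 5/2) / (5/2 - 1)) \<le> (C2 * \<bar>h z\<bar>) * (\<epsilon> + N z) powr (-3/2)"
        using C2(1) by (intro mult_left_mono) auto
      then show ?thesis using C2(1) by (simp add: ennreal_mult[symmetric] ennreal_leI mult.assoc)
    qed
    finally show ?thesis .
  qed (simp add: g_def h0)
  \<comment> \<open>Absolute integrability for Fubini. The weight left by the
    \<open>s\<close>-integral decays like |x - y|^(-3), which is not integrable over space but is
    square integrable; it is therefore paired with the square integrable \<open>U\<close>.\<close>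
  have outer: "(\<integral>\<^sup>+z. ennreal (C2 * (\<bar>h z\<bar> * (\<epsilon> + N z) powr (-3/2))) \<partial>lborel) < \<infinity>"
  proof -
    have [measurable]: "{z::real \<times> (real^3). 0 < fst z \<and> fst z < b} \<in> sets borel" for b
      by (intro borel_open open_Collect_conj open_Collect_less continuous_intros)
    have [measurable]: "{z::real \<times> (real^3). fst z \<in> {\<alpha>..\<beta>}} \<in> sets borel"
      unfolding atLeastAtMost_iff by (intro borel_closed closed_Collect_conj closed_Collect_le continuous_intros)
    let ?I = "\<lambda>z. indicator {z::real \<times> (real^3). 0 < fst z \<and> fst z < \<beta> + 1} z :: ennreal"
    let ?I' = "\<lambda>z. indicator {z::real \<times> (real^3). fst z \<in> {\<alpha>..\<beta>}} z :: ennreal"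
    have "(\<integral>\<^sup>+z. ennreal (C2 * (\<bar>h z\<bar> * (\<epsilon> + N z) powr (-3/2))) \<partial>lborel)
      \<le> (\<integral>\<^sup>+z. ennreal (C2 * A) * (ennreal ((norm (U z))\<^sup>2) * ?I z + ennreal ((\<epsilon> + N z) powr - 3) * ?I' z) \<partial>lborel)"
    proof (rule nn_integral_mono)
      fix z
      show "ennreal (C2 * (\<bar>h z\<bar> * (\<epsilon> + N z) powr (-3/2))) \<le> ennreal (C2 * A) * (ennreal ((norm (U z))\<^sup>2) * ?I z + ennreal ((\<epsilon> + N z) powr - 3) * ?I' z)"
      proof (cases "fst z \<in> {\<alpha>..\<beta>}")
        case True
        let ?q = "(\<epsilon> + N z) powr (-3/2)"
        have q2: "?q\<^sup>2 = (\<epsilon> + N z) powr - 3"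
          using \<epsilon> N0[of z] by (simp add: powr_power)
        have "\<bar>h z\<bar> \<le> norm (U z) * A" unfolding h_def abs_mult by (intro mult_mono component_le A) auto
        then have "\<bar>h z\<bar> * ?q \<le> norm (U z) * A * ?q" by (rule mult_right_mono) simp
        also have "\<dots> = A * (norm (U z) * ?q)" by simp
        also have "norm (U z) * ?q \<le> (norm (U z))\<^sup>2 + ?q\<^sup>2"
          using sum_squares_bound[of "norm (U z)" ?q] mult_nonneg_nonneg[OF norm_ge_zero[of "U z"] powr_ge_zero[of "\<epsilon> + N z" "-3/2"]]
          by linarith
        finally have "C2 * (\<bar>h z\<bar> * ?q) \<le> C2 * (A * ((norm (U z))\<^sup>2 + ?q\<^sup>2))"
          using C2(1) A0 by (intro mult_left_mono) (auto intro: mult_left_mono order_trans)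
        then show ?thesis using True \<alpha> C2(1) A0 unfolding q2
          by (simp add: ennreal_mult[symmetric] ennreal_plus[symmetric] ennreal_leI mult.assoc del: ennreal_plus)
      qed (simp add: h0)
    qed
    also have "\<dots> = ennreal (C2 * A) * ((\<integral>\<^sup>+z. ennreal ((norm (U z))\<^sup>2) * ?I z \<partial>lborel) + (\<integral>\<^sup>+z. ennreal ((\<epsilon> + N z) powr - 3) * ?I' z \<partial>lborel))"
      by (subst nn_integral_cmult, measurable) (subst nn_integral_add, measurable)
    also have "\<dots> < \<infinity>"
    proof -
      obtain c where c: "\<And>\<tau>. 0 < \<tau> \<Longrightarrow> (\<integral>\<^sup>+x. ennreal ((\<tau> + (norm (x::real^3))\<^sup>2) powr - 3) \<partial>lborel) \<le> ennreal (c * \<tau> powr (3/2 - 3))"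
        using nn_integral_inverse_power_space[of 3] by auto
      have "(\<integral>\<^sup>+z. ennreal ((\<epsilon> + N z) powr - 3) * ?I' z \<partial>lborel)
        = (\<integral>\<^sup>+t. \<integral>\<^sup>+x. ennreal ((\<epsilon> + (norm (x - y))\<^sup>2) powr - 3) * indicator {\<alpha>..\<beta>} t \<partial>lborel \<partial>lborel)"
        by (subst nn_integral_spacetime, measurable) (simp add: N_def indicator_def)
      also have "\<dots> = (\<integral>\<^sup>+t. (\<integral>\<^sup>+x. ennreal ((\<epsilon> + (norm (x::real^3))\<^sup>2) powr - 3) \<partial>lborel) * indicator {\<alpha>..\<beta>} t \<partial>lborel)"
        by (subst nn_integral_multc, measurable)
          (subst nn_integral_translate_reflect(2)[of "\<lambda>x. ennreal ((\<epsilon> + (norm x)\<^sup>2) powr - 3)" y], auto)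
      also have "\<dots> \<le> (\<integral>\<^sup>+t. ennreal (c * \<epsilon> powr (3/2 - 3)) * indicator {\<alpha>..\<beta>} t \<partial>lborel)"
        by (intro nn_integral_mono mult_right_mono c \<epsilon>) simp
      also have "\<dots> < \<infinity>"
        by (subst nn_integral_cmult_indicator) (auto simp: ennreal_mult_less_top emeasure_lborel_Icc_eq)
      finally have "(\<integral>\<^sup>+z. ennreal ((\<epsilon> + N z) powr - 3) * ?I' z \<partial>lborel) < \<infinity>" .
      with U_L2[of "\<beta> + 1"] show ?thesis by (simp add: ennreal_mult_less_top)
    qed
    finally show ?thesis .
  qed
  have int: "integrable (lborel \<Otimes>\<^sub>M lborel) (\<lambda>(s, z). g s z)"
  proof (rule integrableI_bounded[OF g_meas])
    have "(\<integral>\<^sup>+p. ennreal (norm (case p of (s, z) \<Rightarrow> g s z)) \<partial>(lborel \<Otimes>\<^sub>M lborel))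
      = (\<integral>\<^sup>+z. \<integral>\<^sup>+s. ennreal \<bar>g s z\<bar> \<partial>lborel \<partial>lborel)"
      using g_meas by (subst lborel_pair.nn_integral_snd[symmetric]) auto
    also have "\<dots> \<le> (\<integral>\<^sup>+z. ennreal (C2 * (\<bar>h z\<bar> * (\<epsilon> + N z) powr (-3/2))) \<partial>lborel)"
      by (intro nn_integral_mono inner)
    also note outer
    finally show "(\<integral>\<^sup>+p. ennreal (norm (case p of (s, z) \<Rightarrow> g s z)) \<partial>(lborel \<Otimes>\<^sub>M lborel)) < \<infinity>" .
  qed
  have "(\<integral>s. \<integral>z. g s z \<partial>lborel \<partial>lborel) = (\<integral>z. \<integral>s. g s z \<partial>lborel \<partial>lborel)"
    by (rule lborel_pair.Fubini_integral[OF int, symmetric])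
  also have "\<dots> = (\<integral>z. - (U z $ k * (?a' (fst z) * heat (\<epsilon> + (t0 - fst z)) (snd z - y))) \<partial>lborel)"
  proof (intro Bochner_Integration.integral_cong refl)
    fix z
    have "(\<integral>s. g s z \<partial>lborel) = (\<integral>s. h z * (indicat_real {\<epsilon><..} s * laplace_heat (s + (t0 - fst z)) (snd z - y)) \<partial>lborel)"
      unfolding g_def by (simp only: mult.left_commute)
    also have "\<dots> = h z * (\<integral>s. indicat_real {\<epsilon><..} s * laplace_heat (s + (t0 - fst z)) (snd z - y) \<partial>lborel)"
      by (rule integral_mult_right_zero)
    also have "\<dots> = - (U z $ k * (?a' (fst z) * heat (\<epsilon> + (t0 - fst z)) (snd z - y)))"
    proof (cases "fst z \<in> {\<alpha>..\<beta>}")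
      case True
      then have "0 < \<epsilon> + (t0 - fst z)" using \<tau> \<epsilon> by (simp add: add_pos_pos)
      then show ?thesis by (simp add: laplace_heat_integral h_def)
    qed (use h0[of z] a'0[of "fst z"] in simp)
    finally show "(\<integral>s. g s z \<partial>lborel) = - (U z $ k * (?a' (fst z) * heat (\<epsilon> + (t0 - fst z)) (snd z - y)))" .
  qed
  finally have eq: "\<bar>\<integral>z. U z $ k * (?a' (fst z) * heat (\<epsilon> + (t0 - fst z)) (snd z - y)) \<partial>lborel\<bar> = \<bar>\<integral>s. \<integral>z. g s z \<partial>lborel \<partial>lborel\<bar>"
    by (simp add: Bochner_Integration.integral_minus)
  have "ennreal \<bar>\<integral>s. \<integral>z. g s z \<partial>lborel \<partial>lborel\<bar> \<le> (\<integral>\<^sup>+s. ennreal \<bar>\<integral>z. g s z \<partial>lborel\<bar> \<partial>lborel)"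
    using integral_norm_bound_ennreal[OF lborel_pair.integrable_fst[OF int]] by simp
  also have "\<dots> \<le> (\<integral>\<^sup>+s. ennreal (18 * heat3_const) * (\<integral>\<^sup>+z. ennreal ((norm (U z))\<^sup>2 * \<bar>a (fst z)\<bar>
      * (indicat_real {\<epsilon><..} s * kern 3 (s + (t0 - fst z), snd z - y))) \<partial>lborel) \<partial>lborel)"
  proof (rule nn_integral_mono)
    fix s
    show "ennreal \<bar>\<integral>z. g s z \<partial>lborel\<bar> \<le> ennreal (18 * heat3_const) * (\<integral>\<^sup>+z. ennreal ((norm (U z))\<^sup>2 * \<bar>a (fst z)\<bar>
      * (indicat_real {\<epsilon><..} s * kern 3 (s + (t0 - fst z), snd z - y))) \<partial>lborel)"
    proof (cases "\<epsilon> < s")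
      case True
      then have s: "0 < s" using \<epsilon> by simp
      have "(\<lambda>z. g s z) = (\<lambda>z. U z $ k * (?a' (fst z) * laplace_heat (s + (t0 - fst z)) (snd z - y)))"
        using True by (simp add: g_def h_def mult.assoc)
      then show ?thesis using heat_identity_bound[OF a \<alpha> \<beta> s, of k y] True by simp
    next
      case False
      then have "(\<lambda>z. g s z) = (\<lambda>z. 0)" by (simp add: g_def)
      then show ?thesis by simp
    qed
  qed
  also have "\<dots> = ennreal (18 * heat3_const) * (\<integral>\<^sup>+s. \<integral>\<^sup>+z. ennreal ((norm (U z))\<^sup>2 * \<bar>a (fst z)\<bar>
      * (indicat_real {\<epsilon><..} s * kern 3 (s + (t0 - fst z), snd z - y))) \<partial>lborel \<partial>lborel)"
    by (rule nn_integral_cmult) measurable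
  also have "(\<integral>\<^sup>+s. \<integral>\<^sup>+z. ennreal ((norm (U z))\<^sup>2 * \<bar>a (fst z)\<bar>
      * (indicat_real {\<epsilon><..} s * kern 3 (s + (t0 - fst z), snd z - y))) \<partial>lborel \<partial>lborel)
    = (\<integral>\<^sup>+z. \<integral>\<^sup>+s. ennreal ((norm (U z))\<^sup>2 * \<bar>a (fst z)\<bar>
      * (indicat_real {\<epsilon><..} s * kern 3 (s + (t0 - fst z), snd z - y))) \<partial>lborel \<partial>lborel)"
    by (rule lborel_pair.Fubini'[symmetric]) measurable
  also have "\<dots> \<le> (\<integral>\<^sup>+z. ennreal (1/2) * ennreal ((norm (U z))\<^sup>2 * \<bar>a (fst z)\<bar> * kern 2 (t0 - fst z, snd z - y)) \<partial>lborel)"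
  proof (rule nn_integral_mono)
    fix z
    let ?b = "(norm (U z))\<^sup>2 * \<bar>a (fst z)\<bar>"
    show "(\<integral>\<^sup>+s. ennreal (?b * (indicat_real {\<epsilon><..} s * kern 3 (s + (t0 - fst z), snd z - y))) \<partial>lborel)
      \<le> ennreal (1/2) * ennreal (?b * kern 2 (t0 - fst z, snd z - y))"
    proof (cases "fst z \<in> {\<alpha>..\<beta>}")
      case True
      let ?m = "t0 - fst z + N z"
      have m: "0 < \<epsilon> + ?m" using \<tau>[OF True] \<epsilon> N0[of z] by linarith
      have "(\<integral>\<^sup>+s. ennreal (?b * (indicat_real {\<epsilon><..} s * kern 3 (s + (t0 - fst z), snd z - y))) \<partial>lborel)
         = (\<integral>\<^sup>+s. ennreal ?b * ennreal (indicat_real {\<epsilon><..} s * (s + ?m) powr - 3) \<partial>lborel)"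
      proof (rule nn_integral_cong)
        fix s
        show "ennreal (?b * (indicat_real {\<epsilon><..} s * kern 3 (s + (t0 - fst z), snd z - y))) = ennreal ?b * ennreal (indicat_real {\<epsilon><..} s * (s + ?m) powr - 3)"
          using \<epsilon> \<tau>[OF True] by (cases "\<epsilon> < s") (auto simp: kern_def N_def ennreal_mult[symmetric] add.assoc)
      qed
      also have "\<dots> = ennreal ?b * ennreal ((\<epsilon> + ?m) powr (1 - 3) / (3 - 1))"
        by (subst nn_integral_cmult, measurable) (subst powr_tail_integral[OF _ m], auto)
      also have "\<dots> = ennreal (1/2 * (?b * (\<epsilon> + ?m) powr - 2))"
        by (subst ennreal_mult[symmetric]) auto
      also have "\<dots> = ennreal (1/2) * ennreal (?b * (\<epsilon> + ?m) powr - 2)"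
        by (rule ennreal_mult) auto
      also have "\<dots> \<le> ennreal (1/2) * ennreal (?b * kern 2 (t0 - fst z, snd z - y))"
      proof (intro mult_left_mono ennreal_leI)
        show "(\<epsilon> + ?m) powr - 2 \<le> kern 2 (t0 - fst z, snd z - y)"
          using powr_mono_base[of ?m "\<epsilon> + ?m" 2] \<epsilon> \<tau>[OF True] N0[of z]
          by (simp add: kern_def N_def add_pos_nonneg)
      qed auto
      finally show ?thesis .
    qed (simp add: a)
  qed
  also have "\<dots> = ennreal (1/2) * (\<integral>\<^sup>+z. ennreal ((norm (U z))\<^sup>2 * \<bar>a (fst z)\<bar> * kern 2 (t0 - fst z, snd z - y)) \<partial>lborel)"
    by (rule nn_integral_cmult) measurable
  finally have "ennreal \<bar>\<integral>s. \<integral>z. g s z \<partial>lborel \<partial>lborel\<bar>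
    \<le> ennreal (18 * heat3_const) * (ennreal (1/2) * (\<integral>\<^sup>+z. ennreal ((norm (U z))\<^sup>2 * \<bar>a (fst z)\<bar> * kern 2 (t0 - fst z, snd z - y)) \<partial>lborel))"
    by (simp add: mult_left_mono)
  also have "\<dots> = ennreal (9 * heat3_const) * (\<integral>\<^sup>+z. ennreal ((norm (U z))\<^sup>2 * \<bar>a (fst z)\<bar> * kern 2 (t0 - fst z, snd z - y)) \<partial>lborel)"
  proof -
    have "ennreal (18 * heat3_const) * ennreal (1/2) = ennreal (9 * heat3_const)"
      using C3(1) by (subst ennreal_mult[symmetric]) auto
    then show ?thesis by (simp only: mult.assoc[symmetric])
  qed
  finally show ?thesis unfolding eq .
qed

end

section \<open>Approximate identity in space and time\<close>

abbreviation step' :: "real \<Rightarrow> real" where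
  "step' \<equiv> pderiv_dir 1 smooth_step"

lemma smooth_step': "smooth step'"
  by (intro smooth_pderiv_dir smooth_smooth_step) auto

lemma step'_measurable [measurable]: "step' \<in> borel_measurable borel"
  by (rule smooth_borel[OF smooth_step'])

lemma step'_eq_0: "s \<notin> {1/4..1/2} \<Longrightarrow> step' s = 0"
proof -
  assume "s \<notin> {1/4..1/2}"
  then consider "s < 1/4" | "1/2 < s" by fastforce
  then show ?thesis
  proof cases
    case 1
    have "step' s = pderiv_dir 1 (\<lambda>_. 0) s"
      by (rule pderiv_dir_cong_open[of "{..<1/4}"]) (use 1 smooth_step_eq_0 in auto)
    then show ?thesis by (simp add: pderiv_dir_const)
  next
    case 2
    have "step' s = pderiv_dir 1 (\<lambda>_. 1) s"
      by (rule pderiv_dir_cong_open[of "{1/2<..}"]) (use 2 smooth_step_eq_1 in auto)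
    then show ?thesis by (simp add: pderiv_dir_const)
  qed
qed

lemma step'_bounded: "\<exists>E>0. \<forall>s. \<bar>step' s\<bar> \<le> E"
proof -
  have "\<exists>C. \<forall>x. \<bar>pderivs [] step' x\<bar> \<le> C"
    by (rule bounded_pderivs_compact_support[OF smooth_step' compact_Icc[of "1/4" "1/2"] step'_eq_0]) auto
  then obtain C where "\<And>x. \<bar>step' x\<bar> \<le> C" by auto
  then have "\<bar>step' x\<bar> \<le> max C 1" for x by (simp add: max.coboundedI1)
  then show ?thesis by (intro exI[of _ "max C 1"]) auto
qed

definition step_const :: real where
  "step_const = (SOME E. 0 < E \<and> (\<forall>s. \<bar>step' s\<bar> \<le> E))"

lemma step_const: "0 < step_const" "\<bar>step' s\<bar> \<le> step_const"
proof -
  have "0 < step_const \<and> (\<forall>s. \<bar>step' s\<bar> \<le> step_const)"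
    unfolding step_const_def by (rule someI_ex) (rule step'_bounded)
  then show "0 < step_const" "\<bar>step' s\<bar> \<le> step_const" by blast+
qed

lemma step'_integral: "(\<integral>s. step' s \<partial>lborel) = 1"
proof -
  have "has_bochner_integral lborel (\<lambda>s. step' s * indicator {1/4..1/2} s) (smooth_step (1/2) - smooth_step (1/4))"
  proof (rule has_bochner_integral_FTC_Icc_real)
    show "DERIV smooth_step s :> step' s" for s
      by (rule has_real_derivative_pderiv_dir[OF smooth_smooth_step])
    show "isCont step' s" for s
      by (intro differentiable_imp_continuous_within smooth_differentiable smooth_step')
  qed simp
  moreover have "(\<lambda>s. step' s * indicator {1/4..1/2} s) = step'"
  proof
    show "step' s * indicator {1/4..1/2} s = step' s" for s
      using step'_eq_0[of s] by (cases "s \<in> {1/4..1/2}") simp_all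
  qed
  ultimately show ?thesis by (simp add: has_bochner_integral_integral_eq smooth_step_eq_0 smooth_step_eq_1)
qed

text \<open>The Gaussian supplies two powers of the parabolic ratio, and for ages between
  \<open>\<epsilon>\<close> and \<open>S\<close> this ratio is at most a constant times the
  reciprocal of \<open>1 + (norm x)\<^sup>2\<close>.\<close>

lemma heat_decay:
  assumes \<epsilon>: "0 < \<epsilon>"
  shows "\<exists>K\<ge>0. \<forall>s x. \<epsilon> \<le> s \<and> s \<le> S \<longrightarrow> heat s x \<le> K * inverse ((1 + (norm x)\<^sup>2)\<^sup>2)"
proof -
  obtain C where C: "0 \<le> C" "\<And>s x. 0 < s \<Longrightarrow> exp (- ((norm (x::real^3))\<^sup>2 / (4 * s))) \<le> C * (s / (s + (norm x)\<^sup>2)) ^ 2"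
    using gaussian_ratio_bound[of 2] by blast
  let ?m = "min \<epsilon> 1"
  have m: "0 < ?m" using \<epsilon> by simp
  have "heat s x \<le> (\<epsilon> powr (-3/2) * (C * (S / ?m)\<^sup>2)) * inverse ((1 + (norm x)\<^sup>2)\<^sup>2)" if s: "\<epsilon> \<le> s" "s \<le> S" for s x
  proof -
    let ?N = "(norm x)\<^sup>2"
    have s0: "0 < s" using s \<epsilon> by simp
    have N1: "0 < 1 + ?N" by (simp add: add_pos_nonneg)
    have "?m * (1 + ?N) \<le> s + ?N"
    proof -
      have "?m * ?N \<le> ?N" using \<epsilon> by (intro mult_left_le_one_le) auto
      moreover have "?m \<le> s" using s by simp
      ultimately show ?thesis by (simp only: distrib_left mult_1_right)
    qed
    then have "s / (s + ?N) \<le> S / (?m * (1 + ?N))"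
      using s s0 m N1 by (intro frac_le) auto
    also have "\<dots> = S / ?m * inverse (1 + ?N)" by (simp add: divide_inverse)
    finally have r: "s / (s + ?N) \<le> S / ?m * inverse (1 + ?N)" .
    have "heat s x \<le> s powr (-3/2) * (C * (s / (s + ?N)) ^ 2)"
      unfolding heat_eq[OF s0] by (intro mult_left_mono C s0) simp
    also have "\<dots> \<le> \<epsilon> powr (-3/2) * (C * (S / ?m * inverse (1 + ?N)) ^ 2)"
      using s s0 \<epsilon> C(1) powr_mono_base[of \<epsilon> s "3/2"]
      by (intro mult_mono mult_left_mono power_mono r) auto
    also have "\<dots> = (\<epsilon> powr (-3/2) * (C * (S / ?m)\<^sup>2)) * inverse ((1 + ?N)\<^sup>2)"
      by (simp only: power_mult_distrib power_inverse mult.assoc)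
    finally show ?thesis .
  qed
  moreover have "0 \<le> \<epsilon> powr (-3/2) * (C * (S / ?m)\<^sup>2)" using C(1) by simp
  ultimately show ?thesis by blast
qed

text \<open>Arises when the derivative falls on the time cutoff \<open>smooth_step ((t0 - t) / \<epsilon>)\<close>; it is a parabolic
  approximate identity as \<open>\<epsilon>\<close> tends to 0.\<close>

definition time_kernel :: "real \<Rightarrow> real \<times> (real^3) \<Rightarrow> real" where
  "time_kernel \<epsilon> h = inverse \<epsilon> * step' (fst h * inverse \<epsilon>) * heat (\<epsilon> + fst h) (snd h)"

lemma time_kernel_measurable [measurable]: "time_kernel \<epsilon> \<in> borel_measurable borel"
  unfolding time_kernel_def[abs_def] by measurable

lemma time_kernel_decay:
  assumes \<epsilon>: "0 < \<epsilon>"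
  shows "\<exists>K\<ge>0. \<forall>h. \<bar>time_kernel \<epsilon> h\<bar> \<le> K * decay (\<epsilon>/4) (\<epsilon>/2) h"
proof -
  obtain K where K: "0 \<le> K" "\<And>s x. \<epsilon> \<le> s \<Longrightarrow> s \<le> 2 * \<epsilon> \<Longrightarrow> heat s x \<le> K * inverse ((1 + (norm x)\<^sup>2)\<^sup>2)"
    using heat_decay[OF \<epsilon>, of "2 * \<epsilon>"] by blast
  obtain E where E: "0 < E" "\<And>s. \<bar>step' s\<bar> \<le> E" using step'_bounded by blast
  have "\<bar>time_kernel \<epsilon> h\<bar> \<le> (inverse \<epsilon> * E * K) * decay (\<epsilon>/4) (\<epsilon>/2) h" for h
  proof (cases "fst h \<in> {\<epsilon>/4..\<epsilon>/2}")
    case True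
    then have "\<epsilon> \<le> \<epsilon> + fst h" "\<epsilon> + fst h \<le> 2 * \<epsilon>" using \<epsilon> by auto
    note Kh = K(2)[OF this, of "snd h"]
    have "\<bar>time_kernel \<epsilon> h\<bar> = inverse \<epsilon> * \<bar>step' (fst h * inverse \<epsilon>)\<bar> * heat (\<epsilon> + fst h) (snd h)"
      using \<epsilon> heat_pos[of "\<epsilon> + fst h" "snd h"] by (simp add: time_kernel_def abs_mult)
    also have "\<dots> \<le> inverse \<epsilon> * E * (K * inverse ((1 + (norm (snd h))\<^sup>2)\<^sup>2))"
      using \<epsilon> E heat_pos[of "\<epsilon> + fst h" "snd h"] by (intro mult_mono Kh mult_left_mono) auto
    finally show ?thesis using True by (simp add: decay_def)
  next
    case False
    then have "fst h * inverse \<epsilon> \<notin> {1/4..1/2}" using \<epsilon> by (auto simp: field_simps)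
    then have "step' (fst h * inverse \<epsilon>) = 0" by (rule step'_eq_0)
    then have "time_kernel \<epsilon> h = 0" unfolding time_kernel_def by simp
    then show ?thesis using \<epsilon> E K(1) decay_nonneg[of "\<epsilon>/4" "\<epsilon>/2" h] by simp
  qed
  then show ?thesis using \<epsilon> E K(1) by (intro exI[of _ "inverse \<epsilon> * E * K"]) auto
qed

lemma time_kernel_integrable:
  assumes "0 < \<epsilon>" shows "integrable lborel (time_kernel \<epsilon>)"
proof -
  obtain K where K: "0 \<le> K" "\<And>h. \<bar>time_kernel \<epsilon> h\<bar> \<le> K * decay (\<epsilon>/4) (\<epsilon>/2) h"
    using time_kernel_decay[OF assms] by blast
  have "integrable lborel (\<lambda>h::real \<times> (real^3). K * decay (\<epsilon>/4) (\<epsilon>/2) h)"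
    using nn_integral_decay by (intro integrable_mult_right integrableI_nonneg) (auto simp: decay_nonneg)
  then show ?thesis
    by (rule Bochner_Integration.integrable_bound) (use K in \<open>auto intro!: AE_I2 order_trans[OF K(2)]\<close>)
qed

section \<open>Parabolic dilation and the mass of the kernel\<close>

lemma integral_scale:
  fixes f :: "'a::euclidean_space \<Rightarrow> real"
  assumes [measurable]: "f \<in> borel_measurable borel" and c: "0 < c"
  shows "(\<integral>x. f x \<partial>lborel) = c ^ DIM('a) * (\<integral>x. f (c *\<^sub>R x) \<partial>lborel)"
  using c by (subst lborel_affine[of c 0]) (simp_all add: integral_density integral_distr)

lemma integral_parabolic_scale:
  fixes f :: "real \<times> (real^3) \<Rightarrow> real"
  assumes [measurable]: "f \<in> borel_measurable borel" and \<epsilon>: "0 < \<epsilon>"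
  shows "(\<integral>z. f z \<partial>lborel) = \<epsilon> * sqrt \<epsilon> ^ 3 * (\<integral>z. f (\<epsilon> * fst z, sqrt \<epsilon> *\<^sub>R snd z) \<partial>lborel)"
proof -
  define c where "c j = (if j = e_time then \<epsilon> else sqrt \<epsilon>)" for j :: "real \<times> (real^3)"
  define T where "T x = 0 + (\<Sum>j\<in>Basis. (c j * (x \<bullet> j)) *\<^sub>R j)" for x :: "real \<times> (real^3)"
  have c0: "c j \<noteq> 0" for j using \<epsilon> by (simp add: c_def)
  have cs: "c (0, v) = sqrt \<epsilon>" for v by (simp add: c_def zero_prod_def)
  have B: "(Basis::(real \<times> (real^3)) set) = insert e_time ((\<lambda>v. (0, v)) ` Basis)"
    by (auto simp: Basis_prod_def)
  have nB: "e_time \<notin> (\<lambda>v. (0, v)) ` (Basis :: (real^3) set)" by auto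
  have inj: "inj_on (\<lambda>v. (0::real, v)) (Basis :: (real^3) set)" by (auto intro: inj_onI)
  have T: "T x = (\<epsilon> * fst x, sqrt \<epsilon> *\<^sub>R snd x)" for x
  proof (rule euclidean_eqI)
    fix b :: "real \<times> (real^3)" assume b: "b \<in> Basis"
    have "T x \<bullet> b = c b * (x \<bullet> b)"
      using b by (simp add: T_def)
    also have "\<dots> = (\<epsilon> * fst x, sqrt \<epsilon> *\<^sub>R snd x) \<bullet> b"
      using b unfolding B by (auto simp: cs) (simp_all add: c_def inner_prod_def)
    finally show "T x \<bullet> b = (\<epsilon> * fst x, sqrt \<epsilon> *\<^sub>R snd x) \<bullet> b" .
  qed
  have [measurable]: "T \<in> borel_measurable borel" unfolding T_def[abs_def] by measurable
  have P: "(\<Prod>j\<in>Basis. \<bar>c j\<bar>) = \<epsilon> * sqrt \<epsilon> ^ 3"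
    unfolding B using \<epsilon> nB
    by (simp add: prod.reindex[OF inj] cs) (simp add: c_def)
  have "lborel = density (distr lborel borel T) (\<lambda>_. (\<Prod>j\<in>Basis. \<bar>c j\<bar>))"
    unfolding T_def using c0 by (rule lborel_affine_euclidean)
  then have "(\<integral>z. f z \<partial>lborel) = (\<integral>z. f z \<partial>density (distr lborel borel T) (\<lambda>_. (\<Prod>j\<in>Basis. \<bar>c j\<bar>)))" by simp
  also have "\<dots> = \<epsilon> * sqrt \<epsilon> ^ 3 * (\<integral>z. f (T z) \<partial>lborel)"
    unfolding P using \<epsilon> by (simp add: integral_density integral_distr)
  finally show ?thesis unfolding T .
qed

lemma heat_scale: "0 < \<epsilon> \<Longrightarrow> 0 < s \<Longrightarrow> heat (\<epsilon> * s) (sqrt \<epsilon> *\<^sub>R x) * (sqrt \<epsilon> ^ 3) = heat s x"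
proof -
  assume \<epsilon>: "0 < \<epsilon>" and s: "0 < s"
  have "sqrt \<epsilon> ^ 3 = exp (3/2 * ln \<epsilon>)"
  proof -
    have "sqrt \<epsilon> ^ 3 = exp (ln (sqrt \<epsilon> ^ 3))" using \<epsilon> by simp
    also have "ln (sqrt \<epsilon> ^ 3) = 3/2 * ln \<epsilon>" using \<epsilon> by (simp add: ln_realpow ln_sqrt)
    finally show ?thesis .
  qed
  moreover have "(norm (sqrt \<epsilon> *\<^sub>R x))\<^sup>2 / (4 * (\<epsilon> * s)) = (norm x)\<^sup>2 / (4 * s)"
    using \<epsilon> by (simp add: power_mult_distrib)
  moreover have "exp (- (3/2) * ln (\<epsilon> * s)) * exp (3/2 * ln \<epsilon>) = exp (- (3/2) * ln s)"
    using \<epsilon> s by (simp add: ln_mult exp_add[symmetric] algebra_simps)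
  ultimately show ?thesis unfolding heat_def by (simp add: mult.assoc mult.left_commute mult.commute)
qed

text \<open>Its value is (4 pi)^(3/2), the normalisation omitted from the kernel. The argument
  relies on its positivity and on the mass being the same for every age.\<close>

definition heat_mass :: real where "heat_mass = (\<integral>x. heat 1 x \<partial>lborel)"

lemma heat_integrable: "0 < s \<Longrightarrow> integrable lborel (heat s)"
proof -
  assume s: "0 < s"
  obtain K where K: "0 \<le> K" "\<And>x. heat s x \<le> K * inverse ((1 + (norm x)\<^sup>2)\<^sup>2)"
    using heat_decay[OF s, of s] by blast
  obtain c where c: "(\<integral>\<^sup>+x. ennreal ((1 + (norm (x::real^3))\<^sup>2) powr - 2) \<partial>lborel) \<le> ennreal (c * 1 powr (3/2 - 2))"
  proof -
    have "3/2 < (2::real)" by simp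
    from nn_integral_inverse_power_space[OF this] show ?thesis using that zero_less_one by blast
  qed
  show ?thesis
  proof (rule integrableI_nonneg)
    have "(\<integral>\<^sup>+x. ennreal (heat s x) \<partial>lborel) \<le> (\<integral>\<^sup>+x. ennreal K * ennreal ((1 + (norm (x::real^3))\<^sup>2) powr - 2) \<partial>lborel)"
    proof (rule nn_integral_mono)
      fix x :: "real^3"
      have "0 < 1 + (norm x)\<^sup>2" by (simp add: add_pos_nonneg)
      then have "inverse ((1 + (norm x)\<^sup>2)\<^sup>2) = (1 + (norm x)\<^sup>2) powr - 2" by (simp add: powr_minus)
      then show "ennreal (heat s x) \<le> ennreal K * ennreal ((1 + (norm x)\<^sup>2) powr - 2)"
        using K(2)[of x] K(1) by (simp add: ennreal_mult[symmetric] ennreal_leI)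
    qed
    also have "\<dots> < \<infinity>"
      using c by (subst nn_integral_cmult) (auto simp: ennreal_mult_less_top le_less_trans)
    finally show "(\<integral>\<^sup>+x. ennreal (heat s x) \<partial>lborel) < \<infinity>" .
  qed (auto simp: heat_pos less_imp_le)
qed

lemma heat_integral: "0 < s \<Longrightarrow> (\<integral>x. heat s x \<partial>lborel) = heat_mass"
proof -
  assume s: "0 < s"
  have "(\<integral>x. heat s x \<partial>lborel) = sqrt s ^ 3 * (\<integral>x. heat s (sqrt s *\<^sub>R x) \<partial>lborel)"
    using integral_scale[of "heat s" "sqrt s"] s by simp
  also have "\<dots> = (\<integral>x. heat (s * 1) (sqrt s *\<^sub>R x) * sqrt s ^ 3 \<partial>lborel)" by simp
  also have "\<dots> = heat_mass" unfolding heat_mass_def by (simp only: heat_scale[OF s zero_less_one])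
  finally show ?thesis .
qed

lemma heat_mass_pos: "0 < heat_mass"
proof -
  have "heat_mass \<noteq> 0"
  proof
    assume "heat_mass = 0"
    then have "AE x in lborel. heat 1 x = 0"
      unfolding heat_mass_def
      by (subst (asm) integral_nonneg_eq_0_iff_AE[OF heat_integrable]) (auto simp: heat_pos less_imp_le)
    then have "AE x in (lborel :: (real^3) measure). False"
      by eventually_elim (use heat_pos[of 1] in \<open>simp add: less_le\<close>)
    then have "ae_filter (lborel :: (real^3) measure) = bot" by (simp only: eventually_False)
    then show False unfolding ae_filter_eq_bot_iff by (simp add: emeasure_lborel_UNIV)
  qed
  moreover have "0 \<le> heat_mass" unfolding heat_mass_def
    by (intro Bochner_Integration.integral_nonneg) (simp add: heat_pos less_imp_le)
  ultimately show ?thesis by simp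
qed

lemma time_kernel_integral: "(\<integral>h. time_kernel 1 h \<partial>lborel) = heat_mass"
proof -
  have i: "integrable (lborel \<Otimes>\<^sub>M lborel) (time_kernel 1)"
    using time_kernel_integrable[of 1] by (simp add: lborel_prod)
  have "(\<integral>h. time_kernel 1 h \<partial>lborel) = (\<integral>t. \<integral>x. time_kernel 1 (t, x) \<partial>lborel \<partial>lborel)"
    using lborel_pair.integral_fst'[OF i] by (simp add: lborel_prod)
  also have "\<dots> = (\<integral>t. heat_mass * step' t \<partial>lborel)"
  proof (intro Bochner_Integration.integral_cong refl)
    fix t
    show "(\<integral>x. time_kernel 1 (t, x) \<partial>lborel) = heat_mass * step' t"
    proof (cases "t \<in> {1/4..1/2}")
      case True
      then show ?thesis by (simp add: time_kernel_def heat_integral)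
    qed (simp add: time_kernel_def step'_eq_0)
  qed
  also have "\<dots> = heat_mass" by (simp add: step'_integral)
  finally show ?thesis .
qed

text \<open>Under the parabolic dilation by \<open>\<epsilon>\<close> all these kernels are rescaled
  copies of one integrable function; this is what makes them an approximate identity of total mass
  \<open>heat_mass\<close>.\<close>

lemma time_kernel_scale:
  assumes \<epsilon>: "0 < \<epsilon>"
  shows "\<epsilon> * sqrt \<epsilon> ^ 3 * time_kernel \<epsilon> (\<epsilon> * fst z, sqrt \<epsilon> *\<^sub>R snd z) = time_kernel 1 z"
proof (cases "fst z \<in> {1/4..1/2}")
  case True
  then have "0 < 1 + fst z" by simp
  note hs = heat_scale[OF \<epsilon> this, of "snd z"]
  have i: "\<epsilon> * fst z * inverse \<epsilon> = fst z" "\<epsilon> + \<epsilon> * fst z = \<epsilon> * (1 + fst z)"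
    using \<epsilon> by (simp_all add: distrib_left)
  have "\<epsilon> * sqrt \<epsilon> ^ 3 * time_kernel \<epsilon> (\<epsilon> * fst z, sqrt \<epsilon> *\<^sub>R snd z)
    = (\<epsilon> * inverse \<epsilon>) * step' (fst z) * (heat (\<epsilon> * (1 + fst z)) (sqrt \<epsilon> *\<^sub>R snd z) * sqrt \<epsilon> ^ 3)"
    unfolding time_kernel_def fst_conv snd_conv i by simp
  also have "\<dots> = time_kernel 1 z" unfolding hs using \<epsilon> by (simp add: time_kernel_def)
  finally show ?thesis .
next
  case False
  have "\<epsilon> * fst z * inverse \<epsilon> = fst z" using \<epsilon> by simp
  then show ?thesis using step'_eq_0[OF False] by (simp only: time_kernel_def fst_conv snd_conv) simp
qed

text \<open>Convergence is stated after integration over a box. The integral over the box of a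
  translate of \<open>f\<close> is a bounded function of the translation and continuous at 0, so
  Fubini and the parabolic dilation reduce the claim to dominated convergence. Pointwise information
  is recovered later by differentiation of integrals.\<close>

lemma time_kernel_approximation:
  fixes f :: "real \<times> (real^3) \<Rightarrow> real" and p q :: "real \<times> (real^3)"
  assumes [measurable]: "f \<in> borel_measurable borel" and f2: "integrable lborel (\<lambda>z. (f z)\<^sup>2)"
  defines "Q \<equiv> cbox p q" and "\<epsilon> \<equiv> \<lambda>n. 1 / real (Suc n)"
  shows "integrable lborel (\<lambda>z0. indicat_real Q z0 * (\<integral>z. f z * time_kernel (\<epsilon> n) (z0 - z) \<partial>lborel))" (is ?I)
    and "(\<lambda>n. \<integral>z0. indicat_real Q z0 * (\<integral>z. f z * time_kernel (\<epsilon> n) (z0 - z) \<partial>lborel) \<partial>lborel)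
      \<longlonglongrightarrow> heat_mass * (\<integral>z. indicat_real Q z * f z \<partial>lborel)" (is ?L)
proof -
  have \<epsilon>: "0 < \<epsilon> n" for n by (simp add: \<epsilon>_def)
  have [measurable]: "Q \<in> sets borel" unfolding Q_def by simp
  have Qint: "integrable lborel (indicat_real Q)"
    unfolding Q_def by (intro integrable_real_indicator) (use emeasure_bounded_finite[OF bounded_cbox[of p q]] in auto)
  define G where "G h = (\<integral>z0. indicat_real Q z0 * f (z0 - h) \<partial>lborel)" for h
  define M where "M = (\<integral>z. (f z)\<^sup>2 \<partial>lborel) + (\<integral>z. indicat_real Q z \<partial>lborel)"
  \<comment> \<open>Used in place of Cauchy-Schwarz: a square integrable function restricted to a
    set of finite measure is dominated by its square plus the indicator of the set.\<close>
  have young: "\<bar>indicat_real A z * c\<bar> \<le> c\<^sup>2 + indicat_real A z" for A :: "(real \<times> (real^3)) set" and z c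
  proof -
    have "\<bar>c\<bar> \<le> \<bar>c\<bar>\<^sup>2 + 1" using sum_squares_bound[of "\<bar>c\<bar>" 1] by (simp add: power2_abs) 
    then show ?thesis by (simp add: indicator_def)
  qed
  have tr: "integrable lborel (\<lambda>z0. (f (z0 - h))\<^sup>2)" "(\<integral>z0. (f (z0 - h))\<^sup>2 \<partial>lborel) = (\<integral>z. (f z)\<^sup>2 \<partial>lborel)" for h
  proof -
    have d: "(lborel :: (real \<times> (real^3)) measure) = distr lborel borel (\<lambda>x. - h + x)"
      by (rule lborel_distr_plus[of "- h", symmetric])
    show "integrable lborel (\<lambda>z0. (f (z0 - h))\<^sup>2)"
      using f2 by (subst (asm) d) (simp add: integrable_distr_eq)
    show "(\<integral>z0. (f (z0 - h))\<^sup>2 \<partial>lborel) = (\<integral>z. (f z)\<^sup>2 \<partial>lborel)"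
      by (subst (2) d) (simp add: integral_distr)
  qed
  have Gint: "integrable lborel (\<lambda>z0. indicat_real Q z0 * f (z0 - h))" for h
    by (rule Bochner_Integration.integrable_bound[OF Bochner_Integration.integrable_add[OF tr(1)[of h] Qint]])
       (auto intro!: AE_I2 order_trans[OF young])
  have absG: "(\<integral>z0. \<bar>indicat_real Q z0 * f (z0 - h)\<bar> \<partial>lborel) \<le> M" for h
  proof -
    have "(\<integral>z0. \<bar>indicat_real Q z0 * f (z0 - h)\<bar> \<partial>lborel) \<le> (\<integral>z0. (f (z0 - h))\<^sup>2 + indicat_real Q z0 \<partial>lborel)"
      by (intro integral_mono Bochner_Integration.integrable_add tr Qint integrable_abs Gint young)
    also have "\<dots> = M" unfolding M_def tr(2)[of h, symmetric] by (intro Bochner_Integration.integral_add tr Qint)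
    finally show ?thesis .
  qed
  have Gb: "\<bar>G h\<bar> \<le> M" for h
    unfolding G_def using order_trans[OF integral_abs_bound absG] .
  have M0: "0 \<le> M" by (rule order_trans[OF abs_ge_zero Gb])
  have [measurable]: "G \<in> borel_measurable borel" unfolding G_def[abs_def] by measurable
  have conv: "(\<integral>z. f z * time_kernel (\<epsilon> n) (z0 - z) \<partial>lborel) = (\<integral>h. f (z0 - h) * time_kernel (\<epsilon> n) h \<partial>lborel)" for n z0
  proof -
    have d: "(lborel :: (real \<times> (real^3)) measure) = distr lborel borel (\<lambda>x. z0 - x)"
      using lborel_affine[of "-1" z0] by (simp add: density_1)
    show ?thesis
      by (subst d) (simp add: integral_distr)
  qed
  have int2: "integrable (lborel \<Otimes>\<^sub>M lborel) (\<lambda>(h, z0). indicat_real Q z0 * f (z0 - h) * time_kernel (\<epsilon> n) h)" for n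
  proof (rule lborel_pair.Fubini_integrable)
    show "(\<lambda>(h, z0). indicat_real Q z0 * f (z0 - h) * time_kernel (\<epsilon> n) h) \<in> borel_measurable (lborel \<Otimes>\<^sub>M lborel)"
      by measurable
    show "AE h in lborel. integrable lborel (\<lambda>z0. case (h, z0) of (h, z0) \<Rightarrow> indicat_real Q z0 * f (z0 - h) * time_kernel (\<epsilon> n) h)"
      by (intro AE_I2) (simp add: Gint)
    have "integrable lborel (\<lambda>h. M * \<bar>time_kernel (\<epsilon> n) h\<bar>)"
      by (intro integrable_mult_right integrable_abs time_kernel_integrable \<epsilon>)
    then show "integrable lborel (\<lambda>h. \<integral>z0. norm (case (h, z0) of (h, z0) \<Rightarrow> indicat_real Q z0 * f (z0 - h) * time_kernel (\<epsilon> n) h) \<partial>lborel)"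
    proof (rule Bochner_Integration.integrable_bound)
      have "\<bar>\<integral>z0. \<bar>indicat_real Q z0 * f (z0 - h)\<bar> * \<bar>time_kernel (\<epsilon> n) h\<bar> \<partial>lborel\<bar> \<le> M * \<bar>time_kernel (\<epsilon> n) h\<bar>" for h
        using absG[of h] by (simp add: abs_mult mult_right_mono)
      then show "AE h in lborel. norm (\<integral>z0. norm (case (h, z0) of (h, z0) \<Rightarrow> indicat_real Q z0 * f (z0 - h) * time_kernel (\<epsilon> n) h) \<partial>lborel)
         \<le> norm (M * \<bar>time_kernel (\<epsilon> n) h\<bar>)"
        using M0 by (intro AE_I2) (simp add: abs_mult)
    qed measurable
  qed
  have eq1: "indicat_real Q z0 * (\<integral>z. f z * time_kernel (\<epsilon> n) (z0 - z) \<partial>lborel)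
      = (\<integral>h. indicat_real Q z0 * f (z0 - h) * time_kernel (\<epsilon> n) h \<partial>lborel)" for n z0
    unfolding conv by (simp add: mult.assoc)
  show ?I
    unfolding eq1 using lborel_pair.integrable_snd[OF int2[of n]] by simp
  have "(\<integral>z0. indicat_real Q z0 * (\<integral>z. f z * time_kernel (\<epsilon> n) (z0 - z) \<partial>lborel) \<partial>lborel)
      = (\<integral>k. G (\<epsilon> n * fst k, sqrt (\<epsilon> n) *\<^sub>R snd k) * time_kernel 1 k \<partial>lborel)" for n
  proof -
    have "(\<integral>z0. indicat_real Q z0 * (\<integral>z. f z * time_kernel (\<epsilon> n) (z0 - z) \<partial>lborel) \<partial>lborel)
      = (\<integral>h. \<integral>z0. indicat_real Q z0 * f (z0 - h) * time_kernel (\<epsilon> n) h \<partial>lborel \<partial>lborel)"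
      unfolding eq1 by (rule lborel_pair.Fubini_integral[OF int2])
    also have "\<dots> = (\<integral>h. G h * time_kernel (\<epsilon> n) h \<partial>lborel)"
      unfolding G_def by simp
    also have "\<dots> = \<epsilon> n * sqrt (\<epsilon> n) ^ 3 * (\<integral>k. G (\<epsilon> n * fst k, sqrt (\<epsilon> n) *\<^sub>R snd k) * time_kernel (\<epsilon> n) (\<epsilon> n * fst k, sqrt (\<epsilon> n) *\<^sub>R snd k) \<partial>lborel)"
      by (rule integral_parabolic_scale[OF _ \<epsilon>]) measurable
    also have "\<dots> = (\<integral>k. G (\<epsilon> n * fst k, sqrt (\<epsilon> n) *\<^sub>R snd k) * (\<epsilon> n * sqrt (\<epsilon> n) ^ 3 * time_kernel (\<epsilon> n) (\<epsilon> n * fst k, sqrt (\<epsilon> n) *\<^sub>R snd k)) \<partial>lborel)"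
      by (subst integral_mult_right_zero[symmetric]) (simp only: mult.left_commute)
    finally show ?thesis by (simp only: time_kernel_scale[OF \<epsilon>])
  qed
  moreover have "(\<lambda>n. \<integral>k. G (\<epsilon> n * fst k, sqrt (\<epsilon> n) *\<^sub>R snd k) * time_kernel 1 k \<partial>lborel)
      \<longlonglongrightarrow> (\<integral>k. G 0 * time_kernel 1 k \<partial>lborel)"
  proof (rule integral_dominated_convergence)
    show "integrable lborel (\<lambda>k. M * \<bar>time_kernel 1 k\<bar>)"
      by (intro integrable_mult_right integrable_abs time_kernel_integrable) simp
    show "AE k in lborel. norm (G (\<epsilon> n * fst k, sqrt (\<epsilon> n) *\<^sub>R snd k) * time_kernel 1 k) \<le> M * \<bar>time_kernel 1 k\<bar>" for n
      by (intro AE_I2) (simp add: abs_mult mult_right_mono Gb)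
    have e0: "\<epsilon> \<longlonglongrightarrow> 0" unfolding \<epsilon>_def by (rule lim_1_over_n[THEN LIMSEQ_Suc])
    have Gcont: "(\<lambda>n. G (h n)) \<longlonglongrightarrow> G 0" if h: "h \<longlonglongrightarrow> 0" for h
    proof -
      obtain r where r: "Q \<subseteq> cball 0 r" 
      using bounded_cbox[of p q] unfolding Q_def bounded_iff by (auto simp: subset_iff)
      \<comment> \<open>Moves the translation from \<open>f\<close> to the box. Off the boundary of
        the box, hence almost everywhere, the translated indicators converge.\<close>
      have eqG: "G h = (\<integral>z. indicat_real Q (z + h) * f z \<partial>lborel)" for h
        unfolding G_def by (subst (2) lborel_distr_plus[of "- h", symmetric]) (simp add: integral_distr)
      \<comment> \<open>From this index on the translations are shorter than 1, so one enlarged ball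
        contains every translated box.\<close>
      obtain N where N: "\<And>n. n \<ge> N \<Longrightarrow> norm (h n) < 1"
        using h unfolding LIMSEQ_iff by (metis diff_zero zero_less_one)
      have "(\<lambda>n. \<integral>z. indicat_real Q (z + h (n + N)) * f z \<partial>lborel) \<longlonglongrightarrow> (\<integral>z. indicat_real Q z * f z \<partial>lborel)"
      proof (rule integral_dominated_convergence)
        have "integrable lborel (indicat_real (cball (0::real \<times> (real^3)) (r + 1)))"
          by (intro integrable_real_indicator) (use emeasure_bounded_finite[OF bounded_cball[of "0::real \<times> (real^3)" "r + 1"]] in auto)
        with f2 show "integrable lborel (\<lambda>z. (f z)\<^sup>2 + indicat_real (cball 0 (r + 1)) z)"
          by (rule Bochner_Integration.integrable_add)
        show "AE z in lborel. norm (indicat_real Q (z + h (n + N)) * f z) \<le> (f z)\<^sup>2 + indicat_real (cball 0 (r + 1)) z" for n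
        proof (intro AE_I2)
          fix z
          show "norm (indicat_real Q (z + h (n + N)) * f z) \<le> (f z)\<^sup>2 + indicat_real (cball 0 (r + 1)) z"
          proof (cases "z + h (n + N) \<in> Q")
            case True
            then have "norm (z + h (n + N)) \<le> r" using r by auto
            moreover have "norm z \<le> norm (z + h (n + N)) + norm (h (n + N))"
              using norm_triangle_ineq4[of "z + h (n + N)" "h (n + N)"] by simp
            moreover have "norm (h (n + N)) < 1" by (rule N) simp
            ultimately have "z \<in> cball 0 (r + 1)" by simp
            then show ?thesis using young[of "cball 0 (r + 1)" z "f z"] True by simp
          qed simp
        qed
        have fQ: "frontier Q \<in> sets lborel" by (simp add: borel_closed)
        have "negligible (frontier Q)" unfolding Q_def by (intro negligible_convex_frontier convex_box)
        then have "\<exists>N\<in>null_sets lborel. frontier Q \<subseteq> N"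
          by (simp add: negligible_iff_null_sets null_sets_completion_iff2)
        then have "frontier Q \<in> null_sets lborel" using null_sets_subset[OF _ fQ] by blast
        then have "AE z in lborel. z \<notin> frontier Q" by (rule AE_not_in)
        then show "AE z in lborel. (\<lambda>n. indicat_real Q (z + h (n + N)) * f z) \<longlonglongrightarrow> indicat_real Q z * f z"
        proof eventually_elim
          case (elim z)
          have "(\<lambda>n. z + h (n + N)) \<longlonglongrightarrow> z + 0" by (intro tendsto_intros LIMSEQ_ignore_initial_segment h)
          then have lim: "(\<lambda>n. z + h (n + N)) \<longlonglongrightarrow> z" by simp
          have "\<forall>\<^sub>F n in sequentially. indicat_real Q (z + h (n + N)) = indicat_real Q z"
          proof (cases "z \<in> Q")
            case True
            then have "z \<in> interior Q" using elim unfolding Q_def frontier_def by auto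
            then have "\<forall>\<^sub>F n in sequentially. z + h (n + N) \<in> interior Q"
              using lim topological_tendstoD open_interior by blast
            then show ?thesis by eventually_elim (use True interior_subset[of Q] in auto)
          next
            case False
            then have "\<forall>\<^sub>F n in sequentially. z + h (n + N) \<in> - Q"
              using lim topological_tendstoD[OF lim, of "- Q"] unfolding Q_def by auto
            then show ?thesis by eventually_elim (use False in auto)
          qed
          then show ?case by (intro tendsto_mult tendsto_const tendsto_eventually)
        qed
      qed measurable
      then have "(\<lambda>n. G (h (n + N))) \<longlonglongrightarrow> G 0" unfolding eqG by simp
      then show ?thesis by (rule LIMSEQ_offset)
    qed
    show "AE k in lborel. (\<lambda>n. G (\<epsilon> n * fst k, sqrt (\<epsilon> n) *\<^sub>R snd k) * time_kernel 1 k) \<longlonglongrightarrow> G 0 * time_kernel 1 k"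
    proof (intro AE_I2 tendsto_mult tendsto_const Gcont)
      fix k :: "real \<times> (real^3)"
      have "(\<lambda>n. sqrt (\<epsilon> n)) \<longlonglongrightarrow> sqrt 0" by (intro tendsto_real_sqrt e0)
      then have "(\<lambda>n. (\<epsilon> n * fst k, sqrt (\<epsilon> n) *\<^sub>R snd k)) \<longlonglongrightarrow> (0 * fst k, sqrt 0 *\<^sub>R snd k)"
        by (intro tendsto_intros e0)
      then show "(\<lambda>n. (\<epsilon> n * fst k, sqrt (\<epsilon> n) *\<^sub>R snd k)) \<longlonglongrightarrow> 0" by (simp add: zero_prod_def)
    qed
  qed measurable
  moreover have "(\<integral>k. G 0 * time_kernel 1 k \<partial>lborel) = heat_mass * (\<integral>z. indicat_real Q z * f z \<partial>lborel)"
    by (simp add: time_kernel_integral G_def)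
  ultimately show ?L by simp
qed

section \<open>The estimate on a time window before the limit\<close>

lemma heat_minus: "heat s (- x) = heat s x"
  by (simp add: heat_def)

context pressure_free_flow
begin

text \<open>Thanks to \<open>\<epsilon>\<close> the ages stay in a compact interval of positive
  numbers, where the kernel decays uniformly; Peetre's inequality recentres this decay at the
  origin.\<close>

lemma integrable_heat_factor:
  assumes [measurable]: "c \<in> borel_measurable borel" and c: "\<And>t. \<bar>c t\<bar> \<le> A" "\<And>t. t \<notin> {\<alpha>..\<beta>} \<Longrightarrow> c t = 0"
    and \<alpha>: "0 < \<alpha>" and \<beta>: "\<beta> < t0" and \<epsilon>: "0 < \<epsilon>"
  shows "integrable lborel (\<lambda>z. U z $ k * (c (fst z) * heat (\<epsilon> + (t0 - fst z)) (snd z - y)))"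
proof -
  obtain K where K: "0 \<le> K" "\<And>s x. \<epsilon> \<le> s \<Longrightarrow> s \<le> \<epsilon> + (t0 - \<alpha>) \<Longrightarrow> heat s x \<le> K * inverse ((1 + (norm x)\<^sup>2)\<^sup>2)"
    using heat_decay[OF \<epsilon>, of "\<epsilon> + (t0 - \<alpha>)"] by blast
  have A0: "0 \<le> A" using order_trans[OF abs_ge_zero c(1)] .
  let ?D = "(2 * (1 + (norm y)\<^sup>2))\<^sup>2"
  have "\<bar>c (fst z) * heat (\<epsilon> + (t0 - fst z)) (snd z - y)\<bar> \<le> (A * (K * ?D)) * decay \<alpha> \<beta> z" for z
  proof (cases "fst z \<in> {\<alpha>..\<beta>}")
    case True
    then have s: "\<epsilon> \<le> \<epsilon> + (t0 - fst z)" "\<epsilon> + (t0 - fst z) \<le> \<epsilon> + (t0 - \<alpha>)" using \<beta> by auto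
    let ?X = "1 + (norm (snd z - y))\<^sup>2" and ?Z = "1 + (norm (snd z))\<^sup>2"
    have pos: "0 < ?X" "0 < ?Z" by (simp_all add: add_pos_nonneg)
    have "?Z\<^sup>2 \<le> (2 * (1 + (norm y)\<^sup>2) * ?X)\<^sup>2"
      using pos by (intro power_mono one_plus_norm_shift) auto
    then have "?Z\<^sup>2 \<le> ?D * ?X\<^sup>2" by (simp only: power_mult_distrib)
    then have "inverse (?X\<^sup>2) \<le> ?D * inverse (?Z\<^sup>2)"
      using pos by (simp add: divide_inverse[symmetric] pos_divide_le_eq pos_le_divide_eq inverse_eq_divide)
    then have "heat (\<epsilon> + (t0 - fst z)) (snd z - y) \<le> K * (?D * inverse (?Z\<^sup>2))"
      using K(2)[OF s, of "snd z - y"] K(1) by (meson mult_left_mono order_trans)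
    then have "\<bar>c (fst z)\<bar> * heat (\<epsilon> + (t0 - fst z)) (snd z - y) \<le> A * (K * (?D * inverse (?Z\<^sup>2)))"
      using heat_pos less_imp_le A0 by (intro mult_mono c) auto
    then show ?thesis
      using True heat_pos[of "\<epsilon> + (t0 - fst z)" "snd z - y"] by (simp add: abs_mult decay_def mult.assoc)
  next
    case False
    then show ?thesis using A0 K(1) decay_nonneg[of \<alpha> \<beta> z] by (simp add: c(2))
  qed
  then show ?thesis by (intro integrable_mult_decaying(1)[OF \<alpha>]) measurable
qed

text \<open>The amplitude is a cutoff \<open>\<eta>\<close> opening at the start of the window times
  one closing at \<open>t0\<close> on the scale \<open>\<epsilon>\<close>. The derivative of the
  closing factor produces the approximate identity on the left; that of the opening factor has size
  1/R and produces the term linear in \<open>v\<close>. In the quadratic term one factor keeps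
  \<open>\<eta>\<close>, so that the inequality becomes closed in
  \<open>v z * \<eta> (fst z)\<close>.\<close>

lemma window_bound:
  fixes b R \<epsilon> :: real and z0 :: "real \<times> (real^3)"
  assumes b: "0 \<le> b" and R: "0 < R" and z0: "fst z0 \<in> {b<..<b + R}" and \<epsilon>: "0 < \<epsilon>"
  defines "\<eta> \<equiv> \<lambda>t. smooth_step ((t - b) * inverse R)"
    and "v \<equiv> \<lambda>z. norm (U z) * indicat_real {z. fst z \<in> {b<..<b + R}} z"
  shows "ennreal \<bar>\<integral>z. (U z $ k * \<eta> (fst z)) * time_kernel \<epsilon> (z0 - z) \<partial>lborel\<bar>
    \<le> ennreal (heat_const * step_const * inverse R) * (\<integral>\<^sup>+z. ennreal (v z * kern (3/2) (z0 - z)) \<partial>lborel)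
      + ennreal (9 * heat3_const) * (\<integral>\<^sup>+z. ennreal (kern 2 (z0 - z) * v z * (v z * \<eta> (fst z))) \<partial>lborel)"
proof -
  note C1 = less_imp_le[OF heat_const(1)] heat_const(2)
  note E = step_const
  define t0 y where "t0 = fst z0" and "y = snd z0"
  have z0e: "z0 = (t0, y)" by (simp add: t0_def y_def)
  define a1 where "a1 t = step' ((t - b) * inverse R) * inverse R * smooth_step ((t0 - t) * inverse \<epsilon>)" for t
  define a2 where "a2 t = \<eta> t * (step' ((t0 - t) * inverse \<epsilon>) * inverse \<epsilon>)" for t
  define a where "a t = \<eta> t * smooth_step ((t0 - t) * inverse \<epsilon>)" for t
  \<comment> \<open>The transition vanishes up to 1/4, so the support of \<open>a\<close> stays away
    from the start of the window and from \<open>t0\<close>; in particular \<open>\<alpha>\<close>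
    is positive even if \<open>b = 0\<close>.\<close>
  define \<alpha> \<beta> where "\<alpha> = b + R/4" and "\<beta> = t0 - \<epsilon>/4"
  have \<alpha>: "0 < \<alpha>" and \<beta>: "\<beta> < t0" using b R \<epsilon> by (auto simp: \<alpha>_def \<beta>_def)
  have arg1: "t < \<alpha> \<Longrightarrow> (t - b) * inverse R < 1/4" for t
    using R by (simp add: \<alpha>_def divide_inverse[symmetric] pos_divide_less_eq)
  have arg2: "\<beta> < t \<Longrightarrow> (t0 - t) * inverse \<epsilon> < 1/4" for t
    using \<epsilon> by (simp add: \<beta>_def divide_inverse[symmetric] pos_divide_less_eq)
  have off1: "\<eta> t = 0 \<and> step' ((t - b) * inverse R) = 0" if "t < \<alpha>" for t
    using arg1[OF that] smooth_step_eq_0 step'_eq_0 unfolding \<eta>_def by auto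
  have off2: "smooth_step ((t0 - t) * inverse \<epsilon>) = 0 \<and> step' ((t0 - t) * inverse \<epsilon>) = 0" if "\<beta> < t" for t
    using arg2[OF that] smooth_step_eq_0 step'_eq_0 by auto
  have off: "a t = 0" "a1 t = 0" "a2 t = 0" if "t \<notin> {\<alpha>..\<beta>}" for t
    using that off1[of t] off2[of t] by (force simp: a_def a1_def a2_def not_le)+
  have s1: "smooth (\<lambda>t. (t - b) * inverse R)" "smooth (\<lambda>t. (t0 - t) * inverse \<epsilon>)"
    by (intro smooth_mult smooth_diff smooth_id smooth_const)+
  have \<eta>: "smooth \<eta>" unfolding \<eta>_def by (intro smooth_compose[OF smooth_smooth_step] s1)
  have \<eta>b: "0 \<le> \<eta> t" "\<eta> t \<le> 1" for t using smooth_step_bounds by (auto simp: \<eta>_def)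
  have as: "smooth a" unfolding a_def[abs_def] by (intro smooth_mult \<eta> smooth_compose[OF smooth_smooth_step] s1)
  have [measurable]: "smooth_step \<in> borel_measurable borel" "\<eta> \<in> borel_measurable borel" "a \<in> borel_measurable borel"
    by (intro smooth_borel smooth_smooth_step \<eta> as)+
  have [measurable]: "a1 \<in> borel_measurable borel" "a2 \<in> borel_measurable borel"
    unfolding a1_def[abs_def] a2_def[abs_def] by measurable
  have a': "pderiv_dir 1 a t = a1 t - a2 t" for t
  proof (rule pderiv_dir_1_eq)
    have D: "((\<lambda>t. smooth_step (g t)) has_real_derivative step' (g t) * d) (at t)"
      if "(g has_real_derivative d) (at t)" for g d
      using DERIV_chain2[OF has_real_derivative_pderiv_dir[OF smooth_smooth_step] that] .
    have "((\<lambda>t. (t - b) * inverse R) has_real_derivative inverse R) (at t)"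
      "((\<lambda>t. (t0 - t) * inverse \<epsilon>) has_real_derivative - inverse \<epsilon>) (at t)"
      by (auto intro!: derivative_eq_intros)
    from DERIV_mult[OF D[OF this(1)] D[OF this(2)]]
    show "(a has_real_derivative a1 t - a2 t) (at t)"
      unfolding a_def[abs_def] \<eta>_def a1_def a2_def by (simp add: algebra_simps)
  qed
  have b1: "\<bar>a1 t\<bar> \<le> step_const * inverse R" for t
  proof -
    have "\<bar>a1 t\<bar> \<le> (step_const * inverse R) * 1"
      unfolding a1_def abs_mult using E R smooth_step_bounds by (intro mult_mono) auto
    then show ?thesis by simp
  qed
  have b2: "\<bar>a2 t\<bar> \<le> step_const * inverse \<epsilon>" for t
  proof -
    have "\<bar>a2 t\<bar> \<le> 1 * (step_const * inverse \<epsilon>)"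
      unfolding a2_def abs_mult using E \<epsilon> \<eta>b by (intro mult_mono) auto
    then show ?thesis by simp
  qed
  let ?h = "\<lambda>z. heat (\<epsilon> + (t0 - fst z)) (snd z - y)"
  have i1: "integrable lborel (\<lambda>z. U z $ k * (a1 (fst z) * ?h z))"
    by (rule integrable_heat_factor[OF _ b1 off(2) \<alpha> \<beta> \<epsilon>]) auto
  have i2: "integrable lborel (\<lambda>z. U z $ k * (a2 (fst z) * ?h z))"
    by (rule integrable_heat_factor[OF _ b2 off(3) \<alpha> \<beta> \<epsilon>]) auto
  have split: "(\<integral>z. U z $ k * (pderiv_dir 1 a (fst z) * ?h z) \<partial>lborel)
     = (\<integral>z. U z $ k * (a1 (fst z) * ?h z) \<partial>lborel) - (\<integral>z. U z $ k * (a2 (fst z) * ?h z) \<partial>lborel)"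
    unfolding a' left_diff_distrib right_diff_distrib by (rule Bochner_Integration.integral_diff[OF i1 i2])
  have lhs: "(\<integral>z. (U z $ k * \<eta> (fst z)) * time_kernel \<epsilon> (z0 - z) \<partial>lborel) = (\<integral>z. U z $ k * (a2 (fst z) * ?h z) \<partial>lborel)"
  proof (intro Bochner_Integration.integral_cong refl)
    fix z
    have "heat (\<epsilon> + (t0 - fst z)) (y - snd z) = ?h z"
      using heat_minus[of "\<epsilon> + (t0 - fst z)" "snd z - y"] by simp
    then show "(U z $ k * \<eta> (fst z)) * time_kernel \<epsilon> (z0 - z) = U z $ k * (a2 (fst z) * ?h z)"
      unfolding time_kernel_def a2_def z0e by simp
  qed
  have W: "fst z \<in> {b<..<b + R}" if "fst z \<in> {\<alpha>..\<beta>}" for z :: "real \<times> (real^3)"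
    using that z0 R \<epsilon> by (auto simp: \<alpha>_def \<beta>_def t0_def)
  have W_meas [measurable]: "{z::real \<times> (real^3). fst z \<in> {b<..<b + R}} \<in> sets borel"
    by (simp only: greaterThanLessThan_iff) (intro borel_open open_Collect_conj open_Collect_less continuous_intros)
  have [measurable]: "v \<in> borel_measurable borel" unfolding v_def by measurable
  have kn: "norm (snd (z0 - z)) = norm (snd z - y)" for z
    unfolding z0e by (simp add: norm_minus_commute)
  have B1: "ennreal \<bar>\<integral>z. U z $ k * (a1 (fst z) * ?h z) \<partial>lborel\<bar>
    \<le> ennreal (heat_const * step_const * inverse R) * (\<integral>\<^sup>+z. ennreal (v z * kern (3/2) (z0 - z)) \<partial>lborel)"
  proof -
    have "ennreal \<bar>\<integral>z. U z $ k * (a1 (fst z) * ?h z) \<partial>lborel\<bar> \<le> (\<integral>\<^sup>+z. ennreal \<bar>U z $ k * (a1 (fst z) * ?h z)\<bar> \<partial>lborel)"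
      using integral_norm_bound_ennreal[OF i1] by simp
    also have "\<dots> \<le> (\<integral>\<^sup>+z. ennreal (heat_const * step_const * inverse R) * ennreal (v z * kern (3/2) (z0 - z)) \<partial>lborel)"
    proof (rule nn_integral_mono)
      fix z
      show "ennreal \<bar>U z $ k * (a1 (fst z) * ?h z)\<bar> \<le> ennreal (heat_const * step_const * inverse R) * ennreal (v z * kern (3/2) (z0 - z))"
      proof (cases "fst z \<in> {\<alpha>..\<beta>}")
        case True
        then have \<tau>: "0 < t0 - fst z" using \<beta> by auto
        have "?h z \<le> heat_const * (\<epsilon> + (t0 - fst z) + (norm (snd z - y))\<^sup>2) powr (-3/2)"
          using \<tau> \<epsilon> by (intro C1) simp
        also have "\<dots> \<le> heat_const * (t0 - fst z + (norm (snd z - y))\<^sup>2) powr (-3/2)"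
          using powr_mono_base[of "t0 - fst z + (norm (snd z - y))\<^sup>2" "\<epsilon> + (t0 - fst z) + (norm (snd z - y))\<^sup>2" "3/2"] \<tau> \<epsilon> C1(1)
          by (intro mult_left_mono) (auto simp: add_pos_nonneg)
        also have "\<dots> = heat_const * kern (3/2) (z0 - z)"
          using \<tau> unfolding kern_def kn by (simp add: z0e)
        finally have h: "?h z \<le> heat_const * kern (3/2) (z0 - z)" .
        have "\<bar>U z $ k * (a1 (fst z) * ?h z)\<bar> \<le> norm (U z) * (step_const * inverse R * (heat_const * kern (3/2) (z0 - z)))"
          unfolding abs_mult using E R heat_pos[of "\<epsilon> + (t0 - fst z)" "snd z - y"] h
          by (intro mult_mono component_le b1) auto
        also have "\<dots> = heat_const * step_const * inverse R * (v z * kern (3/2) (z0 - z))"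
          using W[OF True] by (simp add: v_def)
        finally show ?thesis
          using C1(1) E(1) R by (subst ennreal_mult[symmetric]) (auto simp: v_def kern_nonneg intro!: ennreal_leI)
      qed (simp add: off)
    qed
    also have "\<dots> = ennreal (heat_const * step_const * inverse R) * (\<integral>\<^sup>+z. ennreal (v z * kern (3/2) (z0 - z)) \<partial>lborel)"
      by (rule nn_integral_cmult) measurable
    finally show ?thesis .
  qed
  have "ennreal \<bar>\<integral>z. U z $ k * (pderiv_dir 1 a (fst z) * ?h z) \<partial>lborel\<bar>
    \<le> ennreal (9 * heat3_const) * (\<integral>\<^sup>+z. ennreal ((norm (U z))\<^sup>2 * \<bar>a (fst z)\<bar> * kern 2 (t0 - fst z, snd z - y)) \<partial>lborel)"
    by (rule heat_test_bound[OF as off(1) \<alpha> \<beta> \<epsilon>])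
  also have "\<dots> \<le> ennreal (9 * heat3_const) * (\<integral>\<^sup>+z. ennreal (kern 2 (z0 - z) * v z * (v z * \<eta> (fst z))) \<partial>lborel)"
  proof (intro mult_left_mono nn_integral_mono ennreal_leI)
    fix z
    show "(norm (U z))\<^sup>2 * \<bar>a (fst z)\<bar> * kern 2 (t0 - fst z, snd z - y) \<le> kern 2 (z0 - z) * v z * (v z * \<eta> (fst z))"
    proof (cases "fst z \<in> {\<alpha>..\<beta>}")
      case True
      have k2: "kern 2 (t0 - fst z, snd z - y) = kern 2 (z0 - z)"
        unfolding kern_def kn by (simp add: z0e)
      have "\<bar>a (fst z)\<bar> \<le> \<eta> (fst z) * 1"
        unfolding a_def abs_mult using \<eta>b smooth_step_bounds by (intro mult_mono) auto
      then have "(norm (U z))\<^sup>2 * \<bar>a (fst z)\<bar> * kern 2 (z0 - z) \<le> (norm (U z))\<^sup>2 * \<eta> (fst z) * kern 2 (z0 - z)"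
        by (intro mult_right_mono mult_left_mono) (auto simp: kern_nonneg)
      also have "\<dots> = kern 2 (z0 - z) * v z * (v z * \<eta> (fst z))"
        using W[OF True] by (simp add: v_def power2_eq_square)
      finally show ?thesis unfolding k2 .
    next
      case False
      then show ?thesis using \<eta>b kern_nonneg by (simp add: off v_def)
    qed
  qed simp
  finally have B2: "ennreal \<bar>\<integral>z. U z $ k * (pderiv_dir 1 a (fst z) * ?h z) \<partial>lborel\<bar>
    \<le> ennreal (9 * heat3_const) * (\<integral>\<^sup>+z. ennreal (kern 2 (z0 - z) * v z * (v z * \<eta> (fst z))) \<partial>lborel)" .
  \<comment> \<open>\<open>a2\<close> is \<open>a1\<close> minus the derivative of \<open>a\<close>,
    so its integral is controlled by the other two.\<close>
  have "\<bar>\<integral>z. (U z $ k * \<eta> (fst z)) * time_kernel \<epsilon> (z0 - z) \<partial>lborel\<bar>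
    \<le> \<bar>\<integral>z. U z $ k * (a1 (fst z) * ?h z) \<partial>lborel\<bar> + \<bar>\<integral>z. U z $ k * (pderiv_dir 1 a (fst z) * ?h z) \<partial>lborel\<bar>"
    unfolding lhs split by linarith
  then have "ennreal \<bar>\<integral>z. (U z $ k * \<eta> (fst z)) * time_kernel \<epsilon> (z0 - z) \<partial>lborel\<bar>
    \<le> ennreal \<bar>\<integral>z. U z $ k * (a1 (fst z) * ?h z) \<partial>lborel\<bar> + ennreal \<bar>\<integral>z. U z $ k * (pderiv_dir 1 a (fst z) * ?h z) \<partial>lborel\<bar>"
    by (simp add: ennreal_plus[symmetric] ennreal_leI del: ennreal_plus)
  also have "\<dots> \<le> ennreal (heat_const * step_const * inverse R) * (\<integral>\<^sup>+z. ennreal (v z * kern (3/2) (z0 - z)) \<partial>lborel)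
      + ennreal (9 * heat3_const) * (\<integral>\<^sup>+z. ennreal (kern 2 (z0 - z) * v z * (v z * \<eta> (fst z))) \<partial>lborel)"
    by (rule add_mono[OF B1 B2])
  finally show ?thesis .
qed

end

section \<open>Boundedness of the velocity\<close>

lemma cube_average_le:
  fixes f g :: "'a::euclidean_space \<Rightarrow> real"
  assumes f: "\<And>p q. set_integrable lborel (cbox p q) f" and g: "\<And>p q. set_integrable lborel (cbox p q) g"
    and c: "0 < c" and W: "open W"
    and le: "\<And>p q. cbox p q \<subseteq> W \<Longrightarrow> c * \<bar>\<integral>z. indicat_real (cbox p q) z * f z \<partial>lborel\<bar> \<le> (\<integral>z. indicat_real (cbox p q) z * g z \<partial>lborel)"
  shows "AE z in lborel. z \<in> W \<longrightarrow> c * \<bar>f z\<bar> \<le> g z"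
proof -
  have hk: "h integrable_on cbox p q" "integral (cbox p q) h = (\<integral>z. indicat_real (cbox p q) z * h z \<partial>lborel)"
    if "set_integrable lborel (cbox p q) h" for h :: "'a \<Rightarrow> real" and p q
    using set_borel_integral_eq_integral[OF that] by (auto simp: set_lebesgue_integral_def)
  obtain N1 where N1: "negligible N1" "\<And>x e. x \<notin> N1 \<Longrightarrow> 0 < e \<Longrightarrow> \<exists>d>0. \<forall>h. 0 < h \<and> h < d \<longrightarrow>
      norm (integral (cbox x (x + h *\<^sub>R One)) f /\<^sub>R h ^ DIM('a) - f x) < e"
    using integrable_ccontinuous_explicit[of f] hk(1)[OF f] by blast
  obtain N2 where N2: "negligible N2" "\<And>x e. x \<notin> N2 \<Longrightarrow> 0 < e \<Longrightarrow> \<exists>d>0. \<forall>h. 0 < h \<and> h < d \<longrightarrow>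
      norm (integral (cbox x (x + h *\<^sub>R One)) g /\<^sub>R h ^ DIM('a) - g x) < e"
    using integrable_ccontinuous_explicit[of g] hk(1)[OF g] by blast
  have main: "c * \<bar>f z\<bar> \<le> g z" if z: "z \<in> W" "z \<notin> N1" "z \<notin> N2" for z
  proof (rule field_le_epsilon)
    fix e :: real assume e: "0 < e"
    \<comment> \<open>The error \<open>e'\<close> enters once through \<open>g\<close> and
      \<open>c\<close> times through \<open>f\<close>, hence the divisor
      \<open>1 + c\<close>.\<close>
    define e' where "e' = e / (1 + c)"
    have e': "0 < e'" using e c by (simp add: e'_def)
    obtain r where r: "0 < r" "ball z r \<subseteq> W" using W z(1) open_contains_ball by blast
    obtain d1 where d1: "0 < d1" "\<And>h. 0 < h \<Longrightarrow> h < d1 \<Longrightarrow> norm (integral (cbox z (z + h *\<^sub>R One)) f /\<^sub>R h ^ DIM('a) - f z) < e'"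
      using N1(2)[OF z(2) e'] by blast
    obtain d2 where d2: "0 < d2" "\<And>h. 0 < h \<Longrightarrow> h < d2 \<Longrightarrow> norm (integral (cbox z (z + h *\<^sub>R One)) g /\<^sub>R h ^ DIM('a) - g z) < e'"
      using N2(2)[OF z(3) e'] by blast
    \<comment> \<open>Points of a cube of side \<open>h\<close> lie within \<open>h\<close> times
      the dimension of its corner, by the l1 norm; the extra 1 makes containment in the ball
      strict.\<close>
    define L where "L = real (DIM('a)) + 1"
    define h where "h = min (min d1 d2) (r / L) / 2"
    have L: "0 < L" by (simp add: L_def)
    have h: "0 < h" "h < d1" "h < d2" "h < r / L"
    proof -
      define m where "m = min (min d1 d2) (r / L)"
      have "0 < m" "m \<le> d1" "m \<le> d2" "m \<le> r / L" "h = m / 2"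
        using d1(1) d2(1) r(1) L by (auto simp: m_def h_def)
      then show "0 < h" "h < d1" "h < d2" "h < r / L" by linarith+
    qed
    let ?Q = "cbox z (z + h *\<^sub>R One)"
    have sub: "?Q \<subseteq> W"
    proof
      fix x assume x: "x \<in> ?Q"
      have "norm (x - z) \<le> (\<Sum>b\<in>Basis. \<bar>(x - z) \<bullet> b\<bar>)" by (rule norm_le_l1)
      also have "\<dots> \<le> (\<Sum>b\<in>(Basis::'a set). h)"
        using x by (intro sum_mono) (auto simp: mem_box inner_diff_left inner_add_left)
      also have "\<dots> < r"
      proof -
        have "h * L < r" using h(4) L by (simp add: pos_less_divide_eq)
        then show ?thesis using h(1) by (simp add: L_def algebra_simps)
      qed
      finally have "x \<in> ball z r" by (simp add: dist_norm norm_minus_commute)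
      then show "x \<in> W" using r by blast
    qed
    define k where "k = inverse (h ^ DIM('a))"
    have k: "0 < k" using h(1) by (simp add: k_def)
    have F: "\<bar>k * integral ?Q f - f z\<bar> < e'" using d1(2)[OF h(1,2)] by (simp add: k_def)
    have G: "\<bar>k * integral ?Q g - g z\<bar> < e'" using d2(2)[OF h(1,3)] by (simp add: k_def)
    have "c * \<bar>f z\<bar> \<le> c * (\<bar>k * integral ?Q f\<bar> + e')"
      using F c by (intro mult_left_mono) auto
    also have "\<dots> = k * (c * \<bar>integral ?Q f\<bar>) + c * e'"
      using k by (simp add: abs_mult distrib_left mult.left_commute)
    also have "k * (c * \<bar>integral ?Q f\<bar>) \<le> k * integral ?Q g"
      using k le[OF sub] hk(2)[OF f] hk(2)[OF g] by (intro mult_left_mono) auto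
    also have "k * integral ?Q g + c * e' \<le> g z + e' + c * e'" using G by linarith
    also have "\<dots> = g z + e"
    proof -
      have "(1 + c) * e' = e" using c by (simp add: e'_def)
      then show ?thesis by (simp add: distrib_right)
    qed
    finally show "c * \<bar>f z\<bar> \<le> g z + e" by simp
  qed
  have "negligible (N1 \<union> N2)" using N1(1) N2(1) by (rule negligible_Un)
  then have "N1 \<union> N2 \<in> null_sets lebesgue" by (simp add: negligible_iff_null_sets)
  then have "AE z in lebesgue. z \<notin> N1 \<union> N2" by (rule AE_not_in)
  then have "AE z in lborel. z \<notin> N1 \<union> N2" by (simp only: AE_completion_iff)
  then show ?thesis by eventually_elim (use main in auto)
qed

context pressure_free_flow
begin

text \<open>The window estimate has a right side free of \<open>\<epsilon>\<close>. Integrated over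
  boxes inside the window it survives the limit of vanishing \<open>\<epsilon>\<close>, where the
  approximate identity turns the smoothed field into \<open>heat_mass\<close> times the field.
  Differentiation of the integrals over cubes then yields the pointwise inequality.\<close>

lemma AE_integral_inequality:
  fixes b R :: real
  assumes b: "0 \<le> b" and R: "0 < R"
    and c2: "0 \<le> c2" "(\<integral>\<^sup>+z. ennreal (kern 2 z) * indicator {z. fst z < R} z \<partial>lborel) \<le> ennreal c2"
    and \<kappa>: "0 \<le> \<kappa>" "(\<integral>\<^sup>+z. ennreal (kern (9/5) z) * indicator {z. fst z < R} z \<partial>lborel) \<le> ennreal \<kappa>"
  defines "\<eta> \<equiv> \<lambda>t. smooth_step ((t - b) * inverse R)"
    and "v \<equiv> \<lambda>z. norm (U z) * indicat_real {z. fst z \<in> {b<..<b + R}} z"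
  assumes A: "0 < A" "(\<integral>\<^sup>+z. ennreal (v z ^ 6) \<partial>lborel) \<le> ennreal A"
  shows "AE z in lborel. fst z \<in> {b<..<b + R} \<longrightarrow> ennreal (heat_mass * \<bar>U z $ k * \<eta> (fst z)\<bar>)
     \<le> ennreal (heat_const * step_const * inverse R * (A powr (1/6) * \<kappa> powr (5/6)))
       + ennreal (9 * heat3_const) * (\<integral>\<^sup>+\<zeta>. ennreal (kern 2 (z - \<zeta>) * v \<zeta> * (v \<zeta> * \<eta> (fst \<zeta>))) \<partial>lborel)"
proof -
  note C1 = less_imp_le[OF heat_const(1)] heat_const(2)
  note E = step_const
  let ?W = "{z::real \<times> (real^3). fst z \<in> {b<..<b + R}}"
  have openW: "open ?W"
    by (simp only: greaterThanLessThan_iff) (intro open_Collect_conj open_Collect_less continuous_intros)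
  then have [measurable]: "?W \<in> sets borel" by (rule borel_open)
  have [measurable]: "{z::real \<times> (real^3). fst z < r} \<in> sets borel" "{z::real \<times> (real^3). 0 < fst z \<and> fst z < r} \<in> sets borel" for r
    by (intro borel_open open_Collect_conj open_Collect_less continuous_intros)+
  have [measurable]: "v \<in> borel_measurable borel" unfolding v_def by measurable
  have v0: "0 \<le> v z" for z by (simp add: v_def)
  have vW: "v z = 0" if "z \<notin> ?W" for z using that by (simp add: v_def)
  have \<eta>s: "smooth \<eta>"
    unfolding \<eta>_def by (intro smooth_compose[OF smooth_smooth_step] smooth_mult smooth_diff smooth_id smooth_const)
  have [measurable]: "\<eta> \<in> borel_measurable borel" by (rule smooth_borel[OF \<eta>s])
  have \<eta>b: "0 \<le> \<eta> t" "\<eta> t \<le> 1" for t using smooth_step_bounds by (auto simp: \<eta>_def)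
  have \<eta>0: "\<eta> t = 0" if "t \<le> b" for t
  proof -
    have "(t - b) * inverse R \<le> 0" using that R by (intro mult_nonpos_nonneg) auto
    then show ?thesis unfolding \<eta>_def by (intro smooth_step_eq_0) simp
  qed
  define M where "M = heat_const * step_const * inverse R * (A powr (1/6) * \<kappa> powr (5/6))"
  have M0: "0 \<le> M" using C1(1) E(1) R by (simp add: M_def)
  define B2 where "B2 z = (\<integral>\<^sup>+\<zeta>. ennreal (kern 2 (z - \<zeta>) * v \<zeta> * (v \<zeta> * \<eta> (fst \<zeta>))) \<partial>lborel)" for z
  have [measurable]: "B2 \<in> borel_measurable borel" unfolding B2_def[abs_def] by measurable
  define B where "B z = ennreal M + ennreal (9 * heat3_const) * B2 z" for z
  have [measurable]: "B \<in> borel_measurable borel" unfolding B_def[abs_def] by measurable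
  define f where "f z = U z $ k * \<eta> (fst z) * indicat_real ?W z" for z
  have [measurable]: "f \<in> borel_measurable borel" unfolding f_def[abs_def] by measurable
  have vint: "(\<integral>\<^sup>+z. ennreal ((v z)\<^sup>2) \<partial>lborel) < \<infinity>"
  proof -
    have "(\<integral>\<^sup>+z. ennreal ((v z)\<^sup>2) \<partial>lborel)
      \<le> (\<integral>\<^sup>+z. ennreal ((norm (U z))\<^sup>2) * indicator {z. 0 < fst z \<and> fst z < b + R} z \<partial>lborel)"
      using b by (intro nn_integral_mono) (auto simp: v_def indicator_def)
    then show ?thesis using U_L2[of "b + R"] by (rule le_less_trans)
  qed
  have fv: "\<bar>f z\<bar> \<le> v z" for z
  proof -
    have "\<bar>U z $ k\<bar> * \<eta> (fst z) \<le> norm (U z) * 1" using \<eta>b by (intro mult_mono component_le) auto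
    then show ?thesis using \<eta>b by (simp add: f_def v_def abs_mult indicator_def)
  qed
  have f2: "integrable lborel (\<lambda>z. (f z)\<^sup>2)"
  proof (rule integrableI_nonneg)
    have "(\<integral>\<^sup>+z. ennreal ((f z)\<^sup>2) \<partial>lborel) \<le> (\<integral>\<^sup>+z. ennreal ((v z)\<^sup>2) \<partial>lborel)"
      using fv v0 by (intro nn_integral_mono ennreal_leI) (simp add: abs_le_square_iff[symmetric])
    then show "(\<integral>\<^sup>+z. ennreal ((f z)\<^sup>2) \<partial>lborel) < \<infinity>" using vint by (rule le_less_trans)
  qed auto
  have bound: "ennreal \<bar>\<integral>z. f z * time_kernel \<epsilon> (z0 - z) \<partial>lborel\<bar> \<le> B z0" if z0: "z0 \<in> ?W" and \<epsilon>: "0 < \<epsilon>" for z0 \<epsilon>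
  proof -
    have z0': "fst z0 \<in> {b<..<b + R}" using z0 by simp
    have "(\<integral>z. f z * time_kernel \<epsilon> (z0 - z) \<partial>lborel) = (\<integral>z. (U z $ k * \<eta> (fst z)) * time_kernel \<epsilon> (z0 - z) \<partial>lborel)"
    proof (intro Bochner_Integration.integral_cong refl)
      fix z
      show "f z * time_kernel \<epsilon> (z0 - z) = (U z $ k * \<eta> (fst z)) * time_kernel \<epsilon> (z0 - z)"
      proof (cases "z \<in> ?W")
        case False
        \<comment> \<open>Restriction to the window changes nothing: before it \<open>\<eta>\<close>
          vanishes, and after it the time kernel does, being supported in the past of
          \<open>z0\<close>.\<close>
        then consider "fst z \<le> b" | "b + R \<le> fst z" by fastforce
        then show ?thesis
        proof cases
          case 1 then show ?thesis by (simp add: f_def \<eta>0)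
        next
          case 2
          then have "fst (z0 - z) * inverse \<epsilon> \<le> 0" using z0' \<epsilon> by (intro mult_nonpos_nonneg) auto
          then have "step' (fst (z0 - z) * inverse \<epsilon>) = 0" by (intro step'_eq_0) auto
          then have "time_kernel \<epsilon> (z0 - z) = 0" unfolding time_kernel_def by simp
          then show ?thesis by simp
        qed
      qed (simp add: f_def)
    qed
    then have "ennreal \<bar>\<integral>z. f z * time_kernel \<epsilon> (z0 - z) \<partial>lborel\<bar>
      \<le> ennreal (heat_const * step_const * inverse R) * (\<integral>\<^sup>+z. ennreal (v z * kern (3/2) (z0 - z)) \<partial>lborel) + ennreal (9 * heat3_const) * B2 z0"
      using window_bound[OF b R z0' \<epsilon>, of k] unfolding B2_def \<eta>_def v_def by simp
    also have "\<dots> \<le> B z0"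
    proof -
      have eq: "(\<integral>\<^sup>+z. ennreal (v z * kern (3/2) (z0 - z)) \<partial>lborel) = (\<integral>\<^sup>+z. ennreal (v z * (kern (3/2) (z0 - z) * indicat_real ?W z)) \<partial>lborel)"
        by (intro nn_integral_cong) (auto simp: indicator_def vW)
      \<comment> \<open>The 6/5-th power of \<open>kern (3/2)\<close> is \<open>kern (9/5)\<close>,
        whose integral over times below \<open>R\<close> is at most \<open>\<kappa>\<close>.\<close>
      have K: "(\<integral>\<^sup>+z. ennreal ((kern (3/2) (z0 - z) * indicat_real ?W z) powr (6/5)) \<partial>lborel) \<le> ennreal \<kappa>"
      proof -
        have "(\<integral>\<^sup>+z. ennreal ((kern (3/2) (z0 - z) * indicat_real ?W z) powr (6/5)) \<partial>lborel)
          \<le> (\<integral>\<^sup>+z. ennreal (kern (9/5) (z0 - z)) * indicator {z. fst z < R} (z0 - z) \<partial>lborel)"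
        proof (rule nn_integral_mono)
          fix z
          show "ennreal ((kern (3/2) (z0 - z) * indicat_real ?W z) powr (6/5)) \<le> ennreal (kern (9/5) (z0 - z)) * indicator {z. fst z < R} (z0 - z)"
          proof (cases "z \<in> ?W")
            case True
            then have "fst (z0 - z) < R" using z0' by auto
            then show ?thesis using True by (simp add: kern_powr)
          qed simp
        qed
        also have "\<dots> = (\<integral>\<^sup>+z. ennreal (kern (9/5) z) * indicator {z. fst z < R} z \<partial>lborel)"
          by (rule nn_integral_translate_reflect(1)[of "\<lambda>z. ennreal (kern (9/5) z) * indicator {z. fst z < R} z"]) measurable
        also note \<kappa>(2)
        finally show ?thesis .
      qed
      have "(\<integral>\<^sup>+z. ennreal (v z * (kern (3/2) (z0 - z) * indicat_real ?W z)) \<partial>lborel) \<le> ennreal (A powr (1/6) * \<kappa> powr (5/6))"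
      proof (rule Hoelder_6[OF _ _ v0 _ A \<kappa>(1) K])
        show "0 \<le> kern (3/2) (z0 - z) * indicat_real ?W z" for z by (simp add: kern_nonneg)
      qed measurable
      then have "ennreal (heat_const * step_const * inverse R) * (\<integral>\<^sup>+z. ennreal (v z * kern (3/2) (z0 - z)) \<partial>lborel)
         \<le> ennreal (heat_const * step_const * inverse R) * ennreal (A powr (1/6) * \<kappa> powr (5/6))"
        unfolding eq by (rule mult_left_mono) simp
      also have "\<dots> = ennreal M" unfolding M_def using C1(1) E(1) R by (subst ennreal_mult[symmetric]) auto
      finally show ?thesis unfolding B_def by (rule add_right_mono)
    qed
    finally show ?thesis .
  qed
  \<comment> \<open>Convolution of two integrable functions: the kernel over times below
    \<open>R\<close> and the square of \<open>v\<close>. Hence the bound is finite almost everywhere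
    in the window and can be treated as a real function.\<close>
  have B2int: "(\<integral>\<^sup>+z. B2 z * indicator ?W z \<partial>lborel) < \<infinity>"
  proof -
    have "(\<integral>\<^sup>+z. B2 z * indicator ?W z \<partial>lborel)
      = (\<integral>\<^sup>+z. \<integral>\<^sup>+\<zeta>. ennreal (kern 2 (z - \<zeta>) * v \<zeta> * (v \<zeta> * \<eta> (fst \<zeta>))) * indicator ?W z \<partial>lborel \<partial>lborel)"
      unfolding B2_def by (subst nn_integral_multc) auto
    also have "\<dots> = (\<integral>\<^sup>+\<zeta>. \<integral>\<^sup>+z. ennreal (kern 2 (z - \<zeta>) * v \<zeta> * (v \<zeta> * \<eta> (fst \<zeta>))) * indicator ?W z \<partial>lborel \<partial>lborel)"
      by (rule lborel_pair.Fubini') measurable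
    also have "\<dots> \<le> (\<integral>\<^sup>+\<zeta>. ennreal c2 * ennreal ((v \<zeta>)\<^sup>2) \<partial>lborel)"
    proof (rule nn_integral_mono)
      fix \<zeta>
      show "(\<integral>\<^sup>+z. ennreal (kern 2 (z - \<zeta>) * v \<zeta> * (v \<zeta> * \<eta> (fst \<zeta>))) * indicator ?W z \<partial>lborel) \<le> ennreal c2 * ennreal ((v \<zeta>)\<^sup>2)"
      proof (cases "\<zeta> \<in> ?W")
        case True
        have "(\<integral>\<^sup>+z. ennreal (kern 2 (z - \<zeta>) * v \<zeta> * (v \<zeta> * \<eta> (fst \<zeta>))) * indicator ?W z \<partial>lborel)
          \<le> (\<integral>\<^sup>+z. (ennreal (kern 2 (z - \<zeta>)) * indicator {z. fst z < R} (z - \<zeta>)) * ennreal ((v \<zeta>)\<^sup>2) \<partial>lborel)"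
        proof (rule nn_integral_mono)
          fix z
          have "kern 2 (z - \<zeta>) * v \<zeta> * (v \<zeta> * \<eta> (fst \<zeta>)) \<le> kern 2 (z - \<zeta>) * v \<zeta> * (v \<zeta> * 1)"
            using \<eta>b v0 kern_nonneg by (intro mult_left_mono) auto
          then have "ennreal (kern 2 (z - \<zeta>) * v \<zeta> * (v \<zeta> * \<eta> (fst \<zeta>))) \<le> ennreal (kern 2 (z - \<zeta>)) * ennreal ((v \<zeta>)\<^sup>2)"
            using kern_nonneg by (subst ennreal_mult[symmetric]) (auto simp: power2_eq_square mult.assoc intro!: ennreal_leI)
          moreover have "fst (z - \<zeta>) < R" if "z \<in> ?W" using that True by auto
          ultimately show "ennreal (kern 2 (z - \<zeta>) * v \<zeta> * (v \<zeta> * \<eta> (fst \<zeta>))) * indicator ?W z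
            \<le> (ennreal (kern 2 (z - \<zeta>)) * indicator {z. fst z < R} (z - \<zeta>)) * ennreal ((v \<zeta>)\<^sup>2)"
            by (cases "z \<in> ?W") auto
        qed
        also have "\<dots> = (\<integral>\<^sup>+z. ennreal (kern 2 (z - \<zeta>)) * indicator {z. fst z < R} (z - \<zeta>) \<partial>lborel) * ennreal ((v \<zeta>)\<^sup>2)"
          by (rule nn_integral_multc) measurable
        also have "(\<integral>\<^sup>+z. ennreal (kern 2 (z - \<zeta>)) * indicator {z. fst z < R} (z - \<zeta>) \<partial>lborel)
           = (\<integral>\<^sup>+z. ennreal (kern 2 z) * indicator {z. fst z < R} z \<partial>lborel)"
          by (rule nn_integral_translate_reflect(2)[of "\<lambda>z. ennreal (kern 2 z) * indicator {z. fst z < R} z"]) measurable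
        also have "\<dots> * ennreal ((v \<zeta>)\<^sup>2) \<le> ennreal c2 * ennreal ((v \<zeta>)\<^sup>2)"
          by (intro mult_right_mono c2) simp
        finally show ?thesis .
      qed (simp add: vW)
    qed
    also have "\<dots> < \<infinity>" using vint by (subst nn_integral_cmult) (auto simp: ennreal_mult_less_top)
    finally show ?thesis .
  qed
  \<comment> \<open>A real valued copy of the bound. Where \<open>B\<close> is infinite it takes the
    value 0, which inside the window concerns a null set.\<close>
  define \<beta> where "\<beta> z = enn2real (B z) * indicat_real ?W z" for z
  have [measurable]: "\<beta> \<in> borel_measurable borel" unfolding \<beta>_def[abs_def] by measurable
  have \<beta>0: "0 \<le> \<beta> z" for z by (simp add: \<beta>_def)
  have Bfin: "AE z in lborel. z \<in> ?W \<longrightarrow> B z < \<infinity>"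
  proof -
    have "AE z in lborel. B2 z * indicator ?W z \<noteq> \<infinity>"
      using B2int by (intro nn_integral_PInf_AE) auto
    then show ?thesis
      by eventually_elim (auto simp: B_def ennreal_mult_less_top less_top)
  qed
  have \<beta>le: "ennreal (\<beta> z) \<le> B z" for z
    by (cases "B z") (auto simp: \<beta>_def indicator_def)
  have f_int: "set_integrable lborel (cbox p q) f" for p q
    unfolding set_integrable_def
  proof (rule Bochner_Integration.integrable_bound[OF Bochner_Integration.integrable_add[OF f2]])
    show "integrable lborel (indicat_real (cbox p q))"
      by (intro integrable_real_indicator) (use emeasure_bounded_finite[OF bounded_cbox[of p q]] in auto)
    have "\<bar>f z\<bar> \<le> (f z)\<^sup>2 + 1" for z using sum_squares_bound[of "\<bar>f z\<bar>" 1] by (simp add: power2_abs)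
    then show "AE z in lborel. norm (indicat_real (cbox p q) z *\<^sub>R f z) \<le> norm ((f z)\<^sup>2 + indicat_real (cbox p q) z)"
      by (intro AE_I2) (simp add: indicator_def)
  qed measurable
  have \<beta>_int: "set_integrable lborel (cbox p q) \<beta>" for p q
    unfolding set_integrable_def
  proof (rule integrableI_nonneg)
    have "(\<integral>\<^sup>+z. ennreal (indicat_real (cbox p q) z *\<^sub>R \<beta> z) \<partial>lborel)
       \<le> (\<integral>\<^sup>+z. ennreal M * indicator (cbox p q) z + ennreal (9 * heat3_const) * (B2 z * indicator ?W z) \<partial>lborel)"
    proof (rule nn_integral_mono)
      fix z
      show "ennreal (indicat_real (cbox p q) z *\<^sub>R \<beta> z) \<le> ennreal M * indicator (cbox p q) z + ennreal (9 * heat3_const) * (B2 z * indicator ?W z)"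
      proof (cases "z \<in> cbox p q \<and> z \<in> ?W")
        case True then show ?thesis using \<beta>le[of z] by (simp add: B_def)
      next
        case False then show ?thesis by (auto simp: \<beta>_def)
      qed
    qed
    also have "\<dots> = ennreal M * emeasure lborel (cbox p q) + ennreal (9 * heat3_const) * (\<integral>\<^sup>+z. B2 z * indicator ?W z \<partial>lborel)"
      by (subst nn_integral_add, measurable) (subst nn_integral_cmult, measurable, simp add: nn_integral_cmult_indicator)
    also have "\<dots> < \<infinity>"
      using B2int emeasure_bounded_finite[OF bounded_cbox[of p q]] by (auto simp: ennreal_mult_less_top)
    finally show "(\<integral>\<^sup>+z. ennreal (indicat_real (cbox p q) z *\<^sub>R \<beta> z) \<partial>lborel) < \<infinity>" .
  qed (auto simp: \<beta>0)
  have le: "heat_mass * \<bar>\<integral>z. indicat_real (cbox p q) z * f z \<partial>lborel\<bar> \<le> (\<integral>z. indicat_real (cbox p q) z * \<beta> z \<partial>lborel)"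
    if sub: "cbox p q \<subseteq> ?W" for p q
  proof -
    define D where "D n z0 = (\<integral>z. f z * time_kernel (1 / real (Suc n)) (z0 - z) \<partial>lborel)" for n z0
    note ta = time_kernel_approximation[OF \<open>f \<in> borel_measurable borel\<close> f2, of p q, folded D_def]
    have "\<bar>\<integral>z0. indicat_real (cbox p q) z0 * D n z0 \<partial>lborel\<bar> \<le> (\<integral>z. indicat_real (cbox p q) z * \<beta> z \<partial>lborel)" for n
    proof -
      have "\<bar>\<integral>z0. indicat_real (cbox p q) z0 * D n z0 \<partial>lborel\<bar> \<le> (\<integral>z0. \<bar>indicat_real (cbox p q) z0 * D n z0\<bar> \<partial>lborel)"
        by (rule integral_abs_bound)
      also have "\<dots> \<le> (\<integral>z. indicat_real (cbox p q) z * \<beta> z \<partial>lborel)"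
      proof (rule integral_mono_AE)
        show "integrable lborel (\<lambda>z0. \<bar>indicat_real (cbox p q) z0 * D n z0\<bar>)"
          by (intro integrable_abs ta)
        show "integrable lborel (\<lambda>z. indicat_real (cbox p q) z * \<beta> z)"
          using \<beta>_int[of p q] by (simp add: set_integrable_def)
        show "AE z in lborel. \<bar>indicat_real (cbox p q) z * D n z\<bar> \<le> indicat_real (cbox p q) z * \<beta> z"
          using Bfin
        proof eventually_elim
          case (elim z)
          show ?case
          proof (cases "z \<in> cbox p q")
            case True
            then have zW: "z \<in> ?W" using sub by blast
            have "ennreal \<bar>D n z\<bar> \<le> B z" unfolding D_def by (rule bound[OF zW]) simp
            also have "B z = ennreal (enn2real (B z))" using elim zW by (simp add: less_top)
            finally have "\<bar>D n z\<bar> \<le> enn2real (B z)" by (simp add: ennreal_le_iff)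
            then show ?thesis using True zW by (simp add: \<beta>_def)
          qed simp
        qed
      qed
      finally show ?thesis .
    qed
    moreover have "(\<lambda>n. \<bar>\<integral>z0. indicat_real (cbox p q) z0 * D n z0 \<partial>lborel\<bar>)
      \<longlonglongrightarrow> \<bar>heat_mass * (\<integral>z. indicat_real (cbox p q) z * f z \<partial>lborel)\<bar>"
      by (intro tendsto_rabs ta)
    ultimately have "\<bar>heat_mass * (\<integral>z. indicat_real (cbox p q) z * f z \<partial>lborel)\<bar> \<le> (\<integral>z. indicat_real (cbox p q) z * \<beta> z \<partial>lborel)"
      by (intro LIMSEQ_le_const2) auto
    then show ?thesis using heat_mass_pos by (simp add: abs_mult)
  qed
  have "AE z in lborel. z \<in> ?W \<longrightarrow> heat_mass * \<bar>f z\<bar> \<le> \<beta> z"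
    by (rule cube_average_le[OF f_int \<beta>_int heat_mass_pos openW le])
  then show ?thesis
  proof eventually_elim
    case (elim z)
    show ?case
    proof
      assume z: "fst z \<in> {b<..<b + R}"
      then have "heat_mass * \<bar>U z $ k * \<eta> (fst z)\<bar> \<le> \<beta> z" using elim by (simp add: f_def)
      then have "ennreal (heat_mass * \<bar>U z $ k * \<eta> (fst z)\<bar>) \<le> ennreal (\<beta> z)" by (rule ennreal_leI)
      also note \<beta>le
      finally show "ennreal (heat_mass * \<bar>U z $ k * \<eta> (fst z)\<bar>)
       \<le> ennreal (heat_const * step_const * inverse R * (A powr (1/6) * \<kappa> powr (5/6)))
       + ennreal (9 * heat3_const) * (\<integral>\<^sup>+\<zeta>. ennreal (kern 2 (z - \<zeta>) * v \<zeta> * (v \<zeta> * \<eta> (fst \<zeta>))) \<partial>lborel)"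
        unfolding B_def M_def B2_def .
    qed
  qed
qed

end

text \<open>The constant is fixed before the field, \<open>T\<close> and \<open>I\<close>, so every
  estimate has to see the field through \<open>I\<close> alone. The conclusion is drawn on the
  second half of the window, where the cutoff equals 1.\<close>

lemma interior_bound:
  assumes lam: "0 < lam"
  shows "\<exists>B>0. \<forall>U T I. pressure_free_flow U \<longrightarrow> lam < T \<longrightarrow> 0 \<le> I \<longrightarrow>
    (\<integral>\<^sup>+z. ennreal (norm (U z) ^ 6) * indicator {z. 0 < fst z \<and> fst z < T} z \<partial>lborel) \<le> ennreal I \<longrightarrow>
    (\<exists>d>0. d < T \<and> (AE z in lborel. T - d < fst z \<and> fst z < T \<longrightarrow> norm (U z) \<le> B * (1 + I)))"
proof -
  note C3 = heat3_const(1) and C1 = heat_const(1) and E = step_const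
  have kc: "\<exists>c>0. \<forall>R>0. (\<integral>\<^sup>+z. ennreal (kern p z) * indicator {z. fst z < R} z \<partial>lborel) \<le> ennreal (c * R powr (5/2 - p))"
    if p: "3/2 < p" "p < 5/2" for p
  proof -
    obtain c where c: "0 \<le> c" "\<And>R. 0 < R \<Longrightarrow> (\<integral>\<^sup>+z. ennreal (kern p z) * indicator {z. fst z < R} z \<partial>lborel) \<le> ennreal (c * R powr (5/2 - p))"
      using nn_integral_kern[OF p] by blast
    have "(\<integral>\<^sup>+z. ennreal (kern p z) * indicator {z. fst z < R} z \<partial>lborel) \<le> ennreal ((c + 1) * R powr (5/2 - p))" if "0 < R" for R
      using c(2)[OF that] by (rule order_trans) (intro ennreal_leI mult_right_mono, auto)
    then show ?thesis using c(1) by (intro exI[of _ "c + 1"]) auto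
  qed
  obtain cA where cA: "0 < cA" "\<And>R. 0 < R \<Longrightarrow> (\<integral>\<^sup>+z. ennreal (kern (12/5) z) * indicator {z. fst z < R} z \<partial>lborel) \<le> ennreal (cA * R powr (1/10))"
    using kc[of "12/5"] by auto
  obtain cB where cB: "0 < cB" "\<And>R. 0 < R \<Longrightarrow> (\<integral>\<^sup>+z. ennreal (kern (9/5) z) * indicator {z. fst z < R} z \<partial>lborel) \<le> ennreal (cB * R powr (7/10))"
    using kc[of "9/5"] by auto
  obtain cC where cC: "0 < cC" "\<And>R. 0 < R \<Longrightarrow> (\<integral>\<^sup>+z. ennreal (kern 2 z) * indicator {z. fst z < R} z \<partial>lborel) \<le> ennreal (cC * R powr (1/2))"
    using kc[of 2] by auto
  let ?m = heat_mass
  have m: "0 < ?m" by (rule heat_mass_pos)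
  \<comment> \<open>Adding three components, each with the constant \<open>9 * heat3_const\<close>,
    gives 27; dividing by the mass of the kernel normalises the left side.\<close>
  define C where "C = 27 * heat3_const / ?m"
  have C: "0 < C" using C3 m by (simp add: C_def)
  \<comment> \<open>chosen so that the contraction condition of \<open>convolution_inequality_bounded\<close> holds for
    \<open>R = r / (1 + I)\<^sup>2\<close>, in which all powers of \<open>1 + I\<close> cancel\<close>
  define q where "q = 1 / (2 * (C * cA powr (5/6)))"
  have q: "0 < q" using C cA(1) by (simp add: q_def)
  \<comment> \<open>At most \<open>lam\<close>, so that the window starts at a nonnegative time. The
    twelfth power of \<open>q\<close> undoes the exponent 1/12 with which \<open>R\<close> enters
    the contraction condition.\<close>
  define r where "r = min lam (q powr 12)"
  have r: "0 < r" "r \<le> lam" "r \<le> q powr 12" using lam q by (auto simp: r_def)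
  have rq: "r powr (1/12) \<le> q"
  proof -
    have "r powr (1/12) \<le> (q powr 12) powr (1/12)" using r by (intro powr_mono2) auto
    also have "(q powr 12) powr (1/12) = q powr 1" by (simp only: powr_powr) simp
    finally show ?thesis using q by simp
  qed
  \<comment> \<open>The 6 is the 2 of \<open>convolution_inequality_bounded\<close> times the number
    of components.\<close>
  define B where "B = 6 * (heat_const * step_const * cB powr (5/6) * r powr (-5/12)) / ?m"
  have B: "0 < B" using C1 E cB r m by (simp add: B_def)
  have "\<exists>d>0. d < T \<and> (AE z in lborel. T - d < fst z \<and> fst z < T \<longrightarrow> norm (U z) \<le> B * (1 + I))"
    if flow: "pressure_free_flow U" and T: "lam < T" and I: "0 \<le> I"
      and U6: "(\<integral>\<^sup>+z. ennreal (norm (U z) ^ 6) * indicator {z. 0 < fst z \<and> fst z < T} z \<partial>lborel) \<le> ennreal I"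
    for U T I
  proof -
    interpret pressure_free_flow U by (rule flow)
    \<comment> \<open>Using \<open>1 + I\<close> in place of \<open>I\<close> keeps \<open>R\<close>
      at most \<open>r\<close> and provides a positive bound for the integral of the sixth power
      even when \<open>I\<close> is 0.\<close>
    define X where "X = 1 + I"
    have X: "1 \<le> X" "0 < X" using I by (auto simp: X_def)
    define R where "R = r / X\<^sup>2"
    have R: "0 < R" using r X by (simp add: R_def)
    have Rlam: "R \<le> lam"
    proof -
      have "1 \<le> X\<^sup>2" using X by (simp add: one_le_power)
      then have "R \<le> r" using r X by (simp add: R_def divide_le_eq)
      then show ?thesis using r by simp
    qed
    define b where "b = T - R"
    have b: "0 \<le> b" "b + R = T" using Rlam T by (auto simp: b_def)
    let ?W = "{z::real \<times> (real^3). fst z \<in> {b<..<b + R}}"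
    have [measurable]: "?W \<in> sets borel"
      by (simp only: greaterThanLessThan_iff) (intro borel_open open_Collect_conj open_Collect_less continuous_intros)
    define \<eta> where "\<eta> t = smooth_step ((t - b) * inverse R)" for t
    have \<eta>s: "smooth \<eta>"
      unfolding \<eta>_def[abs_def] by (intro smooth_compose[OF smooth_smooth_step] smooth_mult smooth_diff smooth_id smooth_const)
    have [measurable]: "\<eta> \<in> borel_measurable borel" by (rule smooth_borel[OF \<eta>s])
    have \<eta>b: "0 \<le> \<eta> t" "\<eta> t \<le> 1" for t using smooth_step_bounds by (auto simp: \<eta>_def)
    define v where "v z = norm (U z) * indicat_real ?W z" for z
    have [measurable]: "v \<in> borel_measurable borel" unfolding v_def[abs_def] by measurable
    have v0: "0 \<le> v z" for z by (simp add: v_def)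
    define w where "w z = v z * \<eta> (fst z)" for z
    have [measurable]: "w \<in> borel_measurable borel" unfolding w_def[abs_def] by measurable
    have v6: "(\<integral>\<^sup>+z. ennreal (v z ^ 6) \<partial>lborel) \<le> ennreal X"
    proof -
      have "(\<integral>\<^sup>+z. ennreal (v z ^ 6) \<partial>lborel) \<le> (\<integral>\<^sup>+z. ennreal (norm (U z) ^ 6) * indicator {z. 0 < fst z \<and> fst z < T} z \<partial>lborel)"
        using b by (intro nn_integral_mono) (auto simp: v_def indicator_def)
      also note U6
      also have "ennreal I \<le> ennreal X" by (intro ennreal_leI) (simp add: X_def)
      finally show ?thesis .
    qed
    define \<kappa>A \<kappa>B where "\<kappa>A = cA * R powr (1/10)" and "\<kappa>B = cB * R powr (7/10)"
    have \<kappa>: "0 < \<kappa>A" "0 < \<kappa>B" using cA cB R by (auto simp: \<kappa>A_def \<kappa>B_def)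
    have Rp: "R powr s = r powr s * X powr (- 2 * s)" for s
    proof -
      have "X\<^sup>2 = X powr 2" using X by simp
      then have "R powr s = r powr s / (X powr 2) powr s" using r X by (simp add: R_def powr_divide)
      then show ?thesis by (simp add: powr_powr powr_minus divide_inverse)
    qed
    \<comment> \<open>\<open>R powr (1/12)\<close> contributes the power -1/6 of \<open>X\<close>,
      which cancels the factor \<open>X powr (1/6)\<close>; this is the purpose of the square in the
      definition of \<open>R\<close>.\<close>
    have PA: "X powr (1/6) * \<kappa>A powr (5/6) = cA powr (5/6) * r powr (1/12)"
    proof -
      have "\<kappa>A powr (5/6) = cA powr (5/6) * (R powr (1/12))"
        using cA R by (simp add: \<kappa>A_def powr_mult powr_powr)
      also have "R powr (1/12) = r powr (1/12) * X powr (- (1/6))" by (simp add: Rp)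
      finally show ?thesis using X by (simp add: powr_minus field_simps)
    qed
    \<comment> \<open>Here 7/12 is 5/6 of 7/10, and the powers of \<open>X\<close> add up to 1/6 -
      7/6 = -1. The factor \<open>inverse R\<close> contributes two more, which leaves exactly one
      power of \<open>X\<close> in the final bound.\<close>
    have PB: "X powr (1/6) * \<kappa>B powr (5/6) = cB powr (5/6) * r powr (7/12) * inverse X"
    proof -
      have "\<kappa>B powr (5/6) = cB powr (5/6) * (R powr (7/12))"
        using cB R by (simp add: \<kappa>B_def powr_mult powr_powr)
      also have "R powr (7/12) = r powr (7/12) * X powr (- (7/6))" by (simp add: Rp)
      also have "X powr (- (7/6)) = X powr (- (1/6)) * inverse X"
        using X powr_add[of X "- (1/6)" "- 1"] by (simp add: powr_minus)
      finally show ?thesis using X by (simp add: powr_minus field_simps)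
    qed
    define M1 where "M1 = heat_const * step_const * inverse R * (X powr (1/6) * \<kappa>B powr (5/6))"
    have M1: "0 < M1" using C1 E R X \<kappa> by (simp add: M1_def)
    have M1eq: "6 * M1 / ?m = B * X"
    proof -
      have "inverse R * (r powr (7/12) * inverse X) = r powr (-5/12) * X"
      proof -
        have "r powr (7/12) = r powr (-5/12) * r" using r powr_add[of r "-5/12" 1] by simp
        then show ?thesis using r X by (simp add: R_def power2_eq_square)
      qed
      then have "M1 = heat_const * step_const * cB powr (5/6) * (r powr (-5/12) * X)"
        unfolding M1_def PB by (simp only: mult.assoc mult.left_commute[of "inverse R"])
      then show ?thesis by (simp add: B_def)
    qed
    have AEk: "AE z in lborel. fst z \<in> {b<..<b + R} \<longrightarrow> ennreal (?m * \<bar>U z $ k * \<eta> (fst z)\<bar>)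
     \<le> ennreal M1 + ennreal (9 * heat3_const) * (\<integral>\<^sup>+\<zeta>. ennreal (kern 2 (z - \<zeta>) * v \<zeta> * w \<zeta>) \<partial>lborel)" for k
      using AE_integral_inequality[OF b(1) R _ cC(2)[OF R] _ cB(2)[OF R] X(2) v6[unfolded v_def], of k]
        C3 C1 cC(1) cB(1) \<kappa>
      unfolding \<eta>_def[symmetric] v_def[symmetric] w_def[symmetric] \<kappa>B_def[symmetric] M1_def by auto
    have ineq: "AE z in lborel. fst z \<in> {b<..<b + R} \<longrightarrow>
      ennreal (w z) \<le> ennreal (3 * M1 / ?m) + ennreal C * (\<integral>\<^sup>+\<zeta>. ennreal (kern 2 (z - \<zeta>) * v \<zeta> * w \<zeta>) \<partial>lborel)"
    proof -
      \<comment> \<open>The exceptional null set depends on the component; a finite union removes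
        the dependence before the components are added.\<close>
      have "AE z in lborel. \<forall>k\<in>(UNIV::3 set). fst z \<in> {b<..<b + R} \<longrightarrow> ennreal (?m * \<bar>U z $ k * \<eta> (fst z)\<bar>)
        \<le> ennreal M1 + ennreal (9 * heat3_const) * (\<integral>\<^sup>+\<zeta>. ennreal (kern 2 (z - \<zeta>) * v \<zeta> * w \<zeta>) \<partial>lborel)"
        by (rule AE_finite_allI, simp, rule AEk)
      then show ?thesis
      proof eventually_elim
        case (elim z)
        show ?case
        proof
          assume z: "fst z \<in> {b<..<b + R}"
          define J where "J = (\<integral>\<^sup>+\<zeta>. ennreal (kern 2 (z - \<zeta>) * v \<zeta> * w \<zeta>) \<partial>lborel)"
          have k: "ennreal (?m * \<bar>U z $ k * \<eta> (fst z)\<bar>) \<le> ennreal M1 + ennreal (9 * heat3_const) * J" for k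
            using elim z by (simp add: J_def)
          show "ennreal (w z) \<le> ennreal (3 * M1 / ?m) + ennreal C * J"
          proof (cases "J = \<infinity>")
            case True then show ?thesis using C by (simp add: ennreal_mult_top)
          next
            case False
            define j where "j = enn2real J"
            have j: "J = ennreal j" "0 \<le> j" using False by (auto simp: j_def ennreal_enn2real_if)
            have k': "?m * \<bar>U z $ k * \<eta> (fst z)\<bar> \<le> M1 + 9 * heat3_const * j" for k
            proof -
              have "ennreal M1 + ennreal (9 * heat3_const) * J = ennreal (M1 + 9 * heat3_const * j)"
                unfolding j(1) using M1 C3 j(2) by (subst ennreal_plus) (auto simp: ennreal_mult)
              with k[of k] have "ennreal (?m * \<bar>U z $ k * \<eta> (fst z)\<bar>) \<le> ennreal (M1 + 9 * heat3_const * j)" by (rule ord_le_eq_trans)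
              then show ?thesis by (rule ennreal_le_iff[THEN iffD1, rotated]) (use M1 C3 j(2) in auto)
            qed
            have "w z \<le> (\<Sum>k\<in>UNIV. \<bar>U z $ k * \<eta> (fst z)\<bar>)"
            proof -
              have "w z = norm (U z) * \<eta> (fst z)" using z by (simp add: w_def v_def)
              also have "\<dots> \<le> (\<Sum>k\<in>UNIV. \<bar>U z $ k\<bar>) * \<eta> (fst z)"
                using \<eta>b by (intro mult_right_mono norm_le_l1_cart) auto
              also have "\<dots> = (\<Sum>k\<in>UNIV. \<bar>U z $ k * \<eta> (fst z)\<bar>)"
                using \<eta>b by (simp add: sum_distrib_right abs_mult)
              finally show ?thesis .
            qed
            then have "?m * w z \<le> (\<Sum>k\<in>(UNIV::3 set). ?m * \<bar>U z $ k * \<eta> (fst z)\<bar>)"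
              using m by (subst sum_distrib_left[symmetric]) (simp add: mult_left_mono)
            also have "\<dots> \<le> (\<Sum>k\<in>(UNIV::3 set). M1 + 9 * heat3_const * j)" by (rule sum_mono) (rule k')
            also have "\<dots> = 3 * M1 + 27 * heat3_const * j" by simp
            finally have "w z \<le> (3 * M1 + 27 * heat3_const * j) / ?m" using m by (simp add: pos_le_divide_eq mult.commute)
            then have "w z \<le> 3 * M1 / ?m + C * j" by (simp add: C_def add_divide_distrib)
            then have "ennreal (w z) \<le> ennreal (3 * M1 / ?m + C * j)" by (rule ennreal_leI)
            also have "\<dots> = ennreal (3 * M1 / ?m) + ennreal C * J"
              unfolding j(1) using M1 m C j(2) by (subst ennreal_plus) (auto simp: ennreal_mult)
            finally show ?thesis .
          qed
        qed
      qed
    qed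
    have "AE z in lborel. w z \<le> 2 * (3 * M1 / ?m)"
    proof (rule convolution_inequality_bounded[OF _ _ v0 _ _ ineq _ X(2) v6 \<kappa>(1) cA(2)[OF R, folded \<kappa>A_def] C _ _ R])
      show "0 \<le> w z" for z using v0 \<eta>b by (simp add: w_def)
      show "w z = 0" if "fst z \<notin> {b<..<b + R}" for z using that by (simp add: w_def v_def)
      show "C * (X powr (1/6) * \<kappa>A powr (5/6)) \<le> 1/2"
      proof -
        have "C * (X powr (1/6) * \<kappa>A powr (5/6)) = C * cA powr (5/6) * r powr (1/12)" unfolding PA by simp
        also have "\<dots> \<le> C * cA powr (5/6) * q" using C by (intro mult_left_mono rq) auto
        also have "\<dots> = 1/2" using C cA(1) by (simp add: q_def)
        finally show ?thesis .
      qed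
      show "0 < 3 * M1 / ?m" using M1 m by simp
      have "(\<integral>\<^sup>+z. ennreal ((w z)\<^sup>2) \<partial>lborel)
        \<le> (\<integral>\<^sup>+z. ennreal ((norm (U z))\<^sup>2) * indicator {z. 0 < fst z \<and> fst z < b + R} z \<partial>lborel)"
      proof (rule nn_integral_mono)
        fix z
        have "(w z)\<^sup>2 \<le> (v z)\<^sup>2"
          using v0[of z] \<eta>b[of "fst z"] by (simp add: w_def power_mult_distrib mult_left_le power_le_one)
        then have "ennreal ((w z)\<^sup>2) \<le> ennreal ((v z)\<^sup>2)" by (rule ennreal_leI)
        also have "\<dots> \<le> ennreal ((norm (U z))\<^sup>2) * indicator {z. 0 < fst z \<and> fst z < b + R} z"
          using b by (auto simp: v_def indicator_def)
        finally show "ennreal ((w z)\<^sup>2) \<le> ennreal ((norm (U z))\<^sup>2) * indicator {z. 0 < fst z \<and> fst z < b + R} z" .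
      qed
      then show "(\<integral>\<^sup>+z. ennreal ((w z)\<^sup>2) \<partial>lborel) < \<infinity>" using U_L2[of "b + R"] by (rule le_less_trans)
    qed measurable
    then have "AE z in lborel. T - R/2 < fst z \<and> fst z < T \<longrightarrow> norm (U z) \<le> B * (1 + I)"
    proof eventually_elim
      case (elim z)
      show ?case
      proof
        assume z: "T - R/2 < fst z \<and> fst z < T"
        then have zW: "fst z \<in> {b<..<b + R}" using b R by auto
        have "1/2 \<le> (fst z - b) * inverse R"
          using z R by (simp add: b_def divide_inverse[symmetric] pos_le_divide_eq field_simps)
        then have "\<eta> (fst z) = 1" unfolding \<eta>_def by (rule smooth_step_eq_1)
        then have "norm (U z) = w z" using zW by (simp add: w_def v_def)
        also have "\<dots> \<le> 6 * M1 / ?m" using elim by simp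
        also have "\<dots> = B * (1 + I)" unfolding M1eq X_def ..
        finally show "norm (U z) \<le> B * (1 + I)" .
      qed
    qed
    then show ?thesis using R Rlam T lam by (intro exI[of _ "R/2"]) auto
  qed
  then show ?thesis using B by blast
qed

section \<open>A Borel representative of the solution\<close>

lemma AE_lebesgue_on_positive:
  assumes "AE t in lebesgue_on {0<..}. P t"
  shows "AE t in lborel. 0 < (t::real) \<longrightarrow> P t"
proof -
  have "AE t in lebesgue. t \<in> {0<..} \<longrightarrow> P t"
    using assms by (subst (asm) AE_restrict_space_iff) auto
  then have "AE t in lborel. t \<in> {0<..} \<longrightarrow> P t" by (simp only: AE_completion_iff)
  then show ?thesis by simp
qed

lemma AE_spacetime_slices:
  assumes "AE z in (lborel :: (real \<times> (real^3)) measure). P z"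
  shows "AE t in lborel. AE x in lborel. P (t, x)"
proof (rule lborel_pair.AE_pair)
  show "AE z in lborel \<Otimes>\<^sub>M lborel. P z" unfolding lborel_prod by (rule assms)
qed

text \<open>A Lebesgue measurable field agrees almost everywhere with a Borel one, component by
  component. The integrals in the equation and in the energy bound do not see the difference, so the
  Borel copy inherits both.\<close>

lemma NS_solution_flow:
  assumes "NS_solution u"
  shows "\<exists>U. pressure_free_flow U \<and> (AE z in lborel. 0 < fst z \<longrightarrow> U z = u (fst z) (snd z))"
proof -
  from assms obtain p where energy: "energy_class u" and NS: "NS_equations u p"
    unfolding NS_solution_def by blast
  have um: "(\<lambda>(t, x). u t x) \<in> borel_measurable (lebesgue_on spacetime)"
    using energy unfolding energy_class_def by blast
  obtain C :: real where C: "AE t in lebesgue_on {0<..}. u t \<in> L2 \<and> sq_L2_norm (u t) \<le> ennreal C"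
    using energy unfolding energy_class_def by blast
  have S: "spacetime \<in> sets lebesgue"
    by (intro lborelD sets_completionI_sets borel_open open_Times) auto
  have comp: "(\<lambda>(t, x). u t x $ i) \<in> borel_measurable (lebesgue_on spacetime)" for i
  proof -
    have "(\<lambda>v::real^3. v $ i) \<in> borel_measurable borel"
      by (intro borel_measurable_continuous_onI continuous_intros)
    from measurable_compose[OF um this] show ?thesis by (simp add: case_prod_beta')
  qed
  have "\<exists>g. g \<in> borel_measurable borel \<and> (AE z in lborel. 0 < fst z \<longrightarrow> u (fst z) (snd z) $ i = g z)" for i
  proof -
    have "(\<lambda>z. indicator spacetime z *\<^sub>R (case z of (t, x) \<Rightarrow> u t x $ i)) \<in> borel_measurable lebesgue"
      using comp[of i] S by (subst (asm) borel_measurable_restrict_space_iff) auto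
    from completion_ex_borel_measurable_real[OF this]
    obtain g where g: "g \<in> borel_measurable lborel"
      "AE z in lborel. indicator spacetime z *\<^sub>R (case z of (t, x) \<Rightarrow> u t x $ i) = g z" by blast
    from g(2) have "AE z in lborel. 0 < fst z \<longrightarrow> u (fst z) (snd z) $ i = g z"
    proof eventually_elim
      case (elim z)
      show ?case
      proof
        assume "0 < fst z"
        then have "z \<in> spacetime" by (cases z) auto
        then show "u (fst z) (snd z) $ i = g z" using elim by (simp add: case_prod_beta)
      qed
    qed
    then show ?thesis using g(1) by auto
  qed
  then have "\<exists>g. \<forall>i. g i \<in> borel_measurable borel \<and> (AE z in lborel. 0 < fst z \<longrightarrow> u (fst z) (snd z) $ i = g i z)"
    by (intro choice allI)
  then obtain g where g: "\<And>i. g i \<in> borel_measurable borel"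
    "\<And>i. AE z in lborel. 0 < fst z \<longrightarrow> u (fst z) (snd z) $ i = g i z" by blast
  define U where "U z = (\<chi> i. g i z)" for z
  have [measurable]: "U \<in> borel_measurable borel"
  proof (rule borel_measurable_euclidean_space[THEN iffD2], rule ballI)
    fix b :: "real^3" assume "b \<in> Basis"
    then obtain i where "b = axis i 1" by (auto simp: Basis_vec_def)
    then show "(\<lambda>z. U z \<bullet> b) \<in> borel_measurable borel" using g(1)[of i] by (simp add: U_def inner_axis)
  qed
  have Uu: "AE z in lborel. 0 < fst z \<longrightarrow> U z = u (fst z) (snd z)"
  proof -
    have "AE z in lborel. \<forall>i\<in>(UNIV::3 set). 0 < fst z \<longrightarrow> u (fst z) (snd z) $ i = g i z"
      by (rule AE_finite_allI, simp, rule g(2))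
    then show ?thesis by eventually_elim (auto simp: U_def vec_eq_iff)
  qed
  have "pressure_free_flow U"
  proof
    show "U \<in> borel_measurable borel" by simp
  next
    fix b :: real
    have [measurable]: "{z::real \<times> (real^3). 0 < fst z \<and> fst z < b} \<in> sets borel"
      by (intro borel_open open_Collect_conj open_Collect_less continuous_intros)
    have "(\<integral>\<^sup>+z. ennreal ((norm (U z))\<^sup>2) * indicator {z. 0 < fst z \<and> fst z < b} z \<partial>lborel)
      = (\<integral>\<^sup>+t. \<integral>\<^sup>+x. ennreal ((norm (U (t, x)))\<^sup>2) * indicator {z. 0 < fst z \<and> fst z < b} (t, x) \<partial>lborel \<partial>lborel)"
      by (rule nn_integral_spacetime) measurable
    also have "\<dots> \<le> (\<integral>\<^sup>+t. ennreal C * indicator {0..b} t \<partial>lborel)"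
    proof (rule nn_integral_mono_AE)
      show "AE t in lborel. (\<integral>\<^sup>+x. ennreal ((norm (U (t, x)))\<^sup>2) * indicator {z. 0 < fst z \<and> fst z < b} (t, x) \<partial>lborel) \<le> ennreal C * indicator {0..b} t"
        using AE_spacetime_slices[OF Uu] AE_lebesgue_on_positive[OF C]
      proof eventually_elim
        case (elim t)
        show ?case
        proof (cases "0 < t \<and> t < b")
          case True
          have "(\<integral>\<^sup>+x. ennreal ((norm (U (t, x)))\<^sup>2) * indicator {z. 0 < fst z \<and> fst z < b} (t, x) \<partial>lborel) = (\<integral>\<^sup>+x. ennreal ((norm (u t x))\<^sup>2) \<partial>lborel)"
            by (rule nn_integral_cong_AE) (use elim(1) True in auto)
          also have "\<dots> = sq_L2_norm (u t)" unfolding sq_L2_norm_def by (rule nn_integral_completion[symmetric])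
          also have "\<dots> \<le> ennreal C" using elim(2) True by blast
          finally show ?thesis using True by simp
        next
          case False
          then have "(t, x) \<notin> {z. 0 < fst z \<and> fst z < b}" for x :: "real^3" by simp
          then show ?thesis by simp
        qed
      qed
    qed
    also have "\<dots> < \<infinity>"
      by (subst nn_integral_cmult_indicator) (auto simp: ennreal_mult_less_top emeasure_lborel_Icc_eq)
    finally show "(\<integral>\<^sup>+z. ennreal ((norm (U z))\<^sup>2) * indicator {z. 0 < fst z \<and> fst z < b} z \<partial>lborel) < \<infinity>" .
  next
    fix \<Psi> k assume \<Psi>: "\<Psi> \<in> test_functions spacetime"
    have cm: "(\<lambda>z. U z $ i) \<in> borel_measurable borel" for i using g(1)[of i] by (simp add: U_def)
    have f1: "dist_of spacetime (\<lambda>(t, x). u t x $ i) \<phi> = (\<integral>z. U z $ i * \<phi> z \<partial>lborel)"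
      if "\<phi> \<in> test_functions spacetime" for \<phi> i
      by (rule dist_of_spacetime_eq[OF comp cm _ that])
         (use Uu in \<open>eventually_elim; simp add: case_prod_beta\<close>)
    have f2: "dist_of spacetime (\<lambda>(t, x). u t x $ i * u t x $ j) \<phi> = (\<integral>z. (U z $ i * U z $ j) * \<phi> z \<partial>lborel)"
      if "\<phi> \<in> test_functions spacetime" for \<phi> i j
    proof (rule dist_of_spacetime_eq[OF _ _ _ that])
      show "(\<lambda>(t, x). u t x $ i * u t x $ j) \<in> borel_measurable (lebesgue_on spacetime)"
        using borel_measurable_times[OF comp[of i] comp[of j]] by (simp add: case_prod_beta')
      show "(\<lambda>z. U z $ i * U z $ j) \<in> borel_measurable borel" by (intro borel_measurable_times cm)
      show "AE z in lborel. 0 < fst z \<longrightarrow> (case z of (t, x) \<Rightarrow> u t x $ i * u t x $ j) = U z $ i * U z $ j"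
        using Uu by eventually_elim (simp add: case_prod_beta)
    qed
    have t: "pderivs vs \<Psi> \<in> test_functions spacetime" if "set vs \<subseteq> Basis" for vs
      by (rule pderivs_test_functions[OF \<Psi> that])
    have sub: "set [e_time, e_space j, e_space j] \<subseteq> Basis" "set [e_space l, e_space l, e_space j, e_space j] \<subseteq> Basis"
      "set [e_space l, e_space i, e_space j] \<subseteq> Basis" for i j l :: 3
      using e_space_Basis e_time_Basis by auto
    show "(\<Sum>j\<in>UNIV. \<integral>z. U z $ k * pderivs [e_time, e_space j, e_space j] \<Psi> z \<partial>lborel)
      + (\<Sum>j\<in>UNIV. \<Sum>l\<in>UNIV. \<integral>z. U z $ k * pderivs [e_space l, e_space l, e_space j, e_space j] \<Psi> z \<partial>lborel)
    = (\<Sum>i\<in>UNIV. \<Sum>j\<in>UNIV. \<integral>z. (U z $ i * U z $ j) * pderivs [e_space j, e_space i, e_space k] \<Psi> z \<partial>lborel)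
      - (\<Sum>j\<in>UNIV. \<Sum>l\<in>UNIV. \<integral>z. (U z $ k * U z $ l) * pderivs [e_space l, e_space j, e_space j] \<Psi> z \<partial>lborel)"
      unfolding f1[OF t[OF sub(1)], symmetric] f1[OF t[OF sub(2)], symmetric] f2[OF t[OF sub(3)], symmetric]
      using pressure_free_equation[OF NS \<Psi>, of k] by simp
  qed
  then show ?thesis using Uu by blast
qed

section \<open>The bound at a fixed time\<close>

lemma good_time_exists:
  assumes "AE s in lborel. P s" "a < (b::real)"
  shows "\<exists>s. a < s \<and> s < b \<and> P s"
proof (rule ccontr)
  assume "\<not> ?thesis"
  then have "AE s in lborel. s \<notin> {a<..<b}" using assms(1) by (auto elim!: eventually_mono)
  then have "{a<..<b} \<in> null_sets lborel" by (rule AE_iff_null_sets[THEN iffD2, rotated]) simp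
  then have "emeasure lborel {a<..<b} = 0" by (rule null_setsD1)
  then show False using assms(2) by (simp add: ennreal_eq_0_iff)
qed

text \<open>An upper bound for one signed component survives weak limits. The set \<open>E\<close>
  of violations inside a ball is tested with its indicator times a signed unit vector: at good times
  close to \<open>T\<close> the pairing is at most \<open>N\<close> times the measure of
  \<open>E\<close>, hence also at \<open>T\<close>, and this forces \<open>E\<close> to be
  null.\<close>

lemma weak_limit_component_le:
  fixes u :: "real \<Rightarrow> real^3 \<Rightarrow> real^3"
  assumes wc: "weakly_continuous_L2 u" and T: "0 < T" and d: "0 < d" "d < T"
    and bd: "AE s in lborel. T - d < s \<and> s < T \<longrightarrow> (AE x in lborel. norm (u s x) \<le> N)"
    and c: "\<bar>c\<bar> = 1"
  shows "AE x in lebesgue. c * u T x $ k \<le> N"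
proof -
  have L2: "u t \<in> L2" if "0 < t" for t using wc that unfolding weakly_continuous_L2_def by blast
  have um: "(\<lambda>x. u t x $ k) \<in> borel_measurable lebesgue" if "0 < t" for t
  proof -
    have "(\<lambda>v::real^3. v $ k) \<in> borel_measurable borel"
      by (intro borel_measurable_continuous_onI continuous_intros)
    moreover have "u t \<in> borel_measurable lebesgue" using L2[OF that] by (simp add: L2_def)
    ultimately show ?thesis by (rule measurable_compose[rotated])
  qed
  have N0: "0 \<le> N"
  proof -
    obtain s where s: "T - d < s" "s < T" "AE x in lborel. norm (u s x) \<le> N"
      using good_time_exists[OF bd, of "T - d" T] d by auto
    show ?thesis
    proof (rule ccontr)
      assume "\<not> 0 \<le> N"
      from s(3) have "AE x in (lborel :: (real^3) measure). False"
        by eventually_elim (use \<open>\<not> 0 \<le> N\<close> norm_ge_zero order_trans in blast)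
      then have "ae_filter (lborel :: (real^3) measure) = bot" by (simp only: eventually_False)
      then show False unfolding ae_filter_eq_bot_iff by (simp add: emeasure_lborel_UNIV)
    qed
  qed
  \<comment> \<open>Restriction to balls gives \<open>E\<close> finite measure, so that its
    indicator is square integrable and may be used in the weak continuity.\<close>
  have "AE x in lebesgue. x \<in> cball 0 (real n) \<longrightarrow> c * u T x $ k \<le> N" for n
  proof -
    define E where "E = {x \<in> cball 0 (real n). N < c * u T x $ k}"
    have E[measurable]: "E \<in> sets lebesgue"
    proof -
      have "{x \<in> space lebesgue. N < c * u T x $ k} \<in> sets lebesgue"
        using um[OF T] by measurable
      moreover have "cball 0 (real n) \<in> sets (lebesgue :: (real^3) measure)" by simp
      ultimately have "cball 0 (real n) \<inter> {x \<in> space lebesgue. N < c * u T x $ k} \<in> sets lebesgue" by (rule sets.Int[rotated])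
      moreover have "cball 0 (real n) \<inter> {x \<in> space lebesgue. N < c * u T x $ k} = E" by (auto simp: E_def)
      ultimately show ?thesis by simp
    qed
    have Efin: "emeasure lebesgue E < \<infinity>"
    proof -
      have "emeasure lebesgue E \<le> emeasure lebesgue (cball 0 (real n) :: (real^3) set)"
        by (intro emeasure_mono) (auto simp: E_def)
      also have "\<dots> < \<infinity>" using emeasure_bounded_finite[OF bounded_cball[of "0::real^3" "real n"]] by simp
      finally show ?thesis .
    qed
    have Eint: "integrable lebesgue (indicat_real E)" by (rule integrable_real_indicator[OF E Efin])
    define w where "w x = indicat_real E x *\<^sub>R axis k c" for x :: "real^3"
    have wL2: "w \<in> L2"
    proof -
      have "w \<in> borel_measurable lebesgue" unfolding w_def[abs_def] by measurable
      moreover have "sq_L2_norm w = (\<integral>\<^sup>+x. indicator E x \<partial>lebesgue)"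
        unfolding sq_L2_norm_def w_def
      proof (rule nn_integral_cong)
        have "(axis k c :: real^3) = c *\<^sub>R axis k 1" by (simp add: vec_eq_iff axis_def)
        then have "norm (axis k c :: real^3) = 1" using c by simp
        then show "ennreal ((norm (indicat_real E x *\<^sub>R (axis k c :: real^3)))\<^sup>2) = indicator E x" for x
          by (simp add: indicator_def)
      qed
      ultimately show ?thesis using Efin by (simp add: L2_def)
    qed
    have inner: "u t x \<bullet> w x = indicat_real E x * (c * u t x $ k)" for t x
      by (simp add: w_def inner_axis mult.commute)
    have uint: "integrable lebesgue (\<lambda>x. indicat_real E x * (c * u t x $ k))" if t: "0 < t" for t
    proof (rule Bochner_Integration.integrable_bound)
      show "integrable lebesgue (\<lambda>x. (norm (u t x))\<^sup>2 + indicat_real E x)"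
      proof (rule Bochner_Integration.integrable_add[OF _ Eint])
        show "integrable lebesgue (\<lambda>x. (norm (u t x))\<^sup>2)"
          using L2[OF t] by (intro integrableI_nonneg) (auto simp: L2_def sq_L2_norm_def)
      qed
      show "(\<lambda>x. indicat_real E x * (c * u t x $ k)) \<in> borel_measurable lebesgue"
        using um[OF t] by measurable
      have "\<bar>c * u t x $ k\<bar> \<le> (norm (u t x))\<^sup>2 + 1" for x
      proof -
        have "\<bar>c * u t x $ k\<bar> \<le> norm (u t x)" using c component_le_norm_cart[of "u t x" k] by (simp add: abs_mult)
        also have "\<dots> \<le> (norm (u t x))\<^sup>2 + 1"
          using sum_squares_bound[of "norm (u t x)" 1] norm_ge_zero[of "u t x"] by (simp del: norm_ge_zero)
        finally show ?thesis .
      qed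
      then show "AE x in lebesgue. norm (indicat_real E x * (c * u t x $ k)) \<le> norm ((norm (u t x))\<^sup>2 + indicat_real E x)"
        by (intro AE_I2) (simp add: indicator_def)
    qed
    define g where "g t = (\<integral>x. indicat_real E x * (c * u t x $ k) \<partial>lebesgue)" for t
    have gcont: "continuous_on {0<..} g"
      using wc wL2 unfolding weakly_continuous_L2_def g_def inner[symmetric] by blast
    have gle: "g t \<le> N * measure lebesgue E" if t: "0 < t" "AE x in lborel. norm (u t x) \<le> N" for t
    proof -
      have "g t \<le> (\<integral>x. N * indicat_real E x \<partial>lebesgue)"
        unfolding g_def
      proof (rule integral_mono_AE[OF uint[OF t(1)] integrable_mult_right[OF Eint]])
        have "AE x in lebesgue. norm (u t x) \<le> N" by (rule AE_completion[OF t(2)])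
        then show "AE x in lebesgue. indicat_real E x * (c * u t x $ k) \<le> N * indicat_real E x"
        proof eventually_elim
          case (elim x)
          have "c * u t x $ k \<le> \<bar>c * u t x $ k\<bar>" by simp
          also have "\<dots> \<le> norm (u t x)" using c component_le_norm_cart[of "u t x" k] by (simp add: abs_mult)
          finally show ?case using elim by (simp add: indicator_def)
        qed
      qed
      also have "\<dots> = N * measure lebesgue E" by simp
      finally show ?thesis .
    qed
    \<comment> \<open>Almost every time before \<open>T\<close> in the given interval is good, so
      good times accumulate at \<open>T\<close>; dividing by \<open>Suc n\<close> keeps them all in
      that interval.\<close>
    have "\<exists>s. T - d / real (Suc n) < s \<and> s < T \<and> (AE x in lborel. norm (u s x) \<le> N)" for n
    proof -
      have "d / real (Suc n) \<le> d" using d by (simp add: divide_le_eq)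
      moreover have "0 < d / real (Suc n)" using d by simp
      ultimately show ?thesis using good_time_exists[OF bd, of "T - d / real (Suc n)" T] by force
    qed
    then obtain s where s: "\<And>n. T - d / real (Suc n) < s n" "\<And>n. s n < T" "\<And>n. AE x in lborel. norm (u (s n) x) \<le> N"
      by metis
    have s0: "0 < s n" for n
    proof -
      have "d / real (Suc n) \<le> d" using d by (simp add: divide_le_eq)
      then show ?thesis using s(1)[of n] d by linarith
    qed
    have slim: "s \<longlonglongrightarrow> T"
    proof (rule tendsto_sandwich)
      show "\<forall>\<^sub>F n in sequentially. T - d / real (Suc n) \<le> s n" using s(1) by (intro always_eventually allI less_imp_le)
      show "\<forall>\<^sub>F n in sequentially. s n \<le> T" using s(2) by (intro always_eventually allI less_imp_le)
      have "(\<lambda>n. T - d * (1 / real (Suc n))) \<longlonglongrightarrow> T - d * 0"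
        by (intro tendsto_intros lim_1_over_n[THEN LIMSEQ_Suc])
      then show "(\<lambda>n. T - d / real (Suc n)) \<longlonglongrightarrow> T" by simp
    qed simp
    have "(\<lambda>n. g (s n)) \<longlonglongrightarrow> g T"
      by (rule continuous_on_tendsto_compose[OF gcont slim]) (use T s0 in auto)
    then have gT: "g T \<le> N * measure lebesgue E"
      by (rule LIMSEQ_le_const2) (use gle[OF s0 s(3)] in blast)
    have hint: "integrable lebesgue (\<lambda>x. indicat_real E x * (c * u T x $ k) - N * indicat_real E x)"
      by (intro Bochner_Integration.integrable_diff uint T integrable_mult_right Eint)
    have hnn: "0 \<le> indicat_real E x * (c * u T x $ k) - N * indicat_real E x" for x
      by (auto simp: E_def indicator_def)
    have eqT: "(\<integral>x. indicat_real E x * (c * u T x $ k) - N * indicat_real E x \<partial>lebesgue) = g T - N * measure lebesgue E"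
      unfolding g_def by (subst Bochner_Integration.integral_diff[OF uint[OF T] integrable_mult_right[OF Eint]]) simp
    \<comment> \<open>The integrand is strictly positive on \<open>E\<close> and zero elsewhere,
      while the limit shows that its integral is at most 0.\<close>
    have "(\<integral>x. indicat_real E x * (c * u T x $ k) - N * indicat_real E x \<partial>lebesgue) = 0"
    proof -
      have "0 \<le> (\<integral>x. indicat_real E x * (c * u T x $ k) - N * indicat_real E x \<partial>lebesgue)"
        by (intro Bochner_Integration.integral_nonneg hnn)
      with eqT gT show ?thesis by linarith
    qed
    then have "AE x in lebesgue. indicat_real E x * (c * u T x $ k) - N * indicat_real E x = 0"
      by (rule integral_nonneg_eq_0_iff_AE[OF hint AE_I2, THEN iffD1, rotated]) (rule hnn)
    then show ?thesis by eventually_elim (auto simp: E_def indicator_def)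
  qed
  then have "AE x in lebesgue. \<forall>n. x \<in> cball 0 (real n) \<longrightarrow> c * u T x $ k \<le> N"
    unfolding AE_all_countable by blast
  then show ?thesis
  proof eventually_elim
    case (elim x)
    obtain n where "norm x \<le> real n" using real_arch_simple by blast
    then show ?case using elim by auto
  qed
qed

text \<open>The component bound is used for the six signed components, with one null set for each;
  returning to the Euclidean norm through the l1 norm costs the factor 3.\<close>

lemma weak_limit_esssup:
  fixes u :: "real \<Rightarrow> real^3 \<Rightarrow> real^3"
  assumes wc: "weakly_continuous_L2 u" and T: "0 < T" and d: "0 < d" "d < T"
    and bd: "AE s in lborel. T - d < s \<and> s < T \<longrightarrow> (AE x in lborel. norm (u s x) \<le> N)"
  shows "esssup lebesgue (\<lambda>x. ennreal (norm (u T x))) \<le> ennreal (3 * N)"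
proof (rule esssup_I)
  have "u T \<in> borel_measurable lebesgue" using wc T by (simp add: weakly_continuous_L2_def L2_def)
  then show "(\<lambda>x. ennreal (norm (u T x))) \<in> borel_measurable lebesgue" by measurable
  have "AE x in lebesgue. \<forall>k\<in>(UNIV::3 set). \<forall>c\<in>{1, -1}. c * u T x $ k \<le> N"
    by (intro AE_finite_allI weak_limit_component_le[OF wc T d bd]) auto
  then show "AE x in lebesgue. ennreal (norm (u T x)) \<le> ennreal (3 * N)"
  proof eventually_elim
    case (elim x)
    have "\<bar>u T x $ k\<bar> \<le> N" for k using elim by (auto simp: abs_le_iff)
    then have "(\<Sum>k\<in>(UNIV::3 set). \<bar>u T x $ k\<bar>) \<le> (\<Sum>k\<in>(UNIV::3 set). N)" by (intro sum_mono)
    then have "norm (u T x) \<le> 3 * N" using norm_le_l1_cart[of "u T x"] by simp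
    then show ?case by (rule ennreal_leI)
  qed
qed

theorem proposition1p1:
  fixes lam :: real
  assumes "0 < lam" and "lam < 2"
  shows "\<exists>A>0. \<forall>u. NS_solution u \<longrightarrow> (\<forall>T>lam.
           esssup lebesgue (\<lambda>x. ennreal (norm (u T x)))
             \<le> ennreal A * (1 + (\<integral>\<^sup>+s\<in>{0<..<T}. (\<integral>\<^sup>+x. ennreal ((norm (u s x)) ^ 6) \<partial>lebesgue) \<partial>lebesgue)))"
proof -
  obtain B where B: "0 < B" "\<And>U T I. pressure_free_flow U \<Longrightarrow> lam < T \<Longrightarrow> 0 \<le> I \<Longrightarrow>
    (\<integral>\<^sup>+z. ennreal (norm (U z) ^ 6) * indicator {z. 0 < fst z \<and> fst z < T} z \<partial>lborel) \<le> ennreal I \<Longrightarrow>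
    (\<exists>d>0. d < T \<and> (AE z in lborel. T - d < fst z \<and> fst z < T \<longrightarrow> norm (U z) \<le> B * (1 + I)))"
    using interior_bound[OF assms(1)] by blast
  have "esssup lebesgue (\<lambda>x. ennreal (norm (u T x)))
     \<le> ennreal (3 * B) * (1 + (\<integral>\<^sup>+s\<in>{0<..<T}. (\<integral>\<^sup>+x. ennreal ((norm (u s x)) ^ 6) \<partial>lebesgue) \<partial>lebesgue))"
    if sol: "NS_solution u" and T: "lam < T" for u T
  proof -
    define K where "K = (\<integral>\<^sup>+s\<in>{0<..<T}. (\<integral>\<^sup>+x. ennreal ((norm (u s x)) ^ 6) \<partial>lebesgue) \<partial>lebesgue)"
    have T0: "0 < T" using T assms(1) by simp
    obtain U where U: "pressure_free_flow U" "AE z in lborel. 0 < fst z \<longrightarrow> U z = u (fst z) (snd z)"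
      using NS_solution_flow[OF sol] by blast
    interpret pressure_free_flow U by (rule U(1))
    have [measurable]: "{z::real \<times> (real^3). 0 < fst z \<and> fst z < T} \<in> sets borel"
      by (intro borel_open open_Collect_conj open_Collect_less continuous_intros)
    \<comment> \<open>Tonelli in space-time: for almost every time the slices of \<open>U\<close>
      and \<open>u\<close> agree almost everywhere, so the Borel copy has the iterated integral of
      the sixth power of \<open>u\<close>.\<close>
    have K: "(\<integral>\<^sup>+z. ennreal (norm (U z) ^ 6) * indicator {z. 0 < fst z \<and> fst z < T} z \<partial>lborel) = K"
    proof -
      have "(\<integral>\<^sup>+z. ennreal (norm (U z) ^ 6) * indicator {z. 0 < fst z \<and> fst z < T} z \<partial>lborel)
        = (\<integral>\<^sup>+t. \<integral>\<^sup>+x. ennreal (norm (U (t, x)) ^ 6) * indicator {z. 0 < fst z \<and> fst z < T} (t, x) \<partial>lborel \<partial>lborel)"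
        by (rule nn_integral_spacetime) measurable
      also have "\<dots> = (\<integral>\<^sup>+s. (\<integral>\<^sup>+x. ennreal ((norm (u s x)) ^ 6) \<partial>lebesgue) * indicator {0<..<T} s \<partial>lborel)"
      proof (rule nn_integral_cong_AE)
        show "AE t in lborel. (\<integral>\<^sup>+x. ennreal (norm (U (t, x)) ^ 6) * indicator {z. 0 < fst z \<and> fst z < T} (t, x) \<partial>lborel)
          = (\<integral>\<^sup>+x. ennreal ((norm (u t x)) ^ 6) \<partial>lebesgue) * indicator {0<..<T} t"
          using AE_spacetime_slices[OF U(2)]
        proof eventually_elim
          case (elim t)
          show ?case
          proof (cases "0 < t \<and> t < T")
            case True
            have "(\<integral>\<^sup>+x. ennreal (norm (U (t, x)) ^ 6) * indicator {z. 0 < fst z \<and> fst z < T} (t, x) \<partial>lborel) = (\<integral>\<^sup>+x. ennreal ((norm (u t x)) ^ 6) \<partial>lborel)"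
              by (rule nn_integral_cong_AE) (use elim True in auto)
            also have "\<dots> = (\<integral>\<^sup>+x. ennreal ((norm (u t x)) ^ 6) \<partial>lebesgue)" by (rule nn_integral_completion[symmetric])
            finally show ?thesis using True by simp
          next
            case False
            then have "(t, x) \<notin> {z. 0 < fst z \<and> fst z < T}" "t \<notin> {0<..<T}" for x :: "real^3" by auto
            then show ?thesis by simp
          qed
        qed
      qed
      also have "\<dots> = K" unfolding K_def by (rule nn_integral_completion[symmetric])
      finally show ?thesis .
    qed
    show ?thesis
    \<comment> \<open>With an infinite integral the right side is infinite, because the constant is
      positive; otherwise \<open>I\<close> may be taken as its real value.\<close>
    proof (cases "K = \<infinity>")
      case True
      then show ?thesis unfolding K_def[symmetric] using B(1) by (simp add: ennreal_mult_top)
    next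
      case False
      define I where "I = enn2real K"
      have I: "K = ennreal I" "0 \<le> I" using False by (auto simp: I_def ennreal_enn2real_if)
      obtain d where d: "0 < d" "d < T" "AE z in lborel. T - d < fst z \<and> fst z < T \<longrightarrow> norm (U z) \<le> B * (1 + I)"
        using B(2)[OF U(1) T I(2)] K I(1) by auto
      have "AE z in lborel. T - d < fst z \<and> fst z < T \<longrightarrow> norm (u (fst z) (snd z)) \<le> B * (1 + I)"
        using d(3) U(2)
      proof eventually_elim
        case (elim z)
        show ?case
        proof
          assume z: "T - d < fst z \<and> fst z < T"
          then have "0 < fst z" using d(2) by linarith
          then show "norm (u (fst z) (snd z)) \<le> B * (1 + I)" using elim z by simp
        qed
      qed
      from AE_spacetime_slices[OF this]
      have bd: "AE s in lborel. T - d < s \<and> s < T \<longrightarrow> (AE x in lborel. norm (u s x) \<le> B * (1 + I))"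
        by eventually_elim auto
      have wc: "weakly_continuous_L2 u" using sol by (simp add: NS_solution_def)
      have "esssup lebesgue (\<lambda>x. ennreal (norm (u T x))) \<le> ennreal (3 * (B * (1 + I)))"
        by (rule weak_limit_esssup[OF wc T0 d(1,2) bd])
      also have "\<dots> = ennreal (3 * B * (1 + I))" by (simp only: mult.assoc)
      also have "\<dots> = ennreal (3 * B) * (1 + K)"
        unfolding I(1) using B(1) I(2) by (subst ennreal_mult) (auto simp: ennreal_plus ennreal_1[symmetric] simp del: ennreal_1)
      finally show ?thesis unfolding K_def .
    qed
  qed
  then show ?thesis using B(1) by (intro exI[of _ "3 * B"]) auto
qed

end
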